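(* Let $\Psi$ be a reward-based objective which is solvable in $\mathcal{O}(f(|S|,|E|,\max_\varrho,\dim_\varrho))$ time for every finite-state game $\mathsf{G}=(S,(S_\Box,S_\Diamond),E)$ and every reward function $\varrho$ for $\Psi$. Let $\Delta$ be a window-stability multi-objective. Then the objective $\Delta\wedge\Psi$ is solvable in time \[\mathcal{O}\big(\max\{f(|S|\cdot M_\Delta,|E|\cdot M_\Delta,\max_\varrho,\dim_\varrho),\ |S|^2\cdot|E|\cdot M_\Delta^2\}\big)\] for every finite-state game $\mathsf{G}=(S,(S_\Box,S_\Diamond),E)$ and every reward function $\varrho$ for $\Psi$.
   Context: A game is $\mathsf{G}=(S,(S_\Box,S_\Diamond),E)$ with a non-empty set $S$ of states partitioned into $S_\Box$ (Player $\Box$) and $S_\Diamond$ (Player $\Diamond$), edges $E\subseteq S\times S$, every state having an outgoing edge; finite-state if $S$ is finite. A run is an infinite path; an objective is a Borel set of runs; conjunction is intersection. A strategy of Player $\odot$ is $\tau:S^*S_\odot\to S$ with $(s,\tau(hs))\in E$; a pair of strategies $(\sigma,\pi)$ of $\Box,\Diamond$ and a state $s$ induce a unique run $\mathit{Outcome}(\sigma,\pi,s)$. $\sigma$ achieves $\Phi$ in $s$ if $\mathit{Outcome}(\sigma,\pi,s)\in\Phi$ for every strategy $\pi$ of $\Diamond$; $\Sigma^\Phi(s)$ is the set of such $\sigma$. An objective $\Phi$ is solvable (in a given time) if there is an algorithm (running within that time) which, given a finite-state game $\mathsf{G}$ and a state $s$, decides whether $\Sigma^\Phi(s)=\emptyset$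 and, if not, outputs a finite description of some $\sigma\in\Sigma^\Phi(s)$. A reward function is $\varrho:S\to\mathbb{N}_0^k$; $\dim_\varrho=k$ and $\max_\varrho=\max\{\varrho(s)[i]\mid 1\le i\le k,s\in S\}$. An objective is reward-based if membership of a run depends only on the sequence of rewards of the visited states. For $W,D\in\mathbb{N}$ with $D\mid W$ and a run $\lambda=s_0s_1\dots$, $\mathit{lmp}_{W,D,\varrho,\ell}(\lambda)=\frac1W\sum_{i=0}^{W-1}\varrho(s_{\ell D+i})$. A window-stability objective $(W,D,\varrho,\mu,\nu)$, $\mu,\nu\in\mathbb{Q}^k$, is the set of runs $\lambda$ with $\mu\le\mathit{lmp}_{W,D,\varrho,\ell}(\lambda)\le\nu$ componentwise for all $\ell\in\mathbb{N}_0$. A window-stability multi-objective is a finite conjunction $\Delta=\Phi_1\wedge\cdots\wedge\Phi_n$ of window-stability objectives $\Phi_i=(W_i,D_i,\varrho_i,\mu_i,\nu_i)$ (each with its own reward function $\varrho_i$ of dimension $k_i$), and $M_\Delta=\prod_{i=1}^n W_i\cdot(\max_{\varrho_i}\cdot W_i)^{k_i\cdot(W_i/D_i)}$.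
   Formalization: The bound f is assumed nondecreasing in each argument, and in M_Δ each max_{ϱ_i} is replaced by max(1, max_{ϱ_i}), since otherwise M_Δ and the time bound collapse when a reward function is identically zero. *)

theory Defs
  imports "HOL-Analysis.Analysis"
begin

section \<open>Games\<close>

record 's game =
  states :: "'s set"
  boxes :: "'s set"
  diamonds :: "'s set"
  edges :: "('s \<times> 's) set"

definition game :: "'s game \<Rightarrow> bool" where
  "game G \<longleftrightarrow>
     states G \<noteq> {} \<and>
     boxes G \<union> diamonds G = states G \<and> boxes G \<inter> diamonds G = {} \<and>
     edges G \<subseteq> states G \<times> states G \<and>
     (\<forall>s \<in> states G. \<exists>s'. (s, s') \<in> edges G)"

definition runs :: "'s game \<Rightarrow> (nat \<Rightarrow> 's) set" where
  "runs G = {r. \<forall>i. r i \<in> states G \<and> (r i, r (Suc i)) \<in> edges G}"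

text \<open>A word of $S^* S_\odot$ is a list \<open>h @ [s]\<close> with the current state last;
  values on all other lists are irrelevant.\<close>

definition strategy :: "'s game \<Rightarrow> 's set \<Rightarrow> ('s list \<Rightarrow> 's) \<Rightarrow> bool" where
  "strategy G P \<tau> \<longleftrightarrow>
     (\<forall>h s. set h \<subseteq> states G \<and> s \<in> P \<longrightarrow> (s, \<tau> (h @ [s])) \<in> edges G)"

primrec history :: "'s game \<Rightarrow> ('s list \<Rightarrow> 's) \<Rightarrow> ('s list \<Rightarrow> 's) \<Rightarrow> 's \<Rightarrow> nat \<Rightarrow> 's list" where
  "history G \<sigma> \<pi> s 0 = [s]"
| "history G \<sigma> \<pi> s (Suc n) =
     (let h = history G \<sigma> \<pi> s n
      in h @ [if last h \<in> boxes G then \<sigma> h else \<pi> h])"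

definition outcome :: "'s game \<Rightarrow> ('s list \<Rightarrow> 's) \<Rightarrow> ('s list \<Rightarrow> 's) \<Rightarrow> 's \<Rightarrow> nat \<Rightarrow> 's" where
  "outcome G \<sigma> \<pi> s n = last (history G \<sigma> \<pi> s n)"

definition winning :: "'s game \<Rightarrow> (nat \<Rightarrow> 's) set \<Rightarrow> 's \<Rightarrow> ('s list \<Rightarrow> 's) set" where
  "winning G \<Phi> s =
     {\<sigma>. strategy G (boxes G) \<sigma> \<and>
          (\<forall>\<pi>. strategy G (diamonds G) \<pi> \<longrightarrow> outcome G \<sigma> \<pi> s \<in> \<Phi>)}"


section \<open>Rewards and objectives\<close>

text \<open>A reward function is given together with its dimension.\<close>

type_synonym 's reward = "nat \<times> ('s \<Rightarrow> nat list)"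

abbreviation rdim :: "'s reward \<Rightarrow> nat" where "rdim \<equiv> fst"
abbreviation rew :: "'s reward \<Rightarrow> 's \<Rightarrow> nat list" where "rew \<equiv> snd"

definition reward_function :: "'s game \<Rightarrow> 's reward \<Rightarrow> bool" where
  "reward_function G \<rho> \<longleftrightarrow> 0 < rdim \<rho> \<and> (\<forall>s \<in> states G. length (rew \<rho> s) = rdim \<rho>)"

definition max_reward :: "'s game \<Rightarrow> 's reward \<Rightarrow> nat" where
  "max_reward G \<rho> = Max {rew \<rho> s ! i | s i. s \<in> states G \<and> i < rdim \<rho>}"

text \<open>A reward-based objective is a set of reward sequences. The set \<open>K\<close> collects the dimensions
  of the reward functions to which the objective applies, so that both objectives of one fixed
  dimension and objectives making sense in all dimensions are covered.
  On \<open>nat \<Rightarrow> nat\<close>, \<open>borel\<close> is generated by the product of the discrete topologies.\<close>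

definition reward_objective :: "(nat \<Rightarrow> nat list) set \<Rightarrow> 's game \<Rightarrow> 's reward \<Rightarrow> (nat \<Rightarrow> 's) set" where
  "reward_objective \<Psi> G \<rho> = {r \<in> runs G. (\<lambda>i. rew \<rho> (r i)) \<in> \<Psi>}"

definition reward_based :: "nat set \<Rightarrow> (nat \<Rightarrow> nat list) set \<Rightarrow> bool" where
  "reward_based K \<Psi> \<longleftrightarrow>
     (\<forall>(G :: nat game) \<rho>. game G \<and> reward_function G \<rho> \<and> rdim \<rho> \<in> K
        \<longrightarrow> reward_objective \<Psi> G \<rho> \<in> sets borel)"

text \<open>The part of a window-stability objective $(W,D,\varrho,\mu,\nu)$ that does not refer to
  the game, i.e. everything except $\varrho$.\<close>

record window =
  win_len :: nat
  win_step :: nat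
  lower :: "rat list"
  upper :: "rat list"

abbreviation win_dim :: "window \<Rightarrow> nat" where "win_dim w \<equiv> length (lower w)"

definition window :: "window \<Rightarrow> bool" where
  "window w \<longleftrightarrow> 0 < win_len w \<and> 0 < win_step w \<and> win_step w dvd win_len w \<and>
     length (upper w) = length (lower w)"

definition lmp :: "nat \<Rightarrow> nat \<Rightarrow> 's reward \<Rightarrow> nat \<Rightarrow> (nat \<Rightarrow> 's) \<Rightarrow> nat \<Rightarrow> rat" where
  "lmp W D \<rho> l r i = (\<Sum>j<W. of_nat (rew \<rho> (r (l * D + j)) ! i)) / of_nat W"

definition window_objective :: "'s game \<Rightarrow> window \<Rightarrow> 's reward \<Rightarrow> (nat \<Rightarrow> 's) set" where
  "window_objective G w \<rho> =
     {r \<in> runs G. \<forall>l. \<forall>i < win_dim w.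
        lower w ! i \<le> lmp (win_len w) (win_step w) \<rho> l r i \<and>
        lmp (win_len w) (win_step w) \<rho> l r i \<le> upper w ! i}"

definition multi_objective :: "'s game \<Rightarrow> window list \<Rightarrow> 's reward list \<Rightarrow> (nat \<Rightarrow> 's) set" where
  "multi_objective G ws \<rho>s =
     {r \<in> runs G. \<forall>i < length ws. r \<in> window_objective G (ws ! i) (\<rho>s ! i)}"

text \<open>The maximal reward is replaced by 1 if it is 0: otherwise the whole product would vanish as
  soon as one of the reward functions is identically zero.\<close>

definition M_of :: "'s game \<Rightarrow> window list \<Rightarrow> 's reward list \<Rightarrow> nat" where
  "M_of G ws \<rho>s =
     (\<Prod>i<length ws. let W = win_len (ws ! i); D = win_step (ws ! i); \<rho> = \<rho>s ! i
        in W * (max 1 (max_reward G \<rho>) * W) ^ (rdim \<rho> * (W div D)))"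


section \<open>Machine model\<close>

text \<open>Unit-cost random access machine with addition and truncated subtraction, programmed by
  while-programs. The memory consists of infinitely many arrays of natural numbers; a scalar
  variable is the cell with index 0 of an array. \<open>Print\<close> appends to a write-only output tape.\<close>

type_synonym memory = "nat \<Rightarrow> nat \<Rightarrow> nat"
type_synonym config = "memory \<times> nat list"

datatype prog =
    Skip
  | Const nat nat
  | Add nat nat nat
  | Sub nat nat nat
  | Load nat nat nat
  | Store nat nat nat
  | Print nat
  | Seq prog prog
  | If nat prog prog
  | While nat prog

definition put :: "memory \<Rightarrow> nat \<Rightarrow> nat \<Rightarrow> nat \<Rightarrow> memory" where
  "put m a i v = m(a := (m a)(i := v))"

text \<open>\<open>exec p c t c'\<close>: started in \<open>c\<close>, the program \<open>p\<close> halts in \<open>c'\<close> after \<open>t\<close> steps.\<close>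

inductive exec :: "prog \<Rightarrow> config \<Rightarrow> nat \<Rightarrow> config \<Rightarrow> bool" where
  Skip: "exec Skip c 1 c"
| Const: "exec (Const x v) (m, out) 1 (put m x 0 v, out)"
| Add: "exec (Add x y z) (m, out) 1 (put m x 0 (m y 0 + m z 0), out)"
| Sub: "exec (Sub x y z) (m, out) 1 (put m x 0 (m y 0 - m z 0), out)"
| Load: "exec (Load x a y) (m, out) 1 (put m x 0 (m a (m y 0)), out)"
| Store: "exec (Store a x y) (m, out) 1 (put m a (m x 0) (m y 0), out)"
| Print: "exec (Print x) (m, out) 1 (m, out @ [m x 0])"
| Seq: "exec p c t c' \<Longrightarrow> exec q c' t' c'' \<Longrightarrow> exec (Seq p q) c (t + t') c''"
| If_True: "m x 0 \<noteq> 0 \<Longrightarrow> exec p (m, out) t c \<Longrightarrow> exec (If x p q) (m, out) (Suc t) c"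
| If_False: "m x 0 = 0 \<Longrightarrow> exec q (m, out) t c \<Longrightarrow> exec (If x p q) (m, out) (Suc t) c"
| While_True: "m x 0 \<noteq> 0 \<Longrightarrow> exec p (m, out) t c \<Longrightarrow> exec (While x p) c t' c' \<Longrightarrow>
    exec (While x p) (m, out) (Suc (t + t')) c'"
| While_False: "m x 0 = 0 \<Longrightarrow> exec (While x p) (m, out) 1 (m, out)"

lemma exec_deterministic:
  "exec p c t c' \<Longrightarrow> exec p c u d \<Longrightarrow> u = t \<and> d = c'"
proof (induction arbitrary: u d rule: exec.induct)
  case (Seq p c t c' q t' c'')
  from Seq.prems obtain t1 c1 t2 where "exec p c t1 c1" "exec q c1 t2 d" "u = t1 + t2"
    by cases
  with Seq.IH show ?case by metis
next
  case (If_True m x p out t c q)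
  from If_True.prems If_True.hyps obtain t1 where "exec p (m, out) t1 d" "u = Suc t1"
    by cases simp_all
  with If_True.IH show ?case by metis
next
  case (If_False m x q out t c p)
  from If_False.prems If_False.hyps obtain t1 where "exec q (m, out) t1 d" "u = Suc t1"
    by cases simp_all
  with If_False.IH show ?case by metis
next
  case (While_True m x p out t c t' c')
  from While_True.prems While_True.hyps obtain t1 c1 t2
    where "exec p (m, out) t1 c1" "exec (While x p) c1 t2 d" "u = Suc (t1 + t2)"
    by cases simp_all
  with While_True.IH show ?case by metis
next
  case (While_False m x p out)
  from While_False.prems While_False.hyps show ?case by cases simp_all
qed (erule exec.cases; simp)+


section \<open>Solvability\<close>

text \<open>The states of an input game are numbered \<open>0, \<dots>, |S| - 1\<close>. The successors of \<open>v\<close> are listed,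
  in any order, in array 3 between the positions \<open>m 2 v\<close> and \<open>m 2 (Suc v)\<close>. The \<open>j\<close>-th reward
  function uses array \<open>4 + 2 * j\<close> for references to the reward vectors, which are stored in array
  \<open>5 + 2 * j\<close>; states may share a reward vector, so that a game can be expanded into a larger one
  without copying reward vectors. Nothing is assumed about the unused cells of the
  input arrays, and all further arrays are initially zero.\<close>

definition represents :: "memory \<Rightarrow> nat game \<Rightarrow> nat \<Rightarrow> nat reward list \<Rightarrow> bool" where
  "represents m G s \<rho>s \<longleftrightarrow>
     states G = {..<m 0 0} \<and> m 0 1 = s \<and>
     (\<forall>j < length \<rho>s. m 0 (2 + j) = rdim (\<rho>s ! j)) \<and>
     (\<forall>v \<in> states G. m 1 v = (if v \<in> boxes G then 1 else 0)) \<and>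
     m 2 0 = 0 \<and>
     (\<forall>v \<in> states G. m 2 v \<le> m 2 (Suc v) \<and>
        distinct (map (m 3) [m 2 v..<m 2 (Suc v)]) \<and>
        set (map (m 3) [m 2 v..<m 2 (Suc v)]) = {w. (v, w) \<in> edges G}) \<and>
     (\<forall>j < length \<rho>s. \<forall>v \<in> states G.
        map (\<lambda>i. m (5 + 2 * j) (m (4 + 2 * j) v + i)) [0..<rdim (\<rho>s ! j)] = rew (\<rho>s ! j) v) \<and>
     (\<forall>a \<ge> 4 + 2 * length \<rho>s. \<forall>i. m a i = 0)"

text \<open>A finite description of a strategy is a finite word \<open>d\<close> from which a program \<open>q\<close>, that
  depends neither on the game nor on the rewards, computes the moves of the strategy.\<close>

definition move_input :: "nat list \<Rightarrow> nat list \<Rightarrow> memory" where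
  "move_input d h a i =
     (if a = 0 then (if i = 0 then length d else if i = 1 then length h else 0)
      else if a = 1 \<and> i < length d then d ! i
      else if a = 2 \<and> i < length h then h ! i
      else 0)"

definition describes :: "prog \<Rightarrow> nat list \<Rightarrow> nat game \<Rightarrow> (nat list \<Rightarrow> nat) \<Rightarrow> bool" where
  "describes q d G \<sigma> \<longleftrightarrow>
     (\<forall>h s. set h \<subseteq> states G \<and> s \<in> boxes G \<longrightarrow>
        (\<exists>t m. exec q (move_input d (h @ [s]), []) t (m, [\<sigma> (h @ [s])])))"

text \<open>An objective assigns a set of runs to a game, a main reward function \<open>\<rho>\<close> with dimension in
  \<open>K\<close>, and a list \<open>\<rho>s\<close> of further reward functions with dimensions \<open>ks\<close>. A solver answers \<open>0\<close> if
  Player \<open>\<box>\<close> has no winning strategy, and \<open>1\<close> followed by a description of one otherwise.\<close>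

definition solvable_within ::
  "nat set \<Rightarrow> nat list \<Rightarrow>
   (nat game \<Rightarrow> nat reward \<Rightarrow> nat reward list \<Rightarrow> (nat \<Rightarrow> nat) set) \<Rightarrow>
   (nat game \<Rightarrow> nat reward \<Rightarrow> nat reward list \<Rightarrow> real) \<Rightarrow> bool" where
  "solvable_within K ks \<Phi> T \<longleftrightarrow>
     (\<exists>p q. \<forall>G s \<rho> \<rho>s m.
        game G \<and> finite (states G) \<and> s \<in> states G \<and>
        reward_function G \<rho> \<and> rdim \<rho> \<in> K \<and>
        (\<forall>\<rho>' \<in> set \<rho>s. reward_function G \<rho>') \<and> map rdim \<rho>s = ks \<and>
        represents m G s (\<rho> # \<rho>s)
        \<longrightarrow> (\<exists>t m' out.
              exec p (m, []) t (m', out) \<and> real t \<le> T G \<rho> \<rho>s \<and>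
              (if winning G (\<Phi> G \<rho> \<rho>s) s = {} then out = [0]
               else \<exists>d. out = 1 # d \<and> (\<exists>\<sigma> \<in> winning G (\<Phi> G \<rho> \<rho>s) s. describes q d G \<sigma>))))"

end

(*
A run of the game determines a run of a deterministic monitor, which stores for every window
objective the position in the current window and, for each of the W/D overlapping windows and each
dimension, the reward collected so far. The product of the game with the monitor has |S| M states, at
most |E| M edges and the same rewards, and a run satisfies Delta iff its lift avoids the violating
states of the product. Let A be the attractor of Player Diamond to these states. If the initial state
is in A, then Delta cannot be achieved. Otherwise forbid the edges that enter A from outside: in the
remaining game all runs from the initial state satisfy Delta, so that it remains to solve it for Psi.
As the monitor is deterministic, strategies can be transferred in both directions.

The tables of the monitor are computed digit by digit, in time linear in |S| M per digit. The number of
digits depends on the window lengths, but each of these is at most M, so that the constant only depends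
on the dimensions. Computing the attractor naively takes at most |S| M + 1 passes over |S| M states with
at most |S| successors each, and |S| <= |E| because every state has an outgoing edge.
*)

theory Submission
  imports Defs
begin

section \<open>A weakest precondition calculus with time bounds\<close>

text \<open>The product is never stored as a set of pairs. A product state is a number whose
  remainder modulo the number of game states is the game state and whose higher part codes the
  monitor state. Its successors are then the adjacency list of the game state shifted by one table
  entry, and the initial state keeps its number because the monitor starts with code 0. Attractor
  states stay in the game although they are losing: the states of an input must be numbered
  contiguously and each needs an outgoing edge. Dropping only the edges that enter the attractor
  makes it unreachable from outside. The digits hold the rewards collected before the current state,
  that is fewer than W of them, which is why the maximal reward times W suffices as radix. A window
  is judged at its last state by adding the reward of that state. Solvability speaks of concrete
  programs, so the given solver and strategy program must run as subroutines in a memory that is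
  partly occupied. Renaming their arrays achieves this at the price of a factor 2. As a strategy
  program must not depend on the game, the monitor table travels in the description.\<close>

definition wp :: "prog \<Rightarrow> nat \<Rightarrow> (memory \<Rightarrow> nat list \<Rightarrow> bool) \<Rightarrow> memory \<Rightarrow> nat list \<Rightarrow> bool" where
  "wp p t Q m out \<longleftrightarrow> (\<exists>t' m' out'. t' \<le> t \<and> exec p (m, out) t' (m', out') \<and> Q m' out')"

lemma wp_mono:
  assumes "wp p t Q m out" "\<And>m' out'. Q m' out' \<Longrightarrow> R m' out'" "t \<le> t'"
  shows "wp p t' R m out"
  using assms unfolding wp_def by (meson le_trans)

lemma wp_le: "wp p t Q m out \<Longrightarrow> t \<le> t' \<Longrightarrow> wp p t' Q m out"
  by (rule wp_mono)

lemma put_apply: "put m a i v b j = (if b = a \<and> j = i then v else m b j)"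
  by (simp add: put_def)

lemma wp_Seq:
  assumes "wp p t1 (\<lambda>m' out'. wp q t2 Q m' out') m out" "t1 + t2 \<le> t"
  shows "wp (Seq p q) t Q m out"
proof -
  from assms(1) obtain t' m' out' t'' m'' out'' where
    "t' \<le> t1" "exec p (m, out) t' (m', out')" "t'' \<le> t2" "exec q (m', out') t'' (m'', out'')" "Q m'' out''"
    unfolding wp_def by blast
  moreover from this assms(2) have "t' + t'' \<le> t" by simp
  ultimately show ?thesis unfolding wp_def using exec.Seq by blast
qed

inductive_cases exec_SkipE: "exec Skip c t c'"
inductive_cases exec_ConstE: "exec (Const x v) c t c'"
inductive_cases exec_AddE: "exec (Add x y z) c t c'"
inductive_cases exec_SubE: "exec (Sub x y z) c t c'"
inductive_cases exec_LoadE: "exec (Load x y z) c t c'"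
inductive_cases exec_StoreE: "exec (Store x y z) c t c'"
inductive_cases exec_PrintE: "exec (Print x) c t c'"
inductive_cases exec_SeqE: "exec (Seq p q) c t c'"
inductive_cases exec_IfE: "exec (If x p q) c t c'"

lemma exec_prim:
  "exec Skip c t c' \<longleftrightarrow> t = 1 \<and> c' = c"
  "exec (Const x v) (m, out) t c' \<longleftrightarrow> t = 1 \<and> c' = (put m x 0 v, out)"
  "exec (Add x y z) (m, out) t c' \<longleftrightarrow> t = 1 \<and> c' = (put m x 0 (m y 0 + m z 0), out)"
  "exec (Sub x y z) (m, out) t c' \<longleftrightarrow> t = 1 \<and> c' = (put m x 0 (m y 0 - m z 0), out)"
  "exec (Load x a y) (m, out) t c' \<longleftrightarrow> t = 1 \<and> c' = (put m x 0 (m a (m y 0)), out)"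
  "exec (Store a x y) (m, out) t c' \<longleftrightarrow> t = 1 \<and> c' = (put m a (m x 0) (m y 0), out)"
  "exec (Print x) (m, out) t c' \<longleftrightarrow> t = 1 \<and> c' = (m, out @ [m x 0])"
  by (auto intro: exec.intros[unfolded One_nat_def]
      elim: exec_SkipE exec_ConstE exec_AddE exec_SubE exec_LoadE exec_StoreE exec_PrintE)

lemma exec_Seq: "exec (Seq p q) c t c'' \<longleftrightarrow> (\<exists>t1 c' t2. exec p c t1 c' \<and> exec q c' t2 c'' \<and> t = t1 + t2)"
  by (blast intro: exec.intros elim: exec_SeqE)

lemma exec_If:
  "exec (If x p q) (m, out) t c \<longleftrightarrow> (\<exists>t'. t = Suc t' \<and> exec (if m x 0 \<noteq> 0 then p else q) (m, out) t' c)"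
  by (auto intro: exec.intros elim: exec_IfE)

lemma wp_prim:
  "wp Skip t Q m out \<longleftrightarrow> 0 < t \<and> Q m out"
  "wp (Const x v) t Q m out \<longleftrightarrow> 0 < t \<and> Q (put m x 0 v) out"
  "wp (Add x y z) t Q m out \<longleftrightarrow> 0 < t \<and> Q (put m x 0 (m y 0 + m z 0)) out"
  "wp (Sub x y z) t Q m out \<longleftrightarrow> 0 < t \<and> Q (put m x 0 (m y 0 - m z 0)) out"
  "wp (Load x a y) t Q m out \<longleftrightarrow> 0 < t \<and> Q (put m x 0 (m a (m y 0))) out"
  "wp (Store a x y) t Q m out \<longleftrightarrow> 0 < t \<and> Q (put m a (m x 0) (m y 0)) out"
  "wp (Print x) t Q m out \<longleftrightarrow> 0 < t \<and> Q m (out @ [m x 0])"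
  by (auto simp: wp_def exec_prim)

lemma wp_Seq_prim:
  "wp (Seq Skip q) t Q m out \<longleftrightarrow> 0 < t \<and> wp q (t - 1) Q m out"
  "wp (Seq (Const x v) q) t Q m out \<longleftrightarrow> 0 < t \<and> wp q (t - 1) Q (put m x 0 v) out"
  "wp (Seq (Add x y z) q) t Q m out \<longleftrightarrow> 0 < t \<and> wp q (t - 1) Q (put m x 0 (m y 0 + m z 0)) out"
  "wp (Seq (Sub x y z) q) t Q m out \<longleftrightarrow> 0 < t \<and> wp q (t - 1) Q (put m x 0 (m y 0 - m z 0)) out"
  "wp (Seq (Load x a y) q) t Q m out \<longleftrightarrow> 0 < t \<and> wp q (t - 1) Q (put m x 0 (m a (m y 0))) out"
  "wp (Seq (Store a x y) q) t Q m out \<longleftrightarrow> 0 < t \<and> wp q (t - 1) Q (put m a (m x 0) (m y 0)) out"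
  "wp (Seq (Print x) q) t Q m out \<longleftrightarrow> 0 < t \<and> wp q (t - 1) Q m (out @ [m x 0])"
  by (simp_all add: wp_def exec_prim exec_Seq) (cases t; auto; use Suc_le_mono in blast)+

lemma wp_If:
  "wp (If x p q) t Q m out \<longleftrightarrow> 0 < t \<and> (if m x 0 \<noteq> 0 then wp p (t - 1) Q m out else wp q (t - 1) Q m out)"
  by (simp add: wp_def exec_If; cases t; auto; use Suc_le_mono in blast)

lemma wp_Seq_If:
  "wp (Seq (If x p q) r) t Q m out \<longleftrightarrow>
    0 < t \<and> (if m x 0 \<noteq> 0 then wp (Seq p r) (t - 1) Q m out else wp (Seq q r) (t - 1) Q m out)"
  by (simp add: wp_def exec_If exec_Seq; cases t; auto; (use Suc_le_mono add_Suc in metis)?)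

lemma wp_Seq_assoc: "wp (Seq (Seq p q) r) t Q m out \<longleftrightarrow> wp (Seq p (Seq q r)) t Q m out"
  by (auto simp: wp_def exec_Seq) (metis add.assoc)+

text \<open>Rewriting with these equivalences executes loop-free code symbolically:
  \<open>wp_Seq_assoc\<close> and \<open>wp_Seq_If\<close> bring a primitive command to the front,
  and each command takes one unit from the budget. Loops and subprograms with their own
  specification go through \<open>wp_While\<close> and \<open>wp_Seq\<close>, where the split of the
  budget has to be chosen.\<close>

lemmas wps = wp_prim wp_Seq_prim wp_If wp_Seq_If wp_Seq_assoc

text \<open>\<open>\<mu>\<close> bounds the number of remaining iterations, each of which costs at
  most \<open>k\<close> for the body and 1 for the test; the last 1 pays for the failing
  test.\<close>

lemma wp_While:
  assumes "I m out"
    and step: "\<And>m out. I m out \<Longrightarrow> m x 0 \<noteq> 0 \<Longrightarrow> wp p k (\<lambda>m' out'. I m' out' \<and> \<mu> m' < \<mu> m) m out"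
    and exit: "\<And>m out. I m out \<Longrightarrow> m x 0 = 0 \<Longrightarrow> Q m out"
    and "\<mu> m * (k + 1) + 1 \<le> t"
  shows "wp (While x p) t Q m out"
  using assms(1,4)
proof (induction "\<mu> m" arbitrary: m out t rule: less_induct)
  case less
  show ?case
  proof (cases "m x 0 = 0")
    case True
    with exit less.prems show ?thesis unfolding wp_def by (meson add_leD2 exec.While_False)
  next
    case False
    from step[OF less.prems(1) False] obtain t1 m1 o1 where 1: "t1 \<le> k" "exec p (m, out) t1 (m1, o1)"
      "I m1 o1" "\<mu> m1 < \<mu> m" unfolding wp_def by blast
    have "wp (While x p) (\<mu> m1 * (k + 1) + 1) Q m1 o1"
      using less.hyps[OF 1(4) 1(3)] by simp
    then obtain t2 m2 o2 where 2: "t2 \<le> \<mu> m1 * (k + 1) + 1" "exec (While x p) (m1, o1) t2 (m2, o2)" "Q m2 o2"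
      unfolding wp_def by blast
    have "Suc (\<mu> m1) * (k + 1) \<le> \<mu> m * (k + 1)" using 1(4) by (intro mult_le_mono1) simp
    hence "Suc (t1 + t2) \<le> t" using 1(1) 2(1) less.prems(2) by simp
    then show ?thesis unfolding wp_def using exec.While_True[of m x, OF False 1(2) 2(2)] 2(3) by blast
  qed
qed

section \<open>Relocating a program\<close>

text \<open>Array \<open>a\<close> is moved to \<open>g a\<close>; the sum of all printed numbers is added to scalar \<open>s\<close>, which makes
  the output accessible to the surrounding program, and \<open>e\<close> tells whether the program still prints.\<close>

primrec relocate :: "bool \<Rightarrow> nat \<Rightarrow> (nat \<Rightarrow> nat) \<Rightarrow> prog \<Rightarrow> prog" where
  "relocate e s g Skip = Skip"
| "relocate e s g (Const x v) = Const (g x) v"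
| "relocate e s g (Add x y z) = Add (g x) (g y) (g z)"
| "relocate e s g (Sub x y z) = Sub (g x) (g y) (g z)"
| "relocate e s g (Load x a y) = Load (g x) (g a) (g y)"
| "relocate e s g (Store a x y) = Store (g a) (g x) (g y)"
| "relocate e s g (Print x) = Seq (if e then Print (g x) else Skip) (Add s s (g x))"
| "relocate e s g (Seq p q) = Seq (relocate e s g p) (relocate e s g q)"
| "relocate e s g (If x p q) = If (g x) (relocate e s g p) (relocate e s g q)"
| "relocate e s g (While x p) = While (g x) (relocate e s g p)"

text \<open>Recording the sum of the output suffices for both uses: a solver prints
  \<open>[0]\<close> or a list starting with 1, which the sum tells apart, and a strategy program
  prints a single number, which is its own sum.\<close>

definition relocated where
  "relocated e s g m out M Out m' out' M' Out' \<longleftrightarrow>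
     (\<forall>a. M' (g a) = m' a) \<and> (\<forall>b. b \<notin> range g \<and> b \<noteq> s \<longrightarrow> M' b = M b) \<and>
     (\<exists>ds. out' = out @ ds \<and> M' s 0 = M s 0 + sum_list ds \<and> Out' = (if e then Out @ ds else Out))"

lemma put_relocate:
  assumes "inj g" "\<And>a. M (g a) = m a" "x = g y"
  shows "put M x i v (g a) = put m y i v a"
  using assms by (auto simp: put_def dest: injD)

text \<open>Injectivity of \<open>g\<close> keeps renamed arrays apart, and \<open>s\<close> lies
  outside its range, so both runs proceed in lockstep. Only \<open>Print\<close> turns into two
  commands, which is the source of the factor 2.\<close>

lemma exec_relocate:
  assumes "inj g" "s \<notin> range g"
  shows "exec p c t c' \<Longrightarrow> c = (m, out) \<Longrightarrow> c' = (m', out') \<Longrightarrow> (\<And>a. M (g a) = m a) \<Longrightarrow>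
    \<exists>t' M' Out'. t' \<le> 2 * t \<and> exec (relocate e s g p) (M, Out) t' (M', Out') \<and>
      relocated e s g m out M Out m' out' M' Out'"
proof (induction arbitrary: m out m' out' M Out rule: exec.induct)
  case (Skip c)
  then show ?case by (auto simp: exec_prim relocated_def intro!: exI[of _ 1])
next
  case (Const x v m0 o0)
  then show ?case
    using assms
    by (auto simp: exec_prim relocated_def put_relocate intro!: exI[of _ 1]) (auto simp: put_def)
next
  case (Add x y z m0 o0)
  then show ?case
    using assms
    by (auto simp: exec_prim relocated_def put_relocate intro!: exI[of _ 1]) (auto simp: put_def)
next
  case (Sub x y z m0 o0)
  then show ?case
    using assms
    by (auto simp: exec_prim relocated_def put_relocate intro!: exI[of _ 1]) (auto simp: put_def)
next
  case (Load x a y m0 o0)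
  then show ?case
    using assms
    by (auto simp: exec_prim relocated_def put_relocate intro!: exI[of _ 1]) (auto simp: put_def)
next
  case (Store a x y m0 o0)
  then show ?case
    using assms
    by (auto simp: exec_prim relocated_def put_relocate intro!: exI[of _ 1]) (auto simp: put_def)
next
  case (Print x m0 o0)
  then show ?case
    using assms
    by (auto simp: exec_prim exec_Seq relocated_def intro!: exI[of _ 2])
      (auto simp: put_def)
next
  case (Seq p c t c1 q t' c2)
  obtain m1 o1 where c1: "c1 = (m1, o1)" by (cases c1)
  from Seq.IH(1)[OF Seq.prems(1) c1 Seq.prems(3)] obtain t1 M1 Out1 where
    1: "t1 \<le> 2 * t" "exec (relocate e s g p) (M, Out) t1 (M1, Out1)"
    "relocated e s g m out M Out m1 o1 M1 Out1" by blast
  then have "\<And>a. M1 (g a) = m1 a" by (simp add: relocated_def)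
  from Seq.IH(2)[OF c1 Seq.prems(2) this] obtain t2 M2 Out2 where
    2: "t2 \<le> 2 * t'" "exec (relocate e s g q) (M1, Out1) t2 (M2, Out2)"
    "relocated e s g m1 o1 M1 Out1 m' out' M2 Out2" by blast
  from 1(3) 2(3) have "relocated e s g m out M Out m' out' M2 Out2"
    by (auto simp: relocated_def)
  moreover from exec.Seq[OF 1(2) 2(2)] have "exec (relocate e s g (Seq p q)) (M, Out) (t1 + t2) (M2, Out2)"
    by simp
  moreover have "t1 + t2 \<le> 2 * (t + t')" using 1 2 by simp
  ultimately show ?case by blast
next
  case (If_True m0 x p o0 t c q)
  have eq: "m0 = m" "o0 = out" using If_True.prems(1) by simp_all
  from If_True.IH[where m=m and out=out and m'=m' and out'=out' and M=M and Out=Out] If_True.prems eq obtain t1 M1 Out1 where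
    1: "t1 \<le> 2 * t" "exec (relocate e s g p) (M, Out) t1 (M1, Out1)"
    "relocated e s g m out M Out m' out' M1 Out1" by blast
  have "exec (relocate e s g (If x p q)) (M, Out) (Suc t1) (M1, Out1)"
    using 1(2) If_True.hyps(1) If_True.prems(3) eq by (simp add: exec.If_True)
  then show ?case using 1 by (intro exI[of _ "Suc t1"] exI conjI) auto
next
  case (If_False m0 x q o0 t c p)
  have eq: "m0 = m" "o0 = out" using If_False.prems(1) by simp_all
  from If_False.IH[where m=m and out=out and m'=m' and out'=out' and M=M and Out=Out] If_False.prems eq obtain t1 M1 Out1 where
    1: "t1 \<le> 2 * t" "exec (relocate e s g q) (M, Out) t1 (M1, Out1)"
    "relocated e s g m out M Out m' out' M1 Out1" by blast
  have "exec (relocate e s g (If x p q)) (M, Out) (Suc t1) (M1, Out1)"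
    using 1(2) If_False.hyps(1) If_False.prems(3) eq by (simp add: exec.If_False)
  then show ?case using 1 by (intro exI[of _ "Suc t1"] exI conjI) auto
next
  case (While_True m0 x p o0 t c t' c2)
  have eq: "m0 = m" "o0 = out" using While_True.prems(1) by simp_all
  obtain m1 o1 where c1: "c = (m1, o1)" by (cases c)
  from While_True.IH(1)[where m=m and out=out and m'=m1 and out'=o1 and M=M and Out=Out] c1 While_True.prems eq obtain t1 M1 Out1 where
    1: "t1 \<le> 2 * t" "exec (relocate e s g p) (M, Out) t1 (M1, Out1)"
    "relocated e s g m out M Out m1 o1 M1 Out1" by blast
  then have "\<And>a. M1 (g a) = m1 a" by (simp add: relocated_def)
  from While_True.IH(2)[OF c1 While_True.prems(2) this] obtain t2 M2 Out2 where
    2: "t2 \<le> 2 * t'" "exec (relocate e s g (While x p)) (M1, Out1) t2 (M2, Out2)"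
    "relocated e s g m1 o1 M1 Out1 m' out' M2 Out2" by blast
  from 1(3) 2(3) have r: "relocated e s g m out M Out m' out' M2 Out2"
    by (auto simp: relocated_def)
  have "M (g x) 0 \<noteq> 0" using While_True.hyps(1) While_True.prems(3) eq by simp
  from exec.While_True[OF this 1(2)] 2(2)
  have "exec (relocate e s g (While x p)) (M, Out) (Suc (t1 + t2)) (M2, Out2)"
    by simp
  moreover have "Suc (t1 + t2) \<le> 2 * Suc (t + t')" using 1 2 by simp
  ultimately show ?case using r by blast
next
  case (While_False m0 x p o0)
  then show ?case
    using exec.While_False[of M "g x" "relocate e s g p" Out] by (auto simp: relocated_def intro!: exI[of _ 1])
qed

section \<open>Plays that are consistent with a strategy\<close>

text \<open>Describes plays against an arbitrary opponent without mentioning the strategy of the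
  opponent. Transferring a strategy of Player Box between two games then only requires transferring
  sequences of states.\<close>

definition consistent :: "'s game \<Rightarrow> ('s list \<Rightarrow> 's) \<Rightarrow> 's \<Rightarrow> (nat \<Rightarrow> 's) \<Rightarrow> nat \<Rightarrow> bool" where
  "consistent G \<sigma> s q n \<longleftrightarrow> q 0 = s \<and>
     (\<forall>j<n. (q j, q (Suc j)) \<in> edges G \<and> (q j \<in> boxes G \<longrightarrow> q (Suc j) = \<sigma> (map q [0..<Suc j])))"

text \<open>The opponent that reproduces \<open>q\<close> as long as the history is a prefix of
  \<open>q\<close>. The arbitrary choice elsewhere, and the test for an edge, make it a legal
  strategy for every \<open>q\<close>.\<close>

definition follow :: "'s game \<Rightarrow> (nat \<Rightarrow> 's) \<Rightarrow> 's list \<Rightarrow> 's" where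
  "follow G q h =
     (if h = map q [0..<length h] \<and> (last h, q (length h)) \<in> edges G then q (length h)
      else SOME w. (last h, w) \<in> edges G)"

lemma strategy_follow: "game G \<Longrightarrow> strategy G (diamonds G) (follow G q)"
proof -
  assume "game G"
  then have "(s, SOME w. (s, w) \<in> edges G) \<in> edges G" if "s \<in> diamonds G" for s
    using that by (intro someI_ex[of "\<lambda>w. (s, w) \<in> edges G"]) (auto simp: game_def)
  then show ?thesis unfolding strategy_def follow_def by auto
qed

lemma history_follow:
  assumes "game G" "consistent G \<sigma> s q n" "j \<le> n"
  shows "history G \<sigma> (follow G q) s j = map q [0..<Suc j]"
  using assms(3)
proof (induction j)
  case 0
  then show ?case using assms by (simp add: consistent_def)
next
  case (Suc j)
  then have h: "history G \<sigma> (follow G q) s j = map q [0..<Suc j]" by simp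
  from assms(2) Suc.prems have "(q j, q (Suc j)) \<in> edges G" "q j \<in> boxes G \<longrightarrow> q (Suc j) = \<sigma> (map q [0..<Suc j])"
    by (auto simp: consistent_def)
  moreover from this have "follow G q (map q [0..<Suc j]) = q (Suc j)"
    by (simp add: follow_def del: upt_Suc) simp
  ultimately show ?case using h by (auto simp: Let_def)
qed

lemma history_outcome: "history G \<sigma> \<pi> s n = map (outcome G \<sigma> \<pi> s) [0..<Suc n]"
proof (induction n)
  case (Suc n)
  have "history G \<sigma> \<pi> s (Suc n) = history G \<sigma> \<pi> s n @ [outcome G \<sigma> \<pi> s (Suc n)]"
    by (simp add: Let_def outcome_def)
  then show ?case using Suc by (simp del: history.simps)
qed (simp add: outcome_def)

lemma outcome_Suc:
  "outcome G \<sigma> \<pi> s (Suc n) =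
    (let h = map (outcome G \<sigma> \<pi> s) [0..<Suc n]
     in if outcome G \<sigma> \<pi> s n \<in> boxes G then \<sigma> h else \<pi> h)"
proof -
  have "last (history G \<sigma> \<pi> s n) = outcome G \<sigma> \<pi> s n" by (simp add: outcome_def)
  then show ?thesis
    by (subst outcome_def) (simp add: Let_def history_outcome[symmetric] del: upt_Suc)
qed

lemma consistent_outcome:
  assumes "game G" "s \<in> states G" "strategy G (boxes G) \<sigma>" "strategy G (diamonds G) \<pi>"
  shows "consistent G \<sigma> s (outcome G \<sigma> \<pi> s) n"
proof -
  let ?r = "outcome G \<sigma> \<pi> s"
  have *: "(\<forall>j\<le>n. ?r j \<in> states G) \<and> (\<forall>j<n. (?r j, ?r (Suc j)) \<in> edges G)" for n
  proof (induction n)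
    case 0
    then show ?case using assms by (simp add: outcome_def)
  next
    case (Suc n)
    have e: "(?r n, ?r (Suc n)) \<in> edges G"
    proof -
      have sub: "set (map ?r [0..<n]) \<subseteq> states G" using Suc by auto
      have "?r n \<in> boxes G \<or> ?r n \<in> diamonds G" using Suc assms(1) by (auto simp: game_def)
      then show ?thesis
        using assms(3,4) sub assms(1) unfolding strategy_def
        by (auto simp: outcome_Suc Let_def game_def)
    qed
    then have "?r (Suc n) \<in> states G" using assms(1) by (auto simp: game_def)
    with Suc e show ?case by (auto simp: le_Suc_eq less_Suc_eq)
  qed
  show ?thesis
    unfolding consistent_def using *[of n] by (auto simp: outcome_def[of _ _ _ _ 0] outcome_Suc Let_def)
qed

text \<open>After the prefix the play is continued by letting \<open>\<sigma>\<close> play against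
  \<open>follow G q\<close>, which then makes arbitrary legal moves.\<close>

lemma consistent_extend:
  assumes "game G" "s \<in> states G" "strategy G (boxes G) \<sigma>" "consistent G \<sigma> s q n"
  shows "\<exists>r. (\<forall>k. consistent G \<sigma> s r k) \<and> (\<forall>j\<le>n. r j = q j)"
proof (intro exI conjI allI impI)
  show "consistent G \<sigma> s (outcome G \<sigma> (follow G q) s) k" for k
    by (intro consistent_outcome strategy_follow assms)
  show "outcome G \<sigma> (follow G q) s j = q j" if "j \<le> n" for j
    using history_follow[OF assms(1,4) that] by (simp add: outcome_def)
qed

text \<open>Every outcome is consistent, and conversely every infinite consistent play is the
  outcome against the opponent that follows it.\<close>

lemma winning_iff:
  assumes "game G" "s \<in> states G"
  shows "\<sigma> \<in> winning G \<Phi> s \<longleftrightarrow>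
    strategy G (boxes G) \<sigma> \<and> (\<forall>r. (\<forall>n. consistent G \<sigma> s r n) \<longrightarrow> r \<in> \<Phi>)"
proof -
  have "r \<in> \<Phi>" if w: "\<sigma> \<in> winning G \<Phi> s" and r: "\<forall>n. consistent G \<sigma> s r n" for r
  proof -
    have "outcome G \<sigma> (follow G r) s n = r n" for n
      using history_follow[OF assms(1), of \<sigma> s r n n] r by (simp add: outcome_def)
    then have "outcome G \<sigma> (follow G r) s = r" by blast
    then show ?thesis using w strategy_follow[OF assms(1), of r] by (auto simp: winning_def)
  qed
  moreover have "strategy G (boxes G) \<sigma>" if "\<sigma> \<in> winning G \<Phi> s"
    using that by (simp add: winning_def)
  ultimately show ?thesis
    using consistent_outcome[OF assms] by (simp add: winning_def) metis
qed

lemma consistent_run: "game G \<Longrightarrow> s \<in> states G \<Longrightarrow> \<forall>n. consistent G \<sigma> s r n \<Longrightarrow> r \<in> runs G"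
proof -
  assume a: "game G" "s \<in> states G" "\<forall>n. consistent G \<sigma> s r n"
  then have e: "(r j, r (Suc j)) \<in> edges G" for j
    by (metis consistent_def lessI)
  then have "r j \<in> states G" for j using a(1) by (auto simp: game_def)
  with e show ?thesis by (simp add: runs_def)
qed

section \<open>Games with a deterministic monitor\<close>

text \<open>The state \<open>nb v + w\<close> is reached from \<open>v\<close> when the game moves to \<open>w\<close>, so that every state
  of the monitored game is \<open>nb v + w\<close> for a monitor state coded by the number \<open>nb v\<close>.\<close>

primrec track :: "(nat \<Rightarrow> nat) \<Rightarrow> (nat \<Rightarrow> nat) \<Rightarrow> nat \<Rightarrow> nat" where
  "track nb r 0 = r 0"
| "track nb r (Suc t) = nb (track nb r t) + r (Suc t)"

lemma track_cong: "(\<And>j. j \<le> t \<Longrightarrow> q j = r j) \<Longrightarrow> track nb q t = track nb r t"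
  by (induction t) auto

text \<open>\<open>st\<close> and \<open>nb\<close> are tables indexed by product states. Since
  \<open>nb v\<close> is a multiple of \<open>n\<close>, adding a game state \<open>w < n\<close>
  puts \<open>w\<close> into the remainder, and \<open>nb_le\<close> keeps the result below
  \<open>N\<close>. Thus only one number per product state is needed to describe all its outgoing
  edges.\<close>

locale monitored =
  fixes G :: "nat game" and n N :: nat and st nb :: "nat \<Rightarrow> nat" and bad :: "nat \<Rightarrow> bool"
  assumes game: "game G" and states_G: "states G = {..<n}"
    and n_dvd: "n dvd N" and st: "v < N \<Longrightarrow> st v = v mod n"
    and nb_dvd: "v < N \<Longrightarrow> n dvd nb v" and nb_le: "v < N \<Longrightarrow> nb v + n \<le> N"
begin

lemma n_pos: "0 < n"
  using game states_G by (auto simp: game_def)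

lemma edge_states: "(v, w) \<in> edges G \<Longrightarrow> v < n \<and> w < n"
  using game states_G by (auto simp: game_def)

lemma st_less: "v < N \<Longrightarrow> st v < n"
  using st n_pos by simp

lemma st_succ: "v < N \<Longrightarrow> w < n \<Longrightarrow> st (nb v + w) = w \<and> nb v + w < N"
proof -
  assume a: "v < N" "w < n"
  then have "nb v + w < N" using nb_le[of v] by simp
  moreover have "(nb v + w) mod n = w" using nb_dvd[OF a(1)] a(2) by (metis mod_less mod_add_left_eq add_0 dvd_imp_mod_0)
  ultimately show ?thesis using st by simp
qed

section \<open>The product game, the attractor of Player Diamond, and the safe game\<close>

definition prod_edges :: "(nat \<times> nat) set" where
  "prod_edges = {(v, nb v + w) | v w. v < N \<and> (st v, w) \<in> edges G}"

lemma prod_edges_iff: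
  "(v, u) \<in> prod_edges \<longleftrightarrow> v < N \<and> u < N \<and> (st v, st u) \<in> edges G \<and> u = nb v + st u"
  unfolding prod_edges_def using st_succ edge_states by fastforce

text \<open>Being a least set, it supports the two inductions needed later: no play of a winning
  strategy reaches it, and a marked set closed under the rules contains it. By
  \<open>prod_edge_ex\<close> the \<open>box\<close> rule never holds vacuously.\<close>

inductive attr :: "nat \<Rightarrow> bool" where
  bad: "v < N \<Longrightarrow> bad v \<Longrightarrow> attr v"
| diamond: "(v, u) \<in> prod_edges \<Longrightarrow> st v \<notin> boxes G \<Longrightarrow> attr u \<Longrightarrow> attr v"
| box: "v < N \<Longrightarrow> st v \<in> boxes G \<Longrightarrow> (\<And>u. (v, u) \<in> prod_edges \<Longrightarrow> attr u) \<Longrightarrow> attr v"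

text \<open>Outside the attractor, all successors of a Diamond state are outside again, so in effect
  only choices of Player Box are removed, and at least one choice remains. Inside the attractor all
  edges are kept, so that these states do not become dead ends.\<close>

definition safe_game :: "nat game" where
  "safe_game = \<lparr>states = {..<N}, boxes = {v. v < N \<and> st v \<in> boxes G},
     diamonds = {v. v < N \<and> st v \<notin> boxes G}, edges = {(v, u) \<in> prod_edges. attr v \<or> \<not> attr u}\<rparr>"

lemma safe_game_sel [simp]:
  "states safe_game = {..<N}" "boxes safe_game = {v. v < N \<and> st v \<in> boxes G}"
  "diamonds safe_game = {v. v < N \<and> st v \<notin> boxes G}"
  "edges safe_game = {(v, u) \<in> prod_edges. attr v \<or> \<not> attr u}"
  by (simp_all add: safe_game_def)

lemma prod_edge_ex: "v < N \<Longrightarrow> \<exists>u. (v, u) \<in> prod_edges"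
proof -
  assume v: "v < N"
  then obtain w where "(st v, w) \<in> edges G"
    using game st_less[OF v] states_G unfolding game_def by blast
  with v show ?thesis by (auto simp: prod_edges_def)
qed

lemma game_safe_game: assumes "0 < N" shows "game safe_game"
proof -
  have "\<exists>u. (v, u) \<in> prod_edges \<and> (attr v \<or> \<not> attr u)" if "v < N" for v
    using prod_edge_ex[OF that] that attr.diamond attr.box by (cases "st v \<in> boxes G") blast+
  then show ?thesis using assms by (auto simp: game_def prod_edges_iff)
qed

text \<open>A product run is determined by its game states: \<open>r' 0 < n\<close> means that the
  monitor starts with code 0, and afterwards its state is forced by \<open>nb\<close>.\<close>

lemma prod_edge_track:
  assumes "\<And>j. j < t \<Longrightarrow> (r' j, r' (Suc j)) \<in> prod_edges" "r' 0 < n" "n \<le> N"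
  shows "r' t = track nb (\<lambda>j. st (r' j)) t"
  using assms(1)
proof (induction t)
  case 0
  then show ?case using assms st by simp
next
  case (Suc t)
  then have "r' t = track nb (\<lambda>j. st (r' j)) t" "r' (Suc t) = nb (r' t) + st (r' (Suc t))"
    using Suc.prems[of t] unfolding prod_edges_iff by simp_all
  then show ?case by simp
qed

lemma track_states:
  assumes "\<And>j. j \<le> t \<Longrightarrow> r j < n" "n \<le> N"
  shows "track nb r t < N \<and> st (track nb r t) = r t"
  using assms(1)
proof (induction t)
  case 0
  then show ?case using assms(2) st[of "r 0"] by (auto dest: meta_spec[of _ 0])
next
  case (Suc t)
  then show ?case using st_succ by simp
qed

lemma track_in_states:
  assumes "\<And>j. r j < n" "n \<le> N" shows "track nb r t < N" "st (track nb r t) = r t"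
  using track_states[of t r] assms by auto

section \<open>Transfer of histories and strategies between the game and the safe game\<close>

definition lift :: "nat list \<Rightarrow> nat list" where
  "lift h = map (track nb (\<lambda>i. h ! i)) [0..<length h]"

lemma lift_map: "lift (map r [0..<k]) = map (track nb r) [0..<k]"
  unfolding lift_def by (auto intro!: track_cong)

lemma length_lift [simp]: "length (lift h) = length h"
  by (simp add: lift_def)

lemma set_lift:
  assumes "set h \<subseteq> {..<n}" "n \<le> N" shows "set (lift h) \<subseteq> {..<N}" "map st (lift h) = h"
proof -
  have "track nb ((!) h) i < N \<and> st (track nb ((!) h) i) = h ! i" if "i < length h" for i
  proof (rule track_states)
    show "h ! j < n" if "j \<le> i" for j
      using assms(1) \<open>i < length h\<close> that nth_mem[of j h] by (auto simp: subset_iff)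
  qed (rule assms(2))
  then show "set (lift h) \<subseteq> {..<N}" "map st (lift h) = h"
    by (auto simp: lift_def intro!: nth_equalityI)
qed

lemma lift_snoc: "lift (h @ [s]) = lift h @ [track nb ((!) (h @ [s])) (length h)]"
proof -
  have "map (track nb ((!) (h @ [s]))) [0..<length h] = map (track nb ((!) h)) [0..<length h]"
    by (auto intro!: track_cong simp: nth_append)
  then show ?thesis by (simp add: lift_def)
qed

text \<open>Truncated subtraction is exact here, since an edge leaving \<open>v\<close> always leads
  to a state \<open>nb v + w\<close>.\<close>

definition project :: "(nat list \<Rightarrow> nat) \<Rightarrow> nat list \<Rightarrow> nat" where
  "project \<sigma>' h = \<sigma>' (lift h) - nb (last (lift h))"

text \<open>The move of \<open>\<sigma>\<close> may have been removed from the safe game at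
  histories that \<open>\<sigma>\<close> never produces; the default choice makes the result a
  strategy there as well.\<close>

definition insert_monitor :: "(nat list \<Rightarrow> nat) \<Rightarrow> nat list \<Rightarrow> nat" where
  "insert_monitor \<sigma> h' =
     (let u = nb (last h') + \<sigma> (map st h')
      in if (last h', u) \<in> edges safe_game then u else SOME u. (last h', u) \<in> edges safe_game)"

definition lifted_reward :: "nat reward \<Rightarrow> nat reward" where
  "lifted_reward \<rho> = (rdim \<rho>, \<lambda>v. rew \<rho> (st v))"

context
  fixes \<rho> :: "nat reward" and \<Psi> :: "(nat \<Rightarrow> nat list) set" and \<Delta> :: "(nat \<Rightarrow> nat) set" and s :: nat
  assumes n_le: "n \<le> N" and s: "s < n"
    and \<Delta>: "\<And>r. r \<in> runs G \<Longrightarrow> r \<in> \<Delta> \<longleftrightarrow> (\<forall>t. \<not> bad (track nb r t))"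
begin

abbreviation "objective \<equiv> \<Delta> \<inter> reward_objective \<Psi> G \<rho>"
abbreviation "safe_objective \<equiv> reward_objective \<Psi> safe_game (lifted_reward \<rho>)"

lemma game_safe: "game safe_game" using game_safe_game n_pos n_le by simp

lemma project_strategy:
  assumes "strategy safe_game (boxes safe_game) \<sigma>'" "set h \<subseteq> {..<n}" "w \<in> boxes G" 
  shows "(last (lift (h @ [w])), \<sigma>' (lift (h @ [w]))) \<in> edges safe_game"
    and "st (last (lift (h @ [w]))) = w"
    and "\<sigma>' (lift (h @ [w])) = nb (last (lift (h @ [w]))) + project \<sigma>' (h @ [w])"
    and "(w, project \<sigma>' (h @ [w])) \<in> edges G"
proof -
  have w: "w < n" using assms(3) game states_G by (auto simp: game_def)
  obtain v where v: "lift (h @ [w]) = lift h @ [v]" using lift_snoc by blast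
  have "set (lift (h @ [w])) \<subseteq> {..<N}" "map st (lift (h @ [w])) = h @ [w]"
    using set_lift[of "h @ [w]"] assms(2) w n_le by auto
  then have 1: "v < N" "st v = w" "set (lift h) \<subseteq> {..<N}"
    using v set_lift[OF assms(2) n_le] by auto
  with assms(1,3) have e: "(v, \<sigma>' (lift h @ [v])) \<in> edges safe_game"
    by (auto simp: strategy_def)
  then have "\<sigma>' (lift h @ [v]) = nb v + st (\<sigma>' (lift h @ [v]))" "(w, st (\<sigma>' (lift h @ [v]))) \<in> edges G"
    using 1 by (auto simp: prod_edges_iff)
  then show "(last (lift (h @ [w])), \<sigma>' (lift (h @ [w]))) \<in> edges safe_game"
    "st (last (lift (h @ [w]))) = w"
    "\<sigma>' (lift (h @ [w])) = nb (last (lift (h @ [w]))) + project \<sigma>' (h @ [w])"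
    "(w, project \<sigma>' (h @ [w])) \<in> edges G"
    using e 1 v by (simp_all add: project_def) (metis diff_add_inverse)+
qed

text \<open>A play of the projected strategy lifts to a play of the safe game. It never enters the
  attractor: moves of Player Box are edges of the safe game, and a move of Player Diamond into the
  attractor would put its source there. Hence no bad state is met, which gives
  \<open>\<Delta>\<close>, and the lifted play has the same rewards, which gives the other
  objective.\<close>

lemma project_winning:
  assumes w: "\<sigma>' \<in> winning safe_game safe_objective s" and na: "\<not> attr s"
  shows "project \<sigma>' \<in> winning G objective s"
proof -
  have sN: "s \<in> states safe_game" using s n_le by simp
  have sG: "s \<in> states G" using s states_G by simp
  from w winning_iff[OF game_safe sN] have str: "strategy safe_game (boxes safe_game) \<sigma>'"
    and win: "\<And>r. (\<forall>n. consistent safe_game \<sigma>' s r n) \<Longrightarrow> r \<in> safe_objective" by blast+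
  have "strategy G (boxes G) (project \<sigma>')"
    unfolding strategy_def states_G using project_strategy(4)[OF str] by blast
  moreover have "r \<in> objective" if c: "\<forall>n. consistent G (project \<sigma>') s r n" for r
  proof -
    have run: "r \<in> runs G" using consistent_run[OF game sG c] .
    then have rn: "r j < n" for j using states_G by (auto simp: runs_def)
    have r0: "r 0 = s" using c by (simp add: consistent_def)
    define r' where "r' = track nb r"
    have rN: "r' t < N" "st (r' t) = r t" for t
      using track_in_states[OF rn n_le] by (auto simp: r'_def)
    have pe: "(r' t, r' (Suc t)) \<in> prod_edges" for t
    proof -
      have "(r t, r (Suc t)) \<in> edges G" using run by (auto simp: runs_def)
      moreover have "r' (Suc t) = nb (r' t) + r (Suc t)" by (simp add: r'_def)
      ultimately show ?thesis using rN[of t] unfolding prod_edges_def by auto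
    qed
    have bx: "r' (Suc t) = \<sigma>' (map r' [0..<Suc t]) \<and> (r' t, r' (Suc t)) \<in> edges safe_game"
      if b: "r t \<in> boxes G" for t
    proof -
      have h: "map r [0..<Suc t] = map r [0..<t] @ [r t]" by simp
      have l: "lift (map r [0..<t] @ [r t]) = map r' [0..<Suc t]"
        unfolding h[symmetric] lift_map r'_def ..
      have "set (map r [0..<t]) \<subseteq> {..<n}" using rn by auto
      note P = project_strategy[OF str this b, unfolded l]
      have "r (Suc t) = project \<sigma>' (map r [0..<t] @ [r t])"
        using c b h by (metis consistent_def lessI)
      then have "r' (Suc t) = \<sigma>' (map r' [0..<Suc t])" using P(3) by (simp add: r'_def)
      then show ?thesis using P(1) by simp
    qed
    \<comment> \<open>The two claims need a joint induction: that the step from \<open>r' t\<close>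
      belongs to the safe game depends on \<open>r' t\<close> being outside the attractor, and
      conversely for \<open>r' (Suc t)\<close>.\<close>
    have na': "\<not> attr (r' t) \<and> (\<forall>j<t. (r' j, r' (Suc j)) \<in> edges safe_game)" for t
    proof (induction t)
      case 0
      then show ?case using na r0 by (simp add: r'_def)
    next
      case (Suc t)
      have "(r' t, r' (Suc t)) \<in> edges safe_game"
      proof (cases "r t \<in> boxes G")
        case False
        then show ?thesis using attr.diamond[OF pe[of t]] rN Suc pe by auto
      qed (use bx in blast)
      with Suc show ?case by (auto simp: less_Suc_eq)
    qed
    have "\<forall>k. consistent safe_game \<sigma>' s r' k"
      unfolding consistent_def using na' bx r0 rN by (auto simp: r'_def simp del: upt_Suc safe_game_sel(4))
    then have "r' \<in> safe_objective" by (rule win)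
    then have "r \<in> reward_objective \<Psi> G \<rho>"
      using run rN by (simp add: reward_objective_def lifted_reward_def)
    moreover have "\<not> bad (r' t)" for t using na' attr.bad rN by blast
    then have "r \<in> \<Delta>" using \<Delta>[OF run] by (simp add: r'_def)
    ultimately show ?thesis by blast
  qed
  ultimately show ?thesis using winning_iff[OF game sG] by blast
qed

text \<open>The first claim shows that nothing is lost by giving up at once when the initial state
  is in the attractor; the second, that removing edges into the attractor does not harm a winning
  strategy.\<close>

lemma insert_monitor_winning:
  assumes w: "\<sigma> \<in> winning G objective s"
  shows "\<not> attr s" and "insert_monitor \<sigma> \<in> winning safe_game safe_objective s"
proof -
  have sN: "s \<in> states safe_game" using s n_le by simp
  have sG: "s \<in> states G" using s states_G by simp
  from w winning_iff[OF game sG] have str: "strategy G (boxes G) \<sigma>"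
    and win: "\<And>r. (\<forall>n. consistent G \<sigma> s r n) \<Longrightarrow> r \<in> objective" by blast+
  have extend: "\<exists>q'. consistent G \<sigma> s q' (Suc k) \<and> track nb q' (Suc k) = nb (track nb q k) + x"
    if c: "consistent G \<sigma> s q k" and e: "(q k, x) \<in> edges G" 
      and b: "q k \<in> boxes G \<Longrightarrow> x = \<sigma> (map q [0..<Suc k])" for q k x
  proof (intro exI conjI)
    let ?q = "q(Suc k := x)"
    have "map ?q [0..<Suc j] = map q [0..<Suc j]" if "j \<le> k" for j using that by auto
    then show "consistent G \<sigma> s ?q (Suc k)"
      using c e b by (auto simp: consistent_def less_Suc_eq simp del: upt_Suc)
    have "track nb ?q k = track nb q k" by (rule track_cong) auto
    then show "track nb ?q (Suc k) = nb (track nb q k) + x" by simp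
  qed
  have cN: "q j < n" if "consistent G \<sigma> s q k" "j \<le> k" for q k j
    using that s edge_states unfolding consistent_def by (cases j) (auto simp del: upt_Suc dest!: spec[of _ "j - 1"])
  have cst: "track nb q k < N \<and> st (track nb q k) = q k" if "consistent G \<sigma> s q k" for q k
    by (rule track_states) (use cN[OF that] n_le in auto)
  \<comment> \<open>Induction over \<open>attr\<close>: a finite play ending in a bad state extends
    to an infinite one that violates \<open>\<Delta>\<close>; at a Diamond state the play is
    extended by the move into the attractor, at a Box state by the move of \<open>\<sigma>\<close>,
    all successors there being in the attractor.\<close>
  have not_attr: "attr v \<Longrightarrow> consistent G \<sigma> s q k \<Longrightarrow> v = track nb q k \<Longrightarrow> False" for v q k
  proof (induction arbitrary: q k rule: attr.induct)
    case (bad v)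
    obtain r where r: "\<forall>k. consistent G \<sigma> s r k" "\<forall>j\<le>k. r j = q j"
      using consistent_extend[OF game sG str bad.prems(1)] by blast
    then have "track nb r k = v" using bad.prems track_cong[of k r q] by simp
    moreover have "r \<in> \<Delta>" using win[OF r(1)] by blast
    ultimately show False using \<Delta>[OF consistent_run[OF game sG r(1)]] bad.hyps by blast
  next
    case (diamond v u)
    have "u = nb v + st u" "(q k, st u) \<in> edges G" "q k \<notin> boxes G"
      using diamond.hyps diamond.prems cst[OF diamond.prems(1)] by (auto simp: prod_edges_iff)
    with extend[OF diamond.prems(1), of "st u"] obtain q' where
      "consistent G \<sigma> s q' (Suc k)" "track nb q' (Suc k) = u" using diamond.prems(2) by metis
    then show False using diamond.IH by metis
  next
    case (box v)
    define x where "x = \<sigma> (map q [0..<Suc k])"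
    have qk: "q k = st v" using cst[OF box.prems(1)] box.prems by simp
    have "set (map q [0..<k]) \<subseteq> states G" using cN[OF box.prems(1)] states_G by auto
    then have "(q k, x) \<in> edges G"
      using str box.hyps(2) qk unfolding strategy_def x_def by auto
    moreover from this have "(v, nb v + x) \<in> prod_edges"
      using box.hyps(1) qk unfolding prod_edges_def by auto
    moreover obtain q' where "consistent G \<sigma> s q' (Suc k)" "track nb q' (Suc k) = nb v + x"
      using extend[OF box.prems(1) calculation(1)] box.prems(2) x_def by metis
    ultimately show False using box.IH by metis
  qed
  have "consistent G \<sigma> s (\<lambda>_. s) 0" by (simp add: consistent_def)
  from not_attr[OF _ this, of s] show "\<not> attr s" by auto
  have estr: "(last h', insert_monitor \<sigma> h') \<in> edges safe_game" if "last h' < N" for h'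
    using that game_safe someI_ex[of "\<lambda>u. (last h', u) \<in> edges safe_game"]
    unfolding insert_monitor_def game_def by (auto simp: Let_def simp del: safe_game_sel(4))
  have "strategy safe_game (boxes safe_game) (insert_monitor \<sigma>)"
    unfolding strategy_def using estr by (metis (no_types, lifting) last_snoc mem_Collect_eq safe_game_sel(2))
  moreover have "r' \<in> safe_objective" if c: "\<forall>n. consistent safe_game (insert_monitor \<sigma>) s r' n" for r'
  proof -
    have run': "r' \<in> runs safe_game" using consistent_run[OF game_safe sN c] .
    have r0: "r' 0 = s" using c by (simp add: consistent_def)
    have pe: "(r' t, r' (Suc t)) \<in> edges safe_game" for t using run' by (auto simp: runs_def)
    define r where "r t = st (r' t)" for t
    have r': "r' t = track nb r t" for t
      unfolding r_def by (rule prod_edge_track) (use pe r0 s n_le in auto)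
    have r'N: "r' t < N" for t using pe[of t] by (auto simp: prod_edges_iff)
    have "consistent G \<sigma> s r k" for k
    proof (induction k)
      case 0
      have "r 0 = s" using r' r0 by (metis track.simps(1))
      then show ?case by (simp add: consistent_def)
    next
      case (Suc k)
      have e: "(r k, r (Suc k)) \<in> edges G" using pe[of k] by (auto simp: r_def prod_edges_iff)
      moreover have "r (Suc k) = \<sigma> (map r [0..<Suc k])" if b: "r k \<in> boxes G"
      proof -
        \<comment> \<open>The default of \<open>insert_monitor\<close> is not taken here: the move
          \<open>x\<close> extends a play consistent with \<open>\<sigma>\<close>, so by
          \<open>not_attr\<close> it leads outside the attractor and its edge was kept.\<close>
        define x where "x = \<sigma> (map r [0..<Suc k])"
        have "set (map r [0..<k]) \<subseteq> states G" using cN[OF Suc] states_G by auto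
        then have x: "(r k, x) \<in> edges G"
          using str b unfolding strategy_def x_def by auto
        then obtain q' where "consistent G \<sigma> s q' (Suc k)" "track nb q' (Suc k) = nb (r' k) + x"
          using extend[OF Suc x] x_def r' by auto
        then have "\<not> attr (nb (r' k) + x)" using not_attr by metis
        moreover have "(r' k, nb (r' k) + x) \<in> prod_edges"
          unfolding prod_edges_def using x r'N r_def by auto
        ultimately have "(r' k, nb (r' k) + x) \<in> edges safe_game" by simp
        moreover have "map st (map r' [0..<Suc k]) = map r [0..<Suc k]" by (simp add: r_def)
        moreover have "last (map r' [0..<Suc k]) = r' k" by simp
        ultimately have "insert_monitor \<sigma> (map r' [0..<Suc k]) = nb (r' k) + x"
          unfolding insert_monitor_def x_def by (simp del: upt_Suc safe_game_sel(4) map_map)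
        moreover have "r' (Suc k) = insert_monitor \<sigma> (map r' [0..<Suc k])"
          using c b r'N[of k] unfolding consistent_def r_def by (auto simp del: upt_Suc)
        ultimately have "r' (Suc k) = nb (r' k) + x" by simp
        then show ?thesis using st_succ[OF r'N] edge_states[OF x] r_def x_def by simp
      qed
      ultimately show ?case using Suc by (auto simp: consistent_def less_Suc_eq)
    qed
    then have "r \<in> objective" using win by blast
    then show ?thesis
      using run' by (simp add: reward_objective_def lifted_reward_def r_def)
  qed
  ultimately show "insert_monitor \<sigma> \<in> winning safe_game safe_objective s"
    using winning_iff[OF game_safe sN] by blast
qed

lemma winning_empty_iff:
  "winning G objective s = {} \<longleftrightarrow> attr s \<or> winning safe_game safe_objective s = {}"
  using project_winning insert_monitor_winning by blast

end

text \<open>An edge \<open>(v, u)\<close> is recovered from the underlying edge of \<open>G\<close>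
  and the monitor code \<open>v div n\<close>: these give \<open>v\<close>, and then
  \<open>u = nb v + st u\<close>. So each edge of \<open>G\<close> has at most \<open>k\<close>
  copies.\<close>

lemma card_edges_safe_game:
  assumes "N = n * k"
  shows "card (edges safe_game) \<le> card (edges G) * k"
proof -
  have fin: "finite (edges G)"
    using game states_G by (auto simp: game_def intro: finite_subset[of _ "{..<n} \<times> {..<n}"])
  let ?f = "\<lambda>(v, u). ((st v, st u), v div n)"
  have "inj_on ?f (edges safe_game)"
  proof (rule inj_onI)
    fix x y
    assume xy: "x \<in> edges safe_game" "y \<in> edges safe_game" "?f x = ?f y"
    obtain a b c d where "x = (a, b)" "y = (c, d)" by fastforce
    with xy have "a < N" "c < N" "st a = st c" "a div n = c div n" "b = nb a + st b" "d = nb c + st d"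
      "st b = st d" by (auto simp: prod_edges_iff)
    moreover from this have "a = c" using st by (metis div_mod_decomp)
    ultimately show "x = y" using \<open>x = (a, b)\<close> \<open>y = (c, d)\<close> by metis
  qed
  moreover have "?f ` edges safe_game \<subseteq> edges G \<times> {..<k}"
    using less_mult_imp_div_less[of _ k n]
    by (auto simp del: safe_game_sel(4) simp: safe_game_def prod_edges_iff assms[symmetric] mult.commute[of k])
  ultimately have "card (edges safe_game) \<le> card (edges G \<times> {..<k})"
    using card_inj_on_le fin by blast
  then show ?thesis by (simp add: card_cartesian_product)
qed

lemma max_lifted_reward:
  assumes "n \<le> N"
  shows "max_reward safe_game (lifted_reward \<rho>) = max_reward G \<rho>"
proof -
  have "{rew (lifted_reward \<rho>) v ! i | v i. v \<in> states safe_game \<and> i < rdim (lifted_reward \<rho>)}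
      = {rew \<rho> v ! i | v i. v \<in> states G \<and> i < rdim \<rho>}" (is "?A = ?B")
  proof
    show "?A \<subseteq> ?B" using st_less states_G unfolding lifted_reward_def by fastforce
    show "?B \<subseteq> ?A"
    proof clarify
      fix v i assume "v \<in> states G" "i < rdim \<rho>"
      moreover from this have "v < N" "st v = v" using states_G assms st by auto
      ultimately show "\<exists>va ia. rew \<rho> v ! i = rew (lifted_reward \<rho>) va ! ia \<and> va \<in> states safe_game \<and> ia < rdim (lifted_reward \<rho>)"
        using lifted_reward_def by (metis lessThan_iff prod.sel safe_game_sel(1))
    qed
  qed
  then show ?thesis by (simp add: max_reward_def)
qed

end

section \<open>Extending a monitor by a digit\<close>

text \<open>The conditions of \<open>monitored\<close> on the tables alone. They are a predicate,
  not a locale, because the arrays are rebuilt digit by digit and the bad states are known only at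
  the end.\<close>

definition monitor_tables :: "nat \<Rightarrow> nat \<Rightarrow> (nat \<Rightarrow> nat) \<Rightarrow> (nat \<Rightarrow> nat) \<Rightarrow> bool" where
  "monitor_tables n N st nb \<longleftrightarrow> 0 < n \<and> n \<le> N \<and> n dvd N \<and>
     (\<forall>v<N. st v = v mod n \<and> n dvd nb v \<and> nb v + n \<le> N)"

lemma track_less:
  assumes "monitor_tables n N st nb" "\<And>t. r t < n"
  shows "track nb r t < N"
proof (induction t)
  case 0
  then show ?case using assms by (metis monitor_tables_def order_less_le_trans track.simps(1))
next
  case (Suc t)
  then have "nb (track nb r t) + n \<le> N" using assms(1) by (simp add: monitor_tables_def)
  then show ?case using assms(2)[of "Suc t"] by simp
qed

lemma st_track:
  assumes "monitor_tables n N st nb" "\<And>t. r t < n"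
  shows "st (track nb r t) = r t"
proof -
  have "track nb r t mod n = r t"
  proof (cases t)
    case (Suc t')
    have "n dvd nb (track nb r t')"
      using assms(1) track_less[where r = r, OF assms] by (simp add: monitor_tables_def)
    then show ?thesis using assms(2)[of t] Suc by (auto elim!: dvdE)
  qed (simp add: assms(2))
  then show ?thesis using assms(1) track_less[where r = r, OF assms] by (simp add: monitor_tables_def)
qed

text \<open>A new state is \<open>x * N + v\<close> with a new most significant digit
  \<open>x\<close> and an old state \<open>v\<close>. The old part evolves as before, while
  \<open>d\<close> computes the next digit from both; this is why tracking modulo \<open>N\<close>
  recovers the old monitor.\<close>

locale digit_extension =
  fixes n N R :: nat and st nb st' nb' :: "nat \<Rightarrow> nat" and d :: "nat \<Rightarrow> nat \<Rightarrow> nat"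
  assumes tables: "monitor_tables n N st nb" and R: "0 < R"
    and d: "\<And>x v. x < R \<Longrightarrow> v < N \<Longrightarrow> d x v < R"
    and nb': "\<And>j. j < N * R \<Longrightarrow> nb' j = d (j div N) (j mod N) * N + nb (j mod N)"
    and st': "\<And>j. j < N * R \<Longrightarrow> st' j = st (j mod N)"
begin

lemma N_pos: "0 < N" using tables by (auto simp: monitor_tables_def)

lemma tables': "monitor_tables n (N * R) st' nb'"
  unfolding monitor_tables_def
proof (intro conjI allI impI)
  show "0 < n" "n dvd N * R" using tables by (auto simp: monitor_tables_def)
  have "n \<le> N" using tables by (simp add: monitor_tables_def)
  also have "N \<le> N * R" using R by simp
  finally show "n \<le> N * R" .
  fix v assume v: "v < N * R"
  have m: "v mod N < N" using N_pos by simp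
  have q: "v div N < R" using v by (metis less_mult_imp_div_less mult.commute)
  have n: "n dvd N" using tables by (simp add: monitor_tables_def)
  show "st' v = v mod n"
    using st'[OF v] m n tables by (simp add: monitor_tables_def mod_mod_cancel)
  show "n dvd nb' v"
    using nb'[OF v] m n tables by (simp add: monitor_tables_def)
  have "d (v div N) (v mod N) * N + N \<le> N * R"
    using d[OF q m] by (metis add.commute mult.commute mult_Suc mult_le_mono1 Suc_leI)
  moreover have "nb (v mod N) + n \<le> N" using m tables by (simp add: monitor_tables_def)
  ultimately show "nb' v + n \<le> N * R" unfolding nb'[OF v] by linarith
qed

lemma track_mod:
  assumes "\<And>t. r t < n"
  shows "track nb' r t mod N = track nb r t"
proof (induction t)
  case 0
  have "r 0 < N" using tables assms by (metis monitor_tables_def order_less_le_trans)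
  then show ?case by simp
next
  case (Suc t)
  have "track nb' r t < N * R" using track_less[where r = r, OF tables' assms] .
  moreover have "track nb r (Suc t) < N" using track_less[where r = r, OF tables assms] .
  ultimately show ?case using nb' Suc by (simp add: mod_mult_self3 add.assoc)
qed

lemma track_div:
  assumes "\<And>t. r t < n"
  shows "track nb' r 0 div N = 0"
    "track nb' r (Suc t) div N = d (track nb' r t div N) (track nb r t)"
proof -
  have "r 0 < N" using tables assms by (metis monitor_tables_def order_less_le_trans)
  then show "track nb' r 0 div N = 0" by simp
  have "track nb' r t < N * R" using track_less[where r = r, OF tables' assms] .
  moreover have "track nb r (Suc t) < N" using track_less[where r = r, OF tables assms] .
  ultimately show "track nb' r (Suc t) div N = d (track nb' r t div N) (track nb r t)"
    using nb' track_mod[where r = r, OF assms] N_pos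
    by (simp add: add.assoc div_mult_self3 del: div_mult_self1 div_mult_self2 div_mult_self4)
qed

end

section \<open>Monitoring a window\<close>

text \<open>The position inside the oldest window that is not yet complete.\<close>

definition phase :: "nat \<Rightarrow> nat \<Rightarrow> nat \<Rightarrow> nat" where
  "phase W D t = (if t < W then t else W - D + (t - W) mod D)"

text \<open>\<open>slot_sum x W D b t\<close> is the sum collected before time \<open>t\<close> by the window that starts
  \<open>b * D\<close> positions after the oldest incomplete one.\<close>

definition slot_sum :: "(nat \<Rightarrow> nat) \<Rightarrow> nat \<Rightarrow> nat \<Rightarrow> nat \<Rightarrow> nat \<Rightarrow> nat" where
  "slot_sum x W D b t = (\<Sum>j = t - phase W D t + b * D..<t. x j)"

context
  fixes W D :: nat
  assumes W: "0 < W" and D: "0 < D" and dvd: "D dvd W"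
begin

lemma D_le_W: "D \<le> W" using W dvd by (simp add: dvd_imp_le)

lemma phase_less: "phase W D t < W"
proof -
  have "(t - W) mod D < D" using D by simp
  then show ?thesis using D_le_W by (auto simp: phase_def)
qed

lemma phase_le: "phase W D t \<le> t"
  using phase_less[of t] by (auto simp: phase_def split: if_splits)

lemma phase_0: "phase W D 0 = 0" using W by (simp add: phase_def)

text \<open>When a window is complete, the next one started \<open>D\<close> positions later, so
  \<open>W - D\<close> of its positions have already been seen.\<close>

lemma phase_Suc: "phase W D (Suc t) = (if phase W D t = W - 1 then W - D else Suc (phase W D t))"
proof (cases "t < W")
  case True
  then show ?thesis using W by (auto simp: phase_def)
next
  case False
  have "(t - W) mod D < D" using D by simp
  have "Suc t - W = Suc (t - W)" using False by simp
  then have "phase W D (Suc t) = W - D + (if Suc ((t - W) mod D) = D then 0 else Suc ((t - W) mod D))"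
    using False by (simp add: phase_def mod_Suc)
  moreover have "phase W D t = W - D + (t - W) mod D" using False by (simp add: phase_def)
  ultimately show ?thesis
    using D_le_W \<open>(t - W) mod D < D\<close> by (cases "Suc ((t - W) mod D) = D") simp_all
qed

text \<open>The window with number \<open>l\<close> ends at position \<open>l * D + (W - 1)\<close>,
  and the phase reaches \<open>W - 1\<close> at exactly these times.\<close>

lemma phase_last: "phase W D t = W - 1 \<longleftrightarrow> (\<exists>l. t = l * D + (W - 1))"
proof (cases "t < W")
  case True
  have "l = 0" if "t = l * D + (W - 1)" for l
    using that True D W by (cases l) auto
  then show ?thesis using True by (auto simp: phase_def intro: exI[of _ 0])
next
  case False
  have m: "(t - W) mod D < D" using D by simp
  have "phase W D t = W - 1 \<longleftrightarrow> (t - W) mod D = D - 1"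
    using False m D_le_W D by (auto simp: phase_def)
  also have "\<dots> \<longleftrightarrow> Suc (t - W) mod D = 0"
    using D m by (auto simp: mod_Suc)
  also have "\<dots> \<longleftrightarrow> (\<exists>l. t = l * D + (W - 1))"
  proof
    assume "Suc (t - W) mod D = 0"
    then obtain l where "Suc (t - W) = D * l" by auto
    then show "\<exists>l. t = l * D + (W - 1)" using False W by (intro exI[of _ l]) (auto simp: algebra_simps)
  next
    assume "\<exists>l. t = l * D + (W - 1)"
    then obtain l where "t = l * D + (W - 1)" by blast
    then have "Suc (t - W) = l * D" using False W by linarith
    then show "Suc (t - W) mod D = 0" by simp
  qed
  finally show ?thesis .
qed

lemma slot_sum_0: "slot_sum x W D b 0 = 0"
  by (simp add: slot_sum_def)

text \<open>On completion of the oldest window the slots shift by one: slot \<open>b\<close> takes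
  over from slot \<open>Suc b\<close>, including the current reward. Otherwise the reward is added
  once the window of the slot has begun, which happens when the phase reaches
  \<open>b * D\<close>.\<close>

lemma slot_sum_Suc:
  assumes b: "b < W div D"
  shows "slot_sum x W D b (Suc t) =
    (if phase W D t = W - 1 then (if Suc b < W div D then slot_sum x W D (Suc b) t + x t else 0)
     else if b * D \<le> phase W D t then slot_sum x W D b t + x t else slot_sum x W D b t)"
proof -
  have le: "phase W D t \<le> t" by (rule phase_le)
  have W_eq: "W = W div D * D" using dvd by simp
  have "Suc b * D \<le> W div D * D" using b by (intro mult_le_mono1) simp
  then have bW: "Suc b * D \<le> W" using W_eq by simp
  consider (shift) "phase W D t = W - 1" | (add) "phase W D t \<noteq> W - 1" "b * D \<le> phase W D t"
    | (idle) "phase W D t \<noteq> W - 1" "phase W D t < b * D" by fastforce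
  then show ?thesis
  proof cases
    case shift
    have start: "Suc t - phase W D (Suc t) + b * D = t - phase W D t + Suc b * D"
      using shift le phase_Suc[of t] D_le_W W by simp
    show ?thesis
    proof (cases "Suc b < W div D")
      case True
      then have "Suc (Suc b) * D \<le> W div D * D" by (intro mult_le_mono1) simp
      then have "Suc b * D < W" using W_eq D by simp
      then have "t - phase W D t + Suc b * D \<le> t" using shift le by simp
      with start True shift show ?thesis
        unfolding slot_sum_def by (simp add: sum.atLeastLessThan_Suc del: mult_Suc)
    next
      case False
      \<comment> \<open>As \<open>D\<close> divides \<open>W\<close>, the newest slot starts
        precisely at time \<open>Suc t\<close>, so nothing has been collected for it yet.\<close>
      then have "Suc b = W div D" using b by simp
      then have "Suc b * D = W" using W_eq by simp
      then have "Suc t \<le> t - phase W D t + Suc b * D" using shift le W by simp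
      with start False shift show ?thesis
        unfolding slot_sum_def by (simp del: mult_Suc)
    qed
  next
    case add
    have "Suc t - phase W D (Suc t) = t - phase W D t" using add le phase_Suc[of t] by simp
    moreover have "t - phase W D t + b * D \<le> t" using add le by simp
    ultimately show ?thesis using add
      unfolding slot_sum_def by (simp add: sum.atLeastLessThan_Suc)
  next
    case idle
    have "Suc t - phase W D (Suc t) = t - phase W D t" using idle le phase_Suc[of t] by simp
    moreover have "Suc t \<le> t - phase W D t + b * D" using idle le by simp
    ultimately show ?thesis using idle
      unfolding slot_sum_def by simp
  qed
qed

text \<open>At most \<open>phase W D t\<close>, hence fewer than \<open>W\<close>, rewards have been
  added. The maximum with 1 keeps the bound strict when all rewards are 0. This justifies the radix
  of the sum digits.\<close>

lemma slot_sum_less: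
  assumes "\<And>j. x j \<le> mx"
  shows "slot_sum x W D b t < max 1 mx * W"
proof -
  have "slot_sum x W D b t \<le> of_nat (card {t - phase W D t + b * D..<t}) * mx"
    unfolding slot_sum_def by (rule sum_bounded_above) (use assms in auto)
  also have "\<dots> \<le> phase W D t * max 1 mx" 
    by (rule mult_mono) (use phase_le[of t] in auto)
  also have "\<dots> < W * max 1 mx" using phase_less by simp
  finally show ?thesis by (simp add: mult.commute)
qed

text \<open>The left side is the definition of window stability, the right side a condition on what
  the monitor knows at a single state: its phase, the sum of slot 0 and the current reward.\<close>

lemma window_sums_iff:
  "(\<forall>l. P (\<Sum>j<W. x (l * D + j))) \<longleftrightarrow> (\<forall>t. phase W D t = W - 1 \<longrightarrow> P (slot_sum x W D 0 t + x t))"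
proof -
  have eq: "slot_sum x W D 0 (l * D + (W - 1)) + x (l * D + (W - 1)) = (\<Sum>j<W. x (l * D + j))" for l
  proof -
    let ?t = "l * D + (W - 1)"
    have "phase W D ?t = W - 1" using phase_last by blast
    then have "slot_sum x W D 0 ?t + x ?t = (\<Sum>j = l * D..<Suc ?t. x j)"
      by (simp add: slot_sum_def)
    also have "\<dots> = (\<Sum>j = l * D..<l * D + W. x j)" using W by simp
    also have "\<dots> = (\<Sum>j<W. x (l * D + j))"
      using sum.shift_bounds_nat_ivl[of x 0 "l * D" W] by (simp add: add.commute lessThan_atLeast0)
    finally show ?thesis .
  qed
  then show ?thesis using phase_last by metis
qed

end

text \<open>A negative ceiling becomes 0, which every sum of rewards meets.\<close>

definition sum_lower :: "rat \<Rightarrow> nat \<Rightarrow> nat" where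
  "sum_lower a W = nat \<lceil>a * of_nat W\<rceil>"

text \<open>A strict bound, so that a negative upper bound becomes 0 and admits no sum at all; with
  a non-strict bound, truncation to 0 would wrongly admit the sum 0.\<close>

definition sum_upper :: "rat \<Rightarrow> nat \<Rightarrow> nat" where
  "sum_upper a W = nat (\<lfloor>a * of_nat W\<rfloor> + 1)"

lemma mean_bounds_iff:
  assumes "0 < W"
  shows "a \<le> of_nat S / of_nat W \<and> of_nat S / of_nat W \<le> b \<longleftrightarrow> sum_lower a W \<le> S \<and> S < sum_upper b W"
proof -
  have "a \<le> of_nat S / of_nat W \<longleftrightarrow> a * of_nat W \<le> of_int (int S)"
    using assms by (simp add: field_simps)
  also have "\<dots> \<longleftrightarrow> sum_lower a W \<le> S" unfolding sum_lower_def ceiling_le_iff[symmetric] by linarith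
  finally have 1: "a \<le> of_nat S / of_nat W \<longleftrightarrow> sum_lower a W \<le> S" .
  have "of_nat S / of_nat W \<le> b \<longleftrightarrow> of_int (int S) \<le> b * of_nat W"
    using assms by (simp add: field_simps)
  also have "\<dots> \<longleftrightarrow> S < sum_upper b W" unfolding sum_upper_def le_floor_iff[symmetric] by linarith
  finally show ?thesis using 1 by simp
qed

definition sums_ok :: "window \<Rightarrow> nat reward \<Rightarrow> nat \<Rightarrow> (nat \<Rightarrow> nat) \<Rightarrow> bool" where
  "sums_ok w \<rho> i r \<longleftrightarrow>
     (\<forall>t. phase (win_len w) (win_step w) t = win_len w - 1 \<longrightarrow>
        (let S = slot_sum (\<lambda>j. rew \<rho> (r j) ! i) (win_len w) (win_step w) 0 t + rew \<rho> (r t) ! i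
         in sum_lower (lower w ! i) (win_len w) \<le> S \<and> S < sum_upper (upper w ! i) (win_len w)))"

lemma window_objective_iff:
  assumes "window w" "r \<in> runs G"
  shows "r \<in> window_objective G w \<rho> \<longleftrightarrow> (\<forall>i < win_dim w. sums_ok w \<rho> i r)"
proof -
  have w: "0 < win_len w" "0 < win_step w" "win_step w dvd win_len w"
    using assms(1) by (auto simp: window_def)
  define P where "P i S \<longleftrightarrow> sum_lower (lower w ! i) (win_len w) \<le> S \<and> S < sum_upper (upper w ! i) (win_len w)" for i S
  have "(lower w ! i \<le> lmp (win_len w) (win_step w) \<rho> l r i \<and> lmp (win_len w) (win_step w) \<rho> l r i \<le> upper w ! i)
     \<longleftrightarrow> P i (\<Sum>j<win_len w. rew \<rho> (r (l * win_step w + j)) ! i)" for i l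
    using mean_bounds_iff[OF w(1), of "lower w ! i" "\<Sum>j<win_len w. rew \<rho> (r (l * win_step w + j)) ! i" "upper w ! i"]
    by (simp add: P_def lmp_def of_nat_sum)
  then have "r \<in> window_objective G w \<rho> \<longleftrightarrow>
      (\<forall>i < win_dim w. \<forall>l. P i (\<Sum>j<win_len w. rew \<rho> (r (l * win_step w + j)) ! i))"
    using assms(2) unfolding window_objective_def by blast
  also have "\<dots> \<longleftrightarrow> (\<forall>i < win_dim w. sums_ok w \<rho> i r)"
    unfolding sums_ok_def Let_def
    using window_sums_iff[OF w, of "P _" "\<lambda>j. rew \<rho> (r j) ! _"] unfolding P_def by simp
  finally show ?thesis .
qed

section \<open>Adding a digit to the tables\<close>

definition agree :: "nat set \<Rightarrow> memory \<Rightarrow> memory \<Rightarrow> bool" where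
  "agree A m m' \<longleftrightarrow> (\<forall>a. a \<notin> A \<longrightarrow> (\<forall>i. m' a i = m a i))"

lemma agree_refl [simp]: "agree A m m"
  by (simp add: agree_def)

lemma agree_trans: "agree A m m' \<Longrightarrow> agree B m' m'' \<Longrightarrow> A \<subseteq> C \<Longrightarrow> B \<subseteq> C \<Longrightarrow> agree C m m''"
  by (auto simp: agree_def subset_iff) metis

lemma agree_mono: "agree A m m' \<Longrightarrow> A \<subseteq> B \<Longrightarrow> agree B m m'"
  by (auto simp: agree_def)

lemma agreeD_fun: "agree A m m' \<Longrightarrow> a \<notin> A \<Longrightarrow> m' a = m a"
  by (auto simp: agree_def)

lemma agree_put [simp]: "a \<in> A \<Longrightarrow> agree A m (put m' a i v) \<longleftrightarrow> agree A m m'"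
  by (auto simp: agree_def put_apply)

text \<open>The tables of a monitor with \<open>N\<close> states are the arrays 1 (state of the game), 2 (code of the
  next monitor state), 3 (violations), 4 (phase) and 5 (current sum of the latest slot). \<open>N\<close> itself
  is scalar 6, and scalar 19 is always 1. All of our scratch arrays are below 60, and input array
  \<open>a\<close> is found at \<open>60 + a\<close>. A digit with radix scalar 7 is prepended to all states; the loop counts
  down so that the old tables, which are a prefix of the new ones, are overwritten last.\<close>

definition fill_multiples :: prog where
  "fill_multiples = Seq (Const 12 0) (Seq (Const 8 0) (Seq (Sub 14 7 12) (While 14
     (Seq (Store 11 12 8) (Seq (Add 8 8 6) (Seq (Add 12 12 19) (Sub 14 7 12)))))))"

lemma wp_fill_multiples:
  assumes "m 6 0 = N" "m 7 0 = R" "m 19 0 = 1"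
  shows "wp fill_multiples (R * 5 + 4)
    (\<lambda>m' out'. out' = out \<and> agree {8, 11, 12, 14} m m' \<and> m' 8 0 = N * R \<and> (\<forall>i<R. m' 11 i = i * N)) m out"
proof -
  have "wp (While 14 (Seq (Store 11 12 8) (Seq (Add 8 8 6) (Seq (Add 12 12 19) (Sub 14 7 12))))) (R * 5 + 1)
    (\<lambda>m' out'. out' = out \<and> agree {8, 11, 12, 14} m m' \<and> m' 8 0 = N * R \<and> (\<forall>i<R. m' 11 i = i * N))
    (put (put (put m 12 0 0) 8 0 0) 14 0 R) out"
  proof (rule wp_While[where \<mu> = "\<lambda>m. m 14 0" and k = 4 and
      I = "\<lambda>m' out'. out' = out \<and> agree {8, 11, 12, 14} m m' \<and> m' 14 0 = R - m' 12 0 \<and> m' 12 0 \<le> R \<and>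
        m' 8 0 = N * m' 12 0 \<and> (\<forall>i<m' 12 0. m' 11 i = i * N)"], goal_cases)
    case (2 m1 out1)
    then have "m1 6 0 = N" "m1 7 0 = R" "m1 19 0 = 1" using assms by (auto simp: agree_def)
    with 2 show ?case by (auto simp: wps put_apply less_Suc_eq mult.commute)
  qed (auto simp: put_apply)
  with assms show ?thesis
    unfolding fill_multiples_def
    by (simp add: wps put_apply eval_nat_numeral)
qed

text \<open>The machine cannot multiply or divide. Quotient and remainder of the loop counter
  (scalar 8) by \<open>N\<close> are therefore maintained as counters in scalars 10 and 9, and
  multiples of \<open>N\<close> are read from array 11. The counters start at \<open>R\<close> and
  0, and the first iteration wraps them around. Scalar 13 saves the new size, which ends up in
  scalar 6.\<close>

definition stage :: "prog \<Rightarrow> prog" where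
  "stage body = Seq fill_multiples (Seq (Const 13 0) (Seq (Add 13 13 8) (Seq (Const 9 0) (Seq (Const 10 0)
     (Seq (Add 10 10 7) (Seq
       (While 8
          (Seq (Sub 8 8 19)
          (Seq (If 9 Skip (Seq (Const 9 0) (Seq (Add 9 9 6) (Sub 10 10 19))))
          (Seq (Sub 9 9 19) body))))
     (Seq (Const 6 0) (Add 6 6 13))))))))"

text \<open>\<open>F x v a\<close> is the entry that \<open>body\<close> has to write into table
  \<open>a\<close> at index \<open>x * N + v\<close>, computed from row \<open>v\<close> of the
  tables as they were before the stage.\<close>

lemma wp_stage:
  assumes m0: "mi 6 0 = N" "mi 7 0 = R" "mi 19 0 = 1" and N: "0 < N"
    and body: "\<And>m x v u out. agree ({1..5} \<union> {8..18}) mi m \<Longrightarrow> \<forall>i<R. m 11 i = i * N \<Longrightarrow>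
       m 8 0 = u \<Longrightarrow> m 9 0 = v \<Longrightarrow> m 10 0 = x \<Longrightarrow> v < N \<Longrightarrow> x < R \<Longrightarrow>
       (\<forall>a\<in>{1..5}. m a v = mi a v) \<Longrightarrow>
       wp body K (\<lambda>m' out'. out' = out \<and> agree ({1..5} \<union> {14..18}) m m' \<and>
         (\<forall>a\<in>{1..5}. \<forall>j. m' a j = (if j = u then F x v a else m a j))) m out"
    and T: "N * R * (K + 14) + R * 5 \<le> T"
  shows "wp (stage body) (T + 20) (\<lambda>m' out'. out' = out \<and> agree {1..18} mi m' \<and> m' 6 0 = N * R \<and> m' 7 0 = R \<and>
     (\<forall>a\<in>{1..5}. \<forall>j<N * R. m' a j = F (j div N) (j mod N) a)) mi out"
proof -
  let ?S = "{1..5} \<union> {8..18} :: nat set"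
  let ?Q = "\<lambda>m' out'. out' = out \<and> agree {1..18} mi m' \<and> m' 6 0 = N * R \<and> m' 7 0 = R \<and>
     (\<forall>a\<in>{1..5}. \<forall>j<N * R. m' a j = F (j div N) (j mod N) a)"
  let ?body = "(Seq (Sub 8 8 19)
          (Seq (If 9 Skip (Seq (Const 9 0) (Seq (Add 9 9 6) (Sub 10 10 19))))
          (Seq (Sub 9 9 19) body)))"
  \<comment> \<open>The source row \<open>v\<close> of index \<open>u = x * N + v\<close> satisfies
    \<open>v \<le> u\<close>, so it is still old when the descending loop reaches \<open>u\<close>.
    For \<open>x = 0\<close> source and target coincide, and the body reads each entry before
    writing it.\<close>
  define I where "I m' out' \<longleftrightarrow> out' = out \<and> agree ?S mi m' \<and> (\<forall>i<R. m' 11 i = i * N) \<and>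
        m' 13 0 = N * R \<and> m' 8 0 = m' 10 0 * N + m' 9 0 \<and> m' 9 0 < N \<and> m' 8 0 \<le> N * R \<and>
        (\<forall>a\<in>{1..5}. (\<forall>j<m' 8 0. j < N \<longrightarrow> m' a j = mi a j) \<and>
          (\<forall>j<N * R. m' 8 0 \<le> j \<longrightarrow> m' a j = F (j div N) (j mod N) a))" for m' :: memory and out'
  have step: "wp ?body (K + 8) (\<lambda>m' out'. I m' out' \<and> m' 8 0 < m 8 0) m out'"
    if I: "I m out'" and pos: "m 8 0 \<noteq> 0" for m out'
  proof -
    define u where "u = m 8 0 - 1"
    define v where "v = (if m 9 0 = 0 then N - 1 else m 9 0 - 1)"
    define x where "x = (if m 9 0 = 0 then m 10 0 - 1 else m 10 0)"
    have sc: "m 6 0 = N" "m 19 0 = 1" using I m0 by (auto simp: I_def agree_def)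
    have uv: "u = x * N + v" "v < N" "u < m 8 0" "u < N * R"
    proof -
      have *: "m 8 0 = m 10 0 * N + m 9 0" "m 9 0 < N" "m 8 0 \<le> N * R" using I by (auto simp: I_def)
      show "v < N" using * N by (auto simp: v_def)
      show "u < m 8 0" using pos by (simp add: u_def)
      then show "u < N * R" using *(3) by linarith
      show "u = x * N + v"
        using * pos N by (cases "m 10 0") (auto simp: u_def v_def x_def)
    qed
    have xR: "x < R"
    proof (rule ccontr)
      assume "\<not> x < R"
      then have "R * N \<le> x * N" by simp
      then show False using uv(1,4) mult.commute[of N R] by linarith
    qed
    have dm: "u div N = x" "u mod N = v" using uv by simp_all
    define m1 where "m1 = put (if m 9 0 = 0 then put (put (put (put m 8 0 u) 9 0 0) 9 0 N) 10 0 x else put m 8 0 u) 9 0 v"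
    have a1: "agree {8, 9, 10} m m1" "m1 8 0 = u" "m1 9 0 = v" "m1 10 0 = x"
      by (auto simp: m1_def agree_def put_apply x_def)
    have am1: "agree ?S mi m1"
      by (rule agree_trans[OF _ a1(1), of ?S]) (use I in \<open>auto simp: I_def\<close>)
    have "wp body K (\<lambda>m' out''. out'' = out' \<and> agree ({1..5} \<union> {14..18}) m1 m' \<and>
         (\<forall>a\<in>{1..5}. \<forall>j. m' a j = (if j = u then F x v a else m1 a j))) m1 out'"
    proof (rule body)
      show "agree ?S mi m1" by (rule am1)
      show "\<forall>i<R. m1 11 i = i * N" using I a1(1) by (auto simp: I_def agree_def)
      show "\<forall>a\<in>{1..5}. m1 a v = mi a v"
        using I uv a1(1) by (auto simp: I_def agree_def)
    qed (use a1 uv xR in auto)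
    then have "wp body K (\<lambda>m' out'. I m' out' \<and> m' 8 0 < m 8 0) m1 out'"
    proof (rule wp_mono)
      fix m' out'' assume *: "out'' = out' \<and> agree ({1..5} \<union> {14..18}) m1 m' \<and>
         (\<forall>a\<in>{1..5}. \<forall>j. m' a j = (if j = u then F x v a else m1 a j))"
      then have k: "m' 8 0 = u" "m' 9 0 = v" "m' 10 0 = x" "m' 11 = m 11" "m' 13 0 = m 13 0"
        using a1 by (auto simp: agree_def)
      have "agree ?S m1 m'" using * by (auto elim: agree_mono)
      then have "agree ?S mi m'" by (rule agree_trans[OF am1]) auto
      moreover have "m' a j = (if j = u then F x v a else m a j)" if "a \<in> {1..5}" for a j
        using * that a1(1) by (auto simp: agree_def)
      ultimately show "I m' out'' \<and> m' 8 0 < m 8 0"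
        using I k uv dm * unfolding I_def by (auto simp: u_def)
    qed simp
    moreover have "put m 8 0 u = put m 8 0 (m 8 0 - 1)" by (simp add: u_def)
    ultimately show ?thesis
      using sc by (auto simp: wps put_apply m1_def v_def x_def u_def split: if_splits elim: wp_le)
  qed
  have "wp fill_multiples (R * 5 + 4) (\<lambda>m out'. wp (Seq (Const 13 0) (Seq (Add 13 13 8) (Seq (Const 9 0) (Seq (Const 10 0)
     (Seq (Add 10 10 7) (Seq (While 8 ?body) (Seq (Const 6 0) (Add 6 6 13)))))))) (N * R * (K + 9) + 10) ?Q m out') mi out"
  proof (rule wp_mono[OF wp_fill_multiples[where m = mi and N = N and R = R, OF m0]])
    fix m out' assume *: "out' = out \<and> agree {8, 11, 12, 14} mi m \<and> m 8 0 = N * R \<and> (\<forall>i<R. m 11 i = i * N)"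
    define m1 where "m1 = put (put (put (put (put m 13 0 0) 13 0 (N * R)) 9 0 0) 10 0 0) 10 0 R"
    have "m 7 0 = R" using * m0 by (auto simp: agree_def)
    have a1: "agree ?S mi m1" using * by (auto simp: m1_def elim: agree_mono)
    have "wp (While 8 ?body) (N * R * (K + 9) + 1)
       (\<lambda>m' out'. wp (Seq (Const 6 0) (Add 6 6 13)) 2 ?Q m' out') m1 out"
    proof (rule wp_While[where I = I and \<mu> = "\<lambda>m. m 8 0" and k = "K + 8"])
      show "I m1 out"
        using * N a1 m0 unfolding I_def by (auto simp: m1_def put_apply mult.commute) (auto simp: agree_def)
      show "wp (Seq (Const 6 0) (Add 6 6 13)) 2 ?Q m' out'" if I: "I m' out'" and z: "m' 8 0 = 0" for m' out'
      proof -
        have "agree {1..18} mi m'" using I unfolding I_def by (auto elim: agree_mono)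
        moreover have "m' 7 0 = R" using I m0 unfolding I_def by (auto simp: agree_def)
        ultimately show ?thesis using I z unfolding I_def by (simp add: wps put_apply)
      qed
    qed (use step * in \<open>auto simp: m1_def put_apply\<close>)
    then have "wp (Seq (While 8 ?body) (Seq (Const 6 0) (Add 6 6 13))) (N * R * (K + 9) + 3) ?Q m1 out"
      by (rule wp_Seq) simp
    then show "wp (Seq (Const 13 0) (Seq (Add 13 13 8) (Seq (Const 9 0) (Seq (Const 10 0)
     (Seq (Add 10 10 7) (Seq (While 8 ?body) (Seq (Const 6 0) (Add 6 6 13)))))))) (N * R * (K + 9) + 10) ?Q m out'"
      using * \<open>m 7 0 = R\<close> by (subst wps put_apply, simp)+ (auto simp: m1_def elim: wp_mono)
  qed simp
  then have "wp (stage body) ((R * 5 + 4) + (N * R * (K + 9) + 10)) ?Q mi out"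
    unfolding stage_def by (rule wp_Seq) simp
  then show ?thesis
    by (rule wp_mono) (use T in \<open>auto simp: algebra_simps\<close>)
qed

text \<open>\<open>X t\<close> is the value of the new digit along \<open>r\<close>. It obeys the
  recursion given by \<open>d\<close>, so a stage is understood once this recursion is solved; the
  new tables at time \<open>t\<close> then hold \<open>F\<close> at \<open>X t\<close> and the old
  monitor state.\<close>

lemma wp_stage_monitor:
  assumes m0: "mi 6 0 = N" "mi 7 0 = R" "mi 19 0 = 1" and mt: "monitor_tables n N (mi 1) (mi 2)" and R: "0 < R"
    and body: "\<And>m x v u out. agree ({1..5} \<union> {8..18}) mi m \<Longrightarrow> \<forall>i<R. m 11 i = i * N \<Longrightarrow>
       m 8 0 = u \<Longrightarrow> m 9 0 = v \<Longrightarrow> m 10 0 = x \<Longrightarrow> v < N \<Longrightarrow> x < R \<Longrightarrow>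
       (\<forall>a\<in>{1..5}. m a v = mi a v) \<Longrightarrow>
       wp body K (\<lambda>m' out'. out' = out \<and> agree ({1..5} \<union> {14..18}) m m' \<and>
         (\<forall>a\<in>{1..5}. \<forall>j. m' a j = (if j = u then F x v a else m a j))) m out"
    and F: "\<And>x v. v < N \<Longrightarrow> x < R \<Longrightarrow> F x v 1 = mi 1 v \<and> F x v 2 = d x v * N + mi 2 v \<and> d x v < R"
  shows "wp (stage body) (N * R * (K + 50)) (\<lambda>m' out'. out' = out \<and> agree {1..18} mi m' \<and> m' 6 0 = N * R \<and> m' 7 0 = R \<and>
     monitor_tables n (N * R) (m' 1) (m' 2) \<and>
     (\<forall>r. (\<forall>t. r t < n) \<longrightarrow> (\<exists>X. X 0 = 0 \<and> (\<forall>t. X t < R \<and> X (Suc t) = d (X t) (track (mi 2) r t)) \<and>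
       (\<forall>t. \<forall>a\<in>{1..5}. m' a (track (m' 2) r t) = F (X t) (track (mi 2) r t) a)))) mi out"
proof -
  have N: "0 < N" using mt by (auto simp: monitor_tables_def)
  have "R * 5 + 20 \<le> N * R * 25"
  proof -
    have "1 * 1 \<le> N * R" "1 * R \<le> N * R" using N R by (intro mult_le_mono; simp)+
    then show ?thesis by linarith
  qed
  then have "N * R * (K + 14) + R * 5 \<le> N * R * (K + 50) - 20"
    by (simp add: algebra_simps)
  then have "wp (stage body) (N * R * (K + 50) - 20 + 20) (\<lambda>m' out'. out' = out \<and> agree {1..18} mi m' \<and> m' 6 0 = N * R \<and> m' 7 0 = R \<and>
     (\<forall>a\<in>{1..5}. \<forall>j<N * R. m' a j = F (j div N) (j mod N) a)) mi out"
    by (intro wp_stage[where F = F and K = K and mi = mi and N = N and R = R, OF m0 N]) (rule body; assumption)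
  then show ?thesis
  proof (rule wp_mono, goal_cases)
    case (1 m' out')
    then have m': "\<And>a j. a \<in> {1..5} \<Longrightarrow> j < N * R \<Longrightarrow> m' a j = F (j div N) (j mod N) a" by blast
    have dm: "j mod N < N" "j div N < R" if "j < N * R" for j
      using N that by (auto simp: less_mult_imp_div_less mult.commute)
    interpret digit_extension n N R "mi 1" "mi 2" "m' 1" "m' 2" d
      using mt R F m' dm by unfold_locales auto
    have "\<exists>X. X 0 = 0 \<and> (\<forall>t. X t < R \<and> X (Suc t) = d (X t) (track (mi 2) r t)) \<and>
       (\<forall>t. \<forall>a\<in>{1..5}. m' a (track (m' 2) r t) = F (X t) (track (mi 2) r t) a)"
      if r: "\<forall>t. r t < n" for r
    proof (intro exI[of _ "\<lambda>t. track (m' 2) r t div N"] conjI allI ballI)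
      show "track (m' 2) r 0 div N = 0" using track_div(1)[of r] r by simp
      show "track (m' 2) r (Suc t) div N = d (track (m' 2) r t div N) (track (mi 2) r t)" for t
        using track_div(2)[of r t] r by simp
      have l: "track (m' 2) r t < N * R" for t using track_less[OF tables', of r t] r by simp
      then show "track (m' 2) r t div N < R" for t using dm by blast
      show "m' a (track (m' 2) r t) = F (track (m' 2) r t div N) (track (mi 2) r t) a" if "a \<in> {1..5}" for a t
        using m'[OF that l] track_mod[of r t] r by simp
    qed
    then show ?case using 1 tables' by blast
  next
    case 2
    have "20 \<le> N * R * (K + 50)" using \<open>R * 5 + 20 \<le> N * R * 25\<close> by (simp add: algebra_simps)
    then show ?case by simp
  qed
qed

section \<open>The monitor of a window as a program\<close>

text \<open>The property \<open>Q\<close> is recognised by the flags in array 3: it holds iff none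
  is ever met. Quantification is over all sequences of state numbers, not just runs, because the
  tables are built without inspecting the edges.\<close>

definition Mon :: "nat \<Rightarrow> nat \<Rightarrow> ((nat \<Rightarrow> nat) \<Rightarrow> bool) \<Rightarrow> memory \<Rightarrow> bool" where
  "Mon n N Q m \<longleftrightarrow> m 6 0 = N \<and> m 19 0 = 1 \<and> monitor_tables n N (m 1) (m 2) \<and>
     (\<forall>r. (\<forall>t. r t < n) \<longrightarrow> ((\<forall>t. m 3 (track (m 2) r t) = 0) \<longleftrightarrow> Q r))"

definition tracks :: "nat \<Rightarrow> memory \<Rightarrow> nat \<Rightarrow> ((nat \<Rightarrow> nat) \<Rightarrow> nat \<Rightarrow> nat) \<Rightarrow> bool" where
  "tracks n m a y \<longleftrightarrow> (\<forall>r. (\<forall>t. r t < n) \<longrightarrow> (\<forall>t. m a (track (m 2) r t) = y r t))"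

lemma table_arrays: "{1..5::nat} = {1, 2, 3, 4, 5}"
  by auto

text \<open>The digit itself is the phase. Array 5 is filled with it as a placeholder only: the
  first slot treated is the newest, which restarts from 0 rather than from array 5.\<close>

definition phase_body :: "nat \<Rightarrow> nat \<Rightarrow> prog" where
  "phase_body W D =
     Seq (Load 15 1 9) (Seq (Store 1 8 15) (Seq (Load 15 3 9) (Seq (Store 3 8 15)
     (Seq (Store 4 8 10) (Seq (Store 5 8 10)
     (Seq (Const 16 (W - 1)) (Seq (Sub 17 16 10) (Seq (If 17 (Add 16 10 19) (Const 16 (W - D)))
     (Seq (Load 16 11 16) (Seq (Load 15 2 9) (Seq (Add 15 15 16) (Store 2 8 15))))))))))))"

lemma wp_phase_body:
  assumes "agree ({1..5} \<union> {8..18}) mi m" "\<forall>i<W. m 11 i = i * N"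
       "m 8 0 = u" "m 9 0 = v" "m 10 0 = x" "x < W" "0 < D"
       "\<forall>a\<in>{1..5}. m a v = mi a v" "mi 19 0 = 1"
  shows "wp (phase_body W D) 20 (\<lambda>m' out'. out' = out \<and> agree ({1..5} \<union> {14..18}) m m' \<and>
         (\<forall>a\<in>{1..5}. \<forall>j. m' a j = (if j = u then
           (if a = 1 then mi 1 v else if a = 2 then (if x = W - 1 then W - D else Suc x) * N + mi 2 v
            else if a = 3 then mi 3 v else x) else m a j))) m out"
proof -
  have "m 19 0 = 1" using assms by (auto simp: agree_def)
  moreover have "W - 1 - x \<noteq> 0 \<longleftrightarrow> x \<noteq> W - 1" using assms by auto
  moreover have "x \<noteq> W - 1 \<Longrightarrow> Suc x < W" "W - D < W" using assms by auto
  ultimately show ?thesis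
    using assms(2-8) unfolding table_arrays phase_body_def
    by (simp add: wps put_apply)
qed

definition phase_stage :: "nat \<Rightarrow> nat \<Rightarrow> prog" where
  "phase_stage W D = Seq (Const 7 W) (stage (phase_body W D))"

lemma wp_phase_stage:
  assumes W: "0 < W" and D: "0 < D" and dvd: "D dvd W" and M: "Mon n N Q m"
  shows "wp (phase_stage W D) (N * W * 80) (\<lambda>m' out'. out' = out \<and> agree {1..18} m m' \<and>
    Mon n (N * W) Q m' \<and> tracks n m' 4 (\<lambda>r. phase W D)) m out"
proof -
  define mi where "mi = put m 7 0 W"
  define F where "F x v a = (if a = (1::nat) then mi 1 v else if a = 2 then (if x = W - 1 then W - D else Suc x) * N + mi 2 v
            else if a = 3 then mi 3 v else x)" for x v a
  have M': "m 6 0 = N" "m 19 0 = 1" "monitor_tables n N (m 1) (m 2)"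
    "\<And>r. \<forall>t. r t < n \<Longrightarrow> (\<forall>t. m 3 (track (m 2) r t) = 0) \<longleftrightarrow> Q r"
    using M by (auto simp: Mon_def)
  have mi: "mi 6 0 = N" "mi 7 0 = W" "mi 19 0 = 1" "mi 1 = m 1" "mi 2 = m 2" "mi 3 = m 3"
    using M' by (auto simp: mi_def put_apply)
  have N: "0 < N" using M'(3) by (simp add: monitor_tables_def)
  have "wp (stage (phase_body W D)) (N * W * (20 + 50)) (\<lambda>m' out'. out' = out \<and> agree {1..18} mi m' \<and> m' 6 0 = N * W \<and> m' 7 0 = W \<and>
     monitor_tables n (N * W) (m' 1) (m' 2) \<and>
     (\<forall>r. (\<forall>t. r t < n) \<longrightarrow> (\<exists>X. X 0 = 0 \<and> (\<forall>t. X t < W \<and> X (Suc t) = (\<lambda>x v. if x = W - 1 then W - D else Suc x) (X t) (track (mi 2) r t)) \<and>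
       (\<forall>t. \<forall>a\<in>{1..5}. m' a (track (m' 2) r t) = F (X t) (track (mi 2) r t) a)))) mi out"
  proof (rule wp_stage_monitor)
    fix m x v u out
    assume "agree ({1..5} \<union> {8..18}) mi m" "\<forall>i<W. m 11 i = i * N"
       "m 8 0 = u" "m 9 0 = v" "m 10 0 = x" "x < W" "\<forall>a\<in>{1..5}. m a v = mi a v"
    then show "wp (phase_body W D) 20 (\<lambda>m' out'. out' = out \<and> agree ({1..5} \<union> {14..18}) m m' \<and>
         (\<forall>a\<in>{1..5}. \<forall>j. m' a j = (if j = u then F x v a else m a j))) m out"
      unfolding F_def using mi(3) D by (intro wp_phase_body) auto
  qed (use mi M' W D in \<open>auto simp: F_def\<close>)
  then have "wp (stage (phase_body W D)) (N * W * (20 + 50)) (\<lambda>m' out'. out' = out \<and> agree {1..18} m m' \<and>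
    Mon n (N * W) Q m' \<and> tracks n m' 4 (\<lambda>r. phase W D)) mi out"
  proof (rule wp_mono)
    fix m' out'
    assume *: "out' = out \<and> agree {1..18} mi m' \<and> m' 6 0 = N * W \<and> m' 7 0 = W \<and>
     monitor_tables n (N * W) (m' 1) (m' 2) \<and>
     (\<forall>r. (\<forall>t. r t < n) \<longrightarrow> (\<exists>X. X 0 = 0 \<and> (\<forall>t. X t < W \<and> X (Suc t) = (\<lambda>x v. if x = W - 1 then W - D else Suc x) (X t) (track (mi 2) r t)) \<and>
       (\<forall>t. \<forall>a\<in>{1..5}. m' a (track (m' 2) r t) = F (X t) (track (mi 2) r t) a)))"
    have agr: "agree {1..18} m m'" using * by (auto simp: mi_def agree_def put_apply)
    have key: "m' 4 (track (m' 2) r t) = phase W D t \<and> m' 3 (track (m' 2) r t) = m 3 (track (m 2) r t)"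
      if "\<forall>t. r t < n" for r t
    proof -
      obtain X where X: "X 0 = 0" "\<And>t. X (Suc t) = (if X t = W - 1 then W - D else Suc (X t))"
        "\<And>t a. a\<in>{1..5} \<Longrightarrow> m' a (track (m' 2) r t) = F (X t) (track (mi 2) r t) a"
        using * \<open>\<forall>t. r t < n\<close> by metis
      have "X t = phase W D t" for t
        by (induction t) (simp_all add: X phase_0[OF W D dvd] phase_Suc[OF W D dvd])
      then show ?thesis using X(3)[of 4 t] X(3)[of 3 t] mi by (simp add: F_def)
    qed
    then have "tracks n m' 4 (\<lambda>r. phase W D)" by (simp add: tracks_def)
    moreover have "Mon n (N * W) Q m'" using * M' key agr by (simp add: Mon_def agree_def)
    ultimately show "out' = out \<and> agree {1..18} m m' \<and>
      Mon n (N * W) Q m' \<and> tracks n m' 4 (\<lambda>r. phase W D)" using * agr by blast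
  qed simp
  moreover have "1 \<le> N * W" using N W by simp
  ultimately show ?thesis
    unfolding phase_stage_def by (auto simp: wps mi_def elim: wp_le)
qed

section \<open>The digit for one slot of one dimension\<close>

definition violation_check :: "nat \<Rightarrow> nat \<Rightarrow> nat \<Rightarrow> prog" where
  "violation_check W lo hi =
     Seq (Const 14 (W - 1)) (Seq (Sub 14 14 17)
     (If 14 Skip (Seq (Const 14 lo) (Seq (Sub 14 14 15) (Seq (If 14 (Const 16 1) Skip)
       (Seq (Const 14 hi) (Seq (Sub 14 14 15) (If 14 Skip (Const 16 1)))))))))"

lemma wp_violation_check:
  "wp (violation_check W lo hi) 11 (\<lambda>m' out'. out' = out \<and> agree {14, 16} m m' \<and>
     m' 16 0 = (if W - 1 \<le> m 17 0 \<and> \<not> (lo \<le> m 15 0 \<and> m 15 0 < hi) then 1 else m 16 0)) m out"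
  unfolding violation_check_def
  by (cases "W \<le> Suc (m 17 0)"; cases "lo \<le> m 15 0"; cases "m 15 0 < hi")
    (simp_all add: wps put_apply le_diff_conv)

text \<open>The recursion of \<open>slot_sum_Suc\<close>, with \<open>x\<close> the old sum,
  \<open>y\<close> the sum including the current reward and \<open>y0\<close> that of the next slot.
  The final cut-off keeps the digit below \<open>R\<close> at states that no run reaches; on actual
  runs \<open>slot_sum_less\<close> excludes it.\<close>

definition slot_digit :: "nat \<Rightarrow> nat \<Rightarrow> nat \<Rightarrow> nat \<Rightarrow> bool \<Rightarrow> nat \<Rightarrow> nat \<Rightarrow> nat \<Rightarrow> nat \<Rightarrow> nat" where
  "slot_digit R W D b newest c y0 x y =
     (let z = (if W - 1 \<le> c then (if newest then 0 else y0) else if c < b * D then x else y)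
      in if z < R then z else 0)"

definition next_digit :: "nat \<Rightarrow> nat \<Rightarrow> nat \<Rightarrow> bool \<Rightarrow> prog" where
  "next_digit W D b newest =
     Seq (if newest then Const 18 0 else Skip)
     (Seq (Const 14 (W - 1)) (Seq (Sub 14 14 17)
     (Seq (If 14 (Seq (Const 14 (b * D)) (Seq (Sub 14 14 17) (Seq (Const 18 0) (If 14 (Add 18 18 10) (Add 18 18 15))))) Skip)
     (Seq (Sub 14 7 18) (If 14 Skip (Const 18 0))))))"

lemma wp_next_digit:
  "wp (next_digit W D b newest) 12 (\<lambda>m' out'. out' = out \<and> agree {14, 18} m m' \<and>
     m' 18 0 = slot_digit (m 7 0) W D b newest (m 17 0) (m 18 0) (m 10 0) (m 15 0)) m out"
  unfolding next_digit_def slot_digit_def Let_def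
  by (cases newest; cases "W \<le> Suc (m 17 0)"; cases "m 17 0 < b * D")
    (auto simp: wps put_apply le_diff_conv)

text \<open>Scalar 15 is the sum including the current reward, 16 the violation flag, 17 the phase and 18 the
  new digit, which starts out as the sum of the next slot; array 11 holds the multiples of \<open>N\<close>.\<close>

definition slot_body :: "nat \<Rightarrow> nat \<Rightarrow> nat \<Rightarrow> nat \<Rightarrow> nat \<Rightarrow> nat \<Rightarrow> nat \<Rightarrow> bool \<Rightarrow> prog" where
  "slot_body j i W D lo hi b newest =
     Seq (Load 15 1 9) (Seq (Store 1 8 15)
     (Seq (Load 15 (66 + 2 * j) 15) (Seq (Const 16 i) (Seq (Add 15 15 16) (Seq (Load 15 (67 + 2 * j) 15) (Seq (Add 15 15 10)
     (Seq (Load 16 3 9) (Seq (Load 17 4 9) (Seq (Store 4 8 17) (Seq (Load 18 5 9)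
     (Seq (if b = 0 then violation_check W lo hi else Skip)
     (Seq (Store 3 8 16) (Seq (Store 5 8 15)
     (Seq (next_digit W D b newest)
     (Seq (Load 18 11 18) (Seq (Load 16 2 9) (Seq (Add 16 16 18) (Store 2 8 16))))))))))))))))))"

definition slot_row :: "memory \<Rightarrow> nat \<Rightarrow> (nat \<Rightarrow> nat) \<Rightarrow> nat \<Rightarrow> nat \<Rightarrow> nat \<Rightarrow> nat \<Rightarrow> nat \<Rightarrow> nat \<Rightarrow> bool \<Rightarrow> nat \<Rightarrow> nat \<Rightarrow> nat \<Rightarrow> nat" where
  "slot_row mi N rw R W D lo hi b newest x v a =
     (let y = rw (mi 1 v) + x; c = mi 4 v in
      if a = 1 then mi 1 v
      else if a = 2 then slot_digit R W D b newest c (mi 5 v) x y * N + mi 2 v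
      else if a = 3 then (if b = 0 \<and> W - 1 \<le> c \<and> \<not> (lo \<le> y \<and> y < hi) then 1 else mi 3 v)
      else if a = 4 then c else y)"

lemma wp_slot_body:
  assumes "agree ({1..5} \<union> {8..18}) mi m" "\<forall>i<R. m 11 i = i * N" "mi 7 0 = R"
       "m 8 0 = u" "m 9 0 = v" "m 10 0 = x" "x < R"
       "\<forall>a\<in>{1..5}. m a v = mi a v"
       "mi (67 + 2 * j) (mi (66 + 2 * j) (mi 1 v) + i) = rw (mi 1 v)"
  shows "wp (slot_body j i W D lo hi b newest) 45 (\<lambda>m' out'. out' = out \<and> agree ({1..5} \<union> {14..18}) m m' \<and>
         (\<forall>a\<in>{1..5}. \<forall>k. m' a k = (if k = u then slot_row mi N rw R W D lo hi b newest x v a else m a k))) m out"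
    (is "wp _ _ ?Q m out")
proof -
  have ag: "m (66 + 2 * j) k = mi (66 + 2 * j) k" "m (67 + 2 * j) k = mi (67 + 2 * j) k" "m 7 0 = R" for k
    using assms by (auto simp: agree_def)
  have tb: "m 1 v = mi 1 v" "m 2 v = mi 2 v" "m 3 v = mi 3 v" "m 4 v = mi 4 v" "m 5 v = mi 5 v"
    using assms(8) unfolding table_arrays by simp_all
  define y where "y = rw (mi 1 v) + x"
  define c where "c = mi 4 v"
  define z where "z = slot_digit R W D b newest c (mi 5 v) x y"
  define f where "f = (if b = 0 \<and> W - 1 \<le> c \<and> \<not> (lo \<le> y \<and> y < hi) then 1 else mi 3 v)"
  have zR: "z < R" using assms(7) by (auto simp: z_def slot_digit_def Let_def)
  have row: "slot_row mi N rw R W D lo hi b newest x v 1 = mi 1 v"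
    "slot_row mi N rw R W D lo hi b newest x v 2 = z * N + mi 2 v"
    "slot_row mi N rw R W D lo hi b newest x v 3 = f"
    "slot_row mi N rw R W D lo hi b newest x v 4 = c"
    "slot_row mi N rw R W D lo hi b newest x v 5 = y"
    by (simp_all add: slot_row_def y_def c_def z_def f_def Let_def)
  define Q where "Q = ?Q"
  define p3 where "p3 = Seq (Load 18 11 18) (Seq (Load 16 2 9) (Seq (Add 16 16 18) (Store 2 8 16)))"
  define p2 where "p2 = Seq (Store 3 8 16) (Seq (Store 5 8 15) (Seq (next_digit W D b newest) p3))"
  have p3: "wp p3 4 Q m3 out" if m3: "agree {1, 3, 4, 5, 14, 15, 16, 17, 18} m m3" "m3 18 0 = z"
      "\<And>k. m3 1 k = (if k = u then mi 1 v else m 1 k)" "\<And>k. m3 3 k = (if k = u then f else m 3 k)"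
      "\<And>k. m3 4 k = (if k = u then c else m 4 k)" "\<And>k. m3 5 k = (if k = u then y else m 5 k)" for m3
  proof -
    have "m3 11 z = z * N" "m3 2 = m 2" "m3 9 0 = v" "m3 8 0 = u"
      using m3(1) assms zR by (auto simp: agree_def)
    moreover have "agree ({1..5} \<union> {14..18}) m m3" using m3(1) by (rule agree_mono) auto
    ultimately show ?thesis
      unfolding p3_def Q_def table_arrays
      by (simp add: wps put_apply m3(2-6) tb row del: One_nat_def)
  qed
  have p2: "wp p2 18 Q m2 out" if m2: "agree {1, 4, 14, 15, 16, 17, 18} m m2" "m2 16 0 = f" "m2 15 0 = y" "m2 17 0 = c"
      "m2 18 0 = mi 5 v"
      "\<And>k. m2 1 k = (if k = u then mi 1 v else m 1 k)" 
      "\<And>k. m2 4 k = (if k = u then c else m 4 k)" for m2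
  proof -
    have k: "m2 8 0 = u" "m2 10 0 = x" "m2 7 0 = R" "\<And>k. m2 3 k = m 3 k" "\<And>k. m2 5 k = m 5 k"
      using m2(1) assms ag by (auto simp: agree_def)
    have "wp (next_digit W D b newest) 12 (wp p3 4 Q) (put (put m2 3 u f) 5 u y) out"
      by (rule wp_mono[OF wp_next_digit], clarify, rule p3)
        (use m2 k in \<open>auto simp: agree_def put_apply z_def\<close>)
    then have "wp (Seq (next_digit W D b newest) p3) 16 Q (put (put m2 3 u f) 5 u y) out"
      by (rule wp_Seq) simp
    then show ?thesis unfolding p2_def using m2 k by (simp add: wps put_apply)
  qed
  have p1: "wp (Seq (if b = 0 then violation_check W lo hi else Skip) p2) 29 Q m1 out"
    if m1: "agree {1, 4, 14, 15, 16, 17, 18} m m1" "m1 16 0 = mi 3 v" "m1 15 0 = y" "m1 17 0 = c"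
      "m1 18 0 = mi 5 v" "\<And>k. m1 1 k = (if k = u then mi 1 v else m 1 k)" 
      "\<And>k. m1 4 k = (if k = u then c else m 4 k)" for m1
  proof (cases "b = 0")
    case True
    have "wp (violation_check W lo hi) 11 (wp p2 18 Q) m1 out"
    proof (rule wp_mono[OF wp_violation_check], clarify, rule p2)
      fix m' assume a: "agree {14, 16} m1 m'"
        "m' 16 0 = (if W - 1 \<le> m1 17 0 \<and> \<not> (lo \<le> m1 15 0 \<and> m1 15 0 < hi) then 1 else m1 16 0)"
      show "agree {1, 4, 14, 15, 16, 17, 18} m m'"
        by (rule agree_trans[OF m1(1) a(1)]) auto
      show "m' 16 0 = f" unfolding a(2) f_def using m1 True by auto
    qed (use m1 in \<open>auto simp: agree_def\<close>)
    then have "wp (Seq (violation_check W lo hi) p2) 29 Q m1 out"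
      by (rule wp_Seq) simp
    then show ?thesis using True by simp
  next
    case False
    have "wp p2 18 Q m1 out"
      by (rule p2) (use False m1 in \<open>auto simp: f_def\<close>)
    then show ?thesis using False by (simp add: wps wp_le)
  qed
  define rest where "rest = Seq (if b = 0 then violation_check W lo hi else Skip) p2"
  show ?thesis
    unfolding slot_body_def p2_def[symmetric] p3_def[symmetric] Q_def[symmetric] rest_def[symmetric]
    using assms(4-6,9)
    by (simp add: wps put_apply ag tb y_def[symmetric] c_def[symmetric] del: One_nat_def)
      (rule wp_le[OF p1[folded rest_def]]; simp add: put_apply)
qed

text \<open>The digit is identified with \<open>slot_sum\<close>, so for \<open>b = 0\<close> the
  flag is raised exactly when a completed window has a sum outside its bounds. For other slots only
  the digit is added, and the recognised property stays the same.\<close>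

lemma wp_slot_stage:
  fixes xr :: "nat \<Rightarrow> nat"
  defines "S \<equiv> \<lambda>W D b r t. slot_sum (\<lambda>j. xr (r j)) W D b t + xr (r t)"
  assumes W: "0 < W" and D: "0 < D" and dvd: "D dvd W" and b: "b < W div D"
    and M: "Mon n N Q m" and ph: "tracks n m 4 (\<lambda>r. phase W D)"
    and B: "m 7 0 = B" "B = max 1 mx * W"
    and xr: "\<And>v. v < n \<Longrightarrow> m (67 + 2 * j) (m (66 + 2 * j) v + i) = xr v" "\<And>v. v < n \<Longrightarrow> xr v \<le> mx"
    and prev: "Suc b < W div D \<Longrightarrow> tracks n m 5 (S W D (Suc b))"
  shows "wp (stage (slot_body j i W D lo hi b (Suc b = W div D))) (N * B * 95) (\<lambda>m' out'. out' = out \<and> agree {1..18} m m' \<and>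
    m' 7 0 = B \<and>
    Mon n (N * B) (\<lambda>r. Q r \<and> (b = 0 \<longrightarrow> (\<forall>t. phase W D t = W - 1 \<longrightarrow> lo \<le> S W D 0 r t \<and> S W D 0 r t < hi))) m' \<and>
    tracks n m' 4 (\<lambda>r. phase W D) \<and> tracks n m' 5 (S W D b)) m out"
proof -
  let ?nw = "Suc b = W div D"
  define d where "d x v = slot_digit B W D b ?nw (m 4 v) (m 5 v) x (xr (m 1 v) + x)" for x v
  have M': "m 6 0 = N" "m 19 0 = 1" "monitor_tables n N (m 1) (m 2)"
    "\<And>r. \<forall>t. r t < n \<Longrightarrow> (\<forall>t. m 3 (track (m 2) r t) = 0) \<longleftrightarrow> Q r"
    using M by (auto simp: Mon_def)
  have B0: "0 < B" using B W by simp
  have st: "m 1 v < n" if "v < N" for v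
    using that M'(3) by (simp add: monitor_tables_def)
  have "wp (stage (slot_body j i W D lo hi b ?nw)) (N * B * (45 + 50)) (\<lambda>m' out'. out' = out \<and> agree {1..18} m m' \<and> m' 6 0 = N * B \<and> m' 7 0 = B \<and>
     monitor_tables n (N * B) (m' 1) (m' 2) \<and>
     (\<forall>r. (\<forall>t. r t < n) \<longrightarrow> (\<exists>X. X 0 = 0 \<and> (\<forall>t. X t < B \<and> X (Suc t) = d (X t) (track (m 2) r t)) \<and>
       (\<forall>t. \<forall>a\<in>{1..5}. m' a (track (m' 2) r t) = slot_row m N xr B W D lo hi b ?nw (X t) (track (m 2) r t) a)))) m out"
  proof (rule wp_stage_monitor)
    fix m2 x v u out
    assume *: "agree ({1..5} \<union> {8..18}) m m2" "\<forall>i<B. m2 11 i = i * N"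
       "m2 8 0 = u" "m2 9 0 = v" "m2 10 0 = x" "v < N" "x < B" "\<forall>a\<in>{1..5}. m2 a v = m a v"
    show "wp (slot_body j i W D lo hi b ?nw) 45 (\<lambda>m' out'. out' = out \<and> agree ({1..5} \<union> {14..18}) m2 m' \<and>
         (\<forall>a\<in>{1..5}. \<forall>k. m' a k = (if k = u then slot_row m N xr B W D lo hi b ?nw x v a else m2 a k))) m2 out"
      by (rule wp_slot_body) (use * B(1) xr(1)[OF st] in auto)
  next
    fix x v assume "v < N" "x < B"
    then show "slot_row m N xr B W D lo hi b ?nw x v 1 = m 1 v \<and>
      slot_row m N xr B W D lo hi b ?nw x v 2 = d x v * N + m 2 v \<and> d x v < B"
      using B0 by (simp add: slot_row_def d_def slot_digit_def Let_def)
  qed (use M' B B0 in auto)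
  then show ?thesis
  proof (rule wp_mono)
    fix m' out'
    assume *: "out' = out \<and> agree {1..18} m m' \<and> m' 6 0 = N * B \<and> m' 7 0 = B \<and>
     monitor_tables n (N * B) (m' 1) (m' 2) \<and>
     (\<forall>r. (\<forall>t. r t < n) \<longrightarrow> (\<exists>X. X 0 = 0 \<and> (\<forall>t. X t < B \<and> X (Suc t) = d (X t) (track (m 2) r t)) \<and>
       (\<forall>t. \<forall>a\<in>{1..5}. m' a (track (m' 2) r t) = slot_row m N xr B W D lo hi b ?nw (X t) (track (m 2) r t) a)))"
    have key: "m' 4 (track (m' 2) r t) = phase W D t \<and> m' 5 (track (m' 2) r t) = S W D b r t \<and>
      m' 3 (track (m' 2) r t) = (if b = 0 \<and> phase W D t = W - 1 \<and> \<not> (lo \<le> S W D b r t \<and> S W D b r t < hi)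
        then 1 else m 3 (track (m 2) r t))"
      if r: "\<forall>t. r t < n" for r t
    proof -
      obtain X where X: "X 0 = 0" "\<And>t. X (Suc t) = d (X t) (track (m 2) r t)"
        "\<And>t a. a\<in>{1..5} \<Longrightarrow> m' a (track (m' 2) r t) = slot_row m N xr B W D lo hi b ?nw (X t) (track (m 2) r t) a"
        using * r by metis
      have st_r: "m 1 (track (m 2) r t) = r t" for t using st_track[OF M'(3), of r t] r by simp
      have ph_r: "m 4 (track (m 2) r t) = phase W D t" for t using ph r by (simp add: tracks_def)
      \<comment> \<open>\<open>prev\<close> supplies the value that is inherited on a shift, and
        \<open>lt\<close> shows that the cut-off in \<open>slot_digit\<close> does not
        apply.\<close>
      have Xs: "X t = slot_sum (\<lambda>j. xr (r j)) W D b t" for t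
      proof (induction t)
        case 0
        then show ?case using X(1) slot_sum_0[OF W D dvd] by simp
      next
        case (Suc t)
        have lt: "slot_sum (\<lambda>j. xr (r j)) W D b (Suc t) < B"
          unfolding B(2) by (rule slot_sum_less[OF W D dvd]) (use r xr(2) in auto)
        have "W - 1 \<le> phase W D t \<longleftrightarrow> phase W D t = W - 1"
          using phase_less[OF W D dvd, of t] by linarith
        moreover have "m 5 (track (m 2) r t) = slot_sum (\<lambda>j. xr (r j)) W D (Suc b) t + xr (r t)" if "Suc b < W div D"
          using prev[OF that] r by (simp add: tracks_def S_def)
        ultimately show ?case
          using lt b unfolding slot_sum_Suc[OF W D dvd b]
          by (auto simp: X(2) d_def slot_digit_def Suc st_r ph_r Let_def add.commute simp del: One_nat_def split: if_splits)
      qed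
      have "W - 1 \<le> phase W D t \<longleftrightarrow> phase W D t = W - 1"
        using phase_less[OF W D dvd, of t] by linarith
      then show ?thesis
        using X(3)[of 3 t] X(3)[of 4 t] X(3)[of 5 t]
        by (simp add: slot_row_def Xs[symmetric] S_def st_r ph_r Let_def add.commute del: One_nat_def)
    qed
    have "tracks n m' 4 (\<lambda>r. phase W D)" "tracks n m' 5 (S W D b)" using key by (auto simp: tracks_def)
    moreover have "Mon n (N * B) (\<lambda>r. Q r \<and> (b = 0 \<longrightarrow> (\<forall>t. phase W D t = W - 1 \<longrightarrow> lo \<le> S W D 0 r t \<and> S W D 0 r t < hi))) m'"
      unfolding Mon_def
    proof (intro conjI allI impI)
      fix r :: "nat \<Rightarrow> nat" assume r: "\<forall>t. r t < n"
      show "(\<forall>t. m' 3 (track (m' 2) r t) = 0) \<longleftrightarrow> Q r \<and> (b = 0 \<longrightarrow> (\<forall>t. phase W D t = W - 1 \<longrightarrow> lo \<le> S W D 0 r t \<and> S W D 0 r t < hi))"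
        using key[OF r] M'(4)[OF r] by (auto split: if_splits)
    qed (use * M' in \<open>auto simp: agree_def\<close>)
    ultimately show "out' = out \<and> agree {1..18} m m' \<and> m' 7 0 = B \<and>
      Mon n (N * B) (\<lambda>r. Q r \<and> (b = 0 \<longrightarrow> (\<forall>t. phase W D t = W - 1 \<longrightarrow> lo \<le> S W D 0 r t \<and> S W D 0 r t < hi))) m' \<and>
      tracks n m' 4 (\<lambda>r. phase W D) \<and> tracks n m' 5 (S W D b)" using * by blast
  qed simp
qed

section \<open>All slots of one dimension\<close>

primrec slots :: "nat \<Rightarrow> nat \<Rightarrow> nat \<Rightarrow> nat \<Rightarrow> nat \<Rightarrow> nat \<Rightarrow> nat \<Rightarrow> prog" where
  "slots j i W D lo hi 0 = Skip"
| "slots j i W D lo hi (Suc b) =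
     Seq (stage (slot_body j i W D lo hi b (Suc b = W div D))) (slots j i W D lo hi b)"

text \<open>The slots are added from the newest to the oldest, since each inherits from the next
  newer one through array 5. Only the newest needs no predecessor, which explains the condition on
  the hypothesis about array 5.\<close>

lemma wp_slots:
  fixes xr :: "nat \<Rightarrow> nat"
  defines "S \<equiv> \<lambda>W D b r t. slot_sum (\<lambda>j. xr (r j)) W D b t + xr (r t)"
  assumes W: "0 < W" and D: "0 < D" and dvd: "D dvd W"
    and B: "B = max 1 mx * W" and xr2: "\<And>v. v < n \<Longrightarrow> xr v \<le> mx"
  shows "b \<le> W div D \<Longrightarrow> Mon n N Q m \<Longrightarrow> tracks n m 4 (\<lambda>r. phase W D) \<Longrightarrow> m 7 0 = B \<Longrightarrow>
    (\<And>v. v < n \<Longrightarrow> m (67 + 2 * j) (m (66 + 2 * j) v + i) = xr v) \<Longrightarrow>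
    (b < W div D \<Longrightarrow> tracks n m 5 (S W D b)) \<Longrightarrow>
    wp (slots j i W D lo hi b) ((b * 95 + 1) * (N * B ^ b)) (\<lambda>m' out'. out' = out \<and> agree {1..18} m m' \<and>
      m' 7 0 = B \<and>
      Mon n (N * B ^ b) (\<lambda>r. Q r \<and> (0 < b \<longrightarrow> (\<forall>t. phase W D t = W - 1 \<longrightarrow> lo \<le> S W D 0 r t \<and> S W D 0 r t < hi))) m' \<and>
      tracks n m' 4 (\<lambda>r. phase W D)) m out"
proof (induction b arbitrary: N Q m out)
  case 0
  then have "0 < N" by (auto simp: Mon_def monitor_tables_def)
  with 0 show ?case by (simp add: wps)
next
  case (Suc b)
  define Q' where "Q' = (\<lambda>r. Q r \<and> (b = 0 \<longrightarrow> (\<forall>t. phase W D t = W - 1 \<longrightarrow> lo \<le> S W D 0 r t \<and> S W D 0 r t < hi)))"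
  have "wp (stage (slot_body j i W D lo hi b (Suc b = W div D))) (N * B * 95)
    (wp (slots j i W D lo hi b) ((b * 95 + 1) * (N * B * B ^ b))
      (\<lambda>m' out'. out' = out \<and> agree {1..18} m m' \<and> m' 7 0 = B \<and>
       Mon n (N * B ^ Suc b) (\<lambda>r. Q r \<and> (0 < Suc b \<longrightarrow> (\<forall>t. phase W D t = W - 1 \<longrightarrow> lo \<le> S W D 0 r t \<and> S W D 0 r t < hi))) m' \<and>
       tracks n m' 4 (\<lambda>r. phase W D))) m out"
  proof (rule wp_mono[OF wp_slot_stage[where B = B and mx = mx and xr = xr, OF W D dvd]])
    show "b < W div D" using Suc.prems(1) by simp
    show "Suc b < W div D \<Longrightarrow> tracks n m 5 (\<lambda>r t. slot_sum (\<lambda>j. xr (r j)) W D (Suc b) t + xr (r t))"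
      using Suc.prems(6) by (simp add: S_def)
    fix m1 out1
    assume "out1 = out \<and> agree {1..18} m m1 \<and> m1 7 0 = B \<and>
      Mon n (N * B) (\<lambda>r. Q r \<and> (b = 0 \<longrightarrow> (\<forall>t. phase W D t = W - 1 \<longrightarrow>
        lo \<le> slot_sum (\<lambda>j. xr (r j)) W D 0 t + xr (r t) \<and> slot_sum (\<lambda>j. xr (r j)) W D 0 t + xr (r t) < hi))) m1 \<and>
      tracks n m1 4 (\<lambda>r. phase W D) \<and> tracks n m1 5 (\<lambda>r t. slot_sum (\<lambda>j. xr (r j)) W D b t + xr (r t))"
    then have 1: "out1 = out" "agree {1..18} m m1" "m1 7 0 = B" "Mon n (N * B) Q' m1"
      "tracks n m1 4 (\<lambda>r. phase W D)" "tracks n m1 5 (S W D b)" by (auto simp: S_def Q'_def)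
    have ag: "m1 (66 + 2 * j) = m (66 + 2 * j)" "m1 (67 + 2 * j) = m (67 + 2 * j)"
      by (rule agreeD_fun[OF 1(2)], simp)+
    have "wp (slots j i W D lo hi b) ((b * 95 + 1) * (N * B * B ^ b)) (\<lambda>m' out'. out' = out \<and> agree {1..18} m1 m' \<and>
      m' 7 0 = B \<and>
      Mon n (N * B * B ^ b) (\<lambda>r. Q' r \<and> (0 < b \<longrightarrow> (\<forall>t. phase W D t = W - 1 \<longrightarrow> lo \<le> S W D 0 r t \<and> S W D 0 r t < hi))) m' \<and>
      tracks n m' 4 (\<lambda>r. phase W D)) m1 out"
      using Suc.prems(1,5) 1 ag by (intro Suc.IH) auto
    then show "wp (slots j i W D lo hi b) ((b * 95 + 1) * (N * B * B ^ b))
      (\<lambda>m' out'. out' = out \<and> agree {1..18} m m' \<and> m' 7 0 = B \<and>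
       Mon n (N * B ^ Suc b) (\<lambda>r. Q r \<and> (0 < Suc b \<longrightarrow> (\<forall>t. phase W D t = W - 1 \<longrightarrow> lo \<le> S W D 0 r t \<and> S W D 0 r t < hi))) m' \<and>
       tracks n m' 4 (\<lambda>r. phase W D)) m1 out1"
      unfolding 1(1)
    proof (rule wp_mono, goal_cases)
      case (1 m' out')
      have "(\<lambda>r. Q' r \<and> (0 < b \<longrightarrow> (\<forall>t. phase W D t = W - 1 \<longrightarrow> lo \<le> S W D 0 r t \<and> S W D 0 r t < hi))) =
        (\<lambda>r. Q r \<and> (0 < Suc b \<longrightarrow> (\<forall>t. phase W D t = W - 1 \<longrightarrow> lo \<le> S W D 0 r t \<and> S W D 0 r t < hi)))"
        by (auto simp: Q'_def)
      moreover have "agree {1..18} m m'" using agree_trans[OF \<open>agree {1..18} m m1\<close>, of "{1..18}" m'] 1 by blast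
      ultimately show ?case using 1 by (simp add: mult.assoc)
    qed simp
  qed (use Suc.prems B xr2 in \<open>auto simp: mult.commute\<close>)
  then show ?case unfolding slots.simps
  proof (rule wp_Seq)
    have "0 < B" using B W by simp
    then have "1 * (N * B) \<le> B ^ b * (N * B)" by (intro mult_le_mono) simp_all
    then have "N * B * 95 \<le> 95 * (N * B ^ Suc b)" by (simp add: mult.commute mult.left_commute)
    then show "N * B * 95 + (b * 95 + 1) * (N * B * B ^ b) \<le> (Suc b * 95 + 1) * (N * B ^ Suc b)"
      by (simp add: algebra_simps)
  qed
qed

section \<open>Computing the radix of the sum digits\<close>

primrec max_over_dims :: "nat \<Rightarrow> nat \<Rightarrow> prog" where
  "max_over_dims j 0 = Skip"
| "max_over_dims j (Suc i) = Seq (max_over_dims j i)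
     (Seq (Const 15 i) (Seq (Add 15 15 14) (Seq (Load 15 (67 + 2 * j) 15) (Seq (Sub 16 15 13) (Add 13 13 16)))))"

lemma wp_max_over_dims:
  "wp (max_over_dims j k) (5 * k + 1) (\<lambda>m' out'. out' = out \<and> agree {13, 15, 16} m m' \<and>
     m' 13 0 = Max (insert (m 13 0) ((\<lambda>i. m (67 + 2 * j) (m 14 0 + i)) ` {..<k}))) m out"
proof (induction k)
  case (Suc k)
  show ?case unfolding max_over_dims.simps
  proof (rule wp_Seq[OF wp_mono[OF Suc]])
    fix m' out' assume *: "out' = out \<and> agree {13, 15, 16} m m' \<and>
     m' 13 0 = Max (insert (m 13 0) ((\<lambda>i. m (67 + 2 * j) (m 14 0 + i)) ` {..<k}))"
    let ?x = "m (67 + 2 * j) (m 14 0 + k)"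
    let ?A = "insert (m 13 0) ((\<lambda>i. m (67 + 2 * j) (m 14 0 + i)) ` {..<k})"
    have "m' (67 + 2 * j) (k + m' 14 0) = ?x" using * by (simp add: agree_def add.commute)
    moreover have "Max (insert (m 13 0) ((\<lambda>i. m (67 + 2 * j) (m 14 0 + i)) ` {..<Suc k})) = max ?x (Max ?A)"
      by (subst Max_insert[symmetric]) (auto simp: lessThan_Suc insert_commute)
    \<comment> \<open>With truncated subtraction, adding the excess to the running value yields a
      maximum without a comparison.\<close>
    moreover have "m' 13 0 + (?x - m' 13 0) = max ?x (m' 13 0)" by (simp add: max_def)
    ultimately show "wp (Seq (Const 15 k) (Seq (Add 15 15 14) (Seq (Load 15 (67 + 2 * j) 15) (Seq (Sub 16 15 13) (Add 13 13 16))))) 5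
      (\<lambda>m' out'. out' = out \<and> agree {13, 15, 16} m m' \<and>
       m' 13 0 = Max (insert (m 13 0) ((\<lambda>i. m (67 + 2 * j) (m 14 0 + i)) ` {..<Suc k}))) m' out'"
      using * \<open>m' 13 0 + (?x - m' 13 0) = max ?x (m' 13 0)\<close> by (simp add: wps put_apply)
  qed auto
qed (simp add: wps)

text \<open>The radix depends on the rewards of the input and must be computed at run time, whereas
  window lengths, dimensions and the number of slots are constants of the program. The maximum with
  1 is again obtained by truncated subtraction, the product with \<open>W\<close> by repeated
  addition.\<close>

definition radix_prog :: "nat \<Rightarrow> nat \<Rightarrow> nat \<Rightarrow> prog" where
  "radix_prog j k W =
     Seq (Const 13 0) (Seq (Const 12 0) (Seq (Add 12 12 60)
     (Seq (While 12 (Seq (Sub 12 12 19) (Seq (Load 14 (66 + 2 * j) 12) (max_over_dims j k))))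
     (Seq (Const 16 1) (Seq (Sub 16 16 13) (Seq (Add 13 13 16) (Seq (Const 7 0) (Seq (Const 12 W)
     (While 12 (Seq (Add 7 7 13) (Sub 12 12 19)))))))))))"

lemma wp_radix_prog:
  assumes m: "m 60 0 = n" "m 19 0 = 1" and n: "0 < n" and k: "0 < k"
    and x: "\<And>v i. v < n \<Longrightarrow> i < k \<Longrightarrow> m (67 + 2 * j) (m (66 + 2 * j) v + i) = x v i"
  shows "wp (radix_prog j k W) (n * (5 * k + 4) + W * 3 + 10) (\<lambda>m' out'. out' = out \<and> agree {7, 12, 13, 14, 15, 16} m m' \<and>
    m' 7 0 = max 1 (Max {x v i | v i. v < n \<and> i < k}) * W) m out"
proof -
  define S where "S c = {x v i | v i. c \<le> v \<and> v < n \<and> i < k}" for c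
  have fin: "finite (S c)" for c
    by (rule finite_subset[of _ "(\<lambda>(v, i). x v i) ` ({..<n} \<times> {..<k})"]) (auto simp: S_def)
  have S_split: "S c = x c ` {..<k} \<union> S (Suc c)" if "c < n" for c
  proof
    show "S c \<subseteq> x c ` {..<k} \<union> S (Suc c)"
      using le_eq_less_or_eq by (fastforce simp: S_def)
    show "x c ` {..<k} \<union> S (Suc c) \<subseteq> S c"
      using that Suc_leD by (fastforce simp: S_def)
  qed
  let ?body = "Seq (Sub 12 12 19) (Seq (Load 14 (66 + 2 * j) 12) (max_over_dims j k))"
  \<comment> \<open>The loop counts down, so the states from \<open>m' 12 0\<close> on have been
    visited. The inserted 0 gives \<open>Max\<close> a value while this set of rewards is still
    empty.\<close>
  define I where "I m' out' \<longleftrightarrow> out' = out \<and> agree {7, 12, 13, 14, 15, 16} m m' \<and> m' 12 0 \<le> n \<and>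
    m' 13 0 = Max (insert 0 (S (m' 12 0)))" for m' :: memory and out'
  have step: "wp ?body (5 * k + 3) (\<lambda>m2 out2. I m2 out2 \<and> m2 12 0 < m1 12 0) m1 out1"
    if I: "I m1 out1" and pos: "m1 12 0 \<noteq> 0" for m1 out1
  proof -
    define c where "c = m1 12 0 - 1"
    have c: "c < n" "m1 12 0 = Suc c" using I pos by (auto simp: I_def c_def)
    have ag: "m1 (66 + 2 * j) = m (66 + 2 * j)" "m1 (67 + 2 * j) = m (67 + 2 * j)" "m1 19 0 = 1"
      using I m(2) by (auto simp: I_def agree_def)
    define m2 where "m2 = put (put m1 12 0 c) 14 0 (m (66 + 2 * j) c)"
    have "wp (max_over_dims j k) (5 * k + 1) (\<lambda>m3 out3. I m3 out3 \<and> m3 12 0 < m1 12 0) m2 out1"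
    proof (rule wp_mono[OF wp_max_over_dims])
      fix m3 out3
      assume *: "out3 = out1 \<and> agree {13, 15, 16} m2 m3 \<and>
        m3 13 0 = Max (insert (m2 13 0) ((\<lambda>i. m2 (67 + 2 * j) (m2 14 0 + i)) ` {..<k}))"
      have "(\<lambda>i. m2 (67 + 2 * j) (m2 14 0 + i)) ` {..<k} = x c ` {..<k}"
        using x[OF c(1)] ag by (auto simp: m2_def put_apply)
      moreover have "m2 13 0 = Max (insert 0 (S (Suc c)))" using I c by (simp add: I_def m2_def put_apply)
      ultimately have "m3 13 0 = Max (insert (Max (insert 0 (S (Suc c)))) (x c ` {..<k}))" using * by simp
      also have "\<dots> = max (Max (insert 0 (S (Suc c)))) (Max (x c ` {..<k}))"
        using k by (intro Max_insert) auto
      also have "\<dots> = Max (insert 0 (S (Suc c)) \<union> x c ` {..<k})"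
        using k fin by (intro Max_Un[symmetric]) auto
      also have "insert 0 (S (Suc c)) \<union> x c ` {..<k} = insert 0 (S c)"
        unfolding S_split[OF c(1)] by auto
      finally have "m3 13 0 = Max (insert 0 (S c))" .
      moreover have "m3 12 0 = c" using * by (simp add: agree_def m2_def put_apply)
      moreover have "agree {7, 12, 13, 14, 15, 16} m m3"
        using I * by (auto simp: I_def agree_def m2_def put_apply)
      ultimately show "I m3 out3 \<and> m3 12 0 < m1 12 0" using * I c by (simp add: I_def)
    qed simp
    then show ?thesis using c ag by (simp add: wps put_apply m2_def)
  qed
  define rest where "rest = Seq (Const 16 1) (Seq (Sub 16 16 13) (Seq (Add 13 13 16) (Seq (Const 7 0) (Seq (Const 12 W)
     (While 12 (Seq (Add 7 7 13) (Sub 12 12 19)))))))"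
  let ?Q = "\<lambda>m' out'. out' = out \<and> agree {7, 12, 13, 14, 15, 16} m m' \<and>
    m' 7 0 = max 1 (Max {x v i | v i. v < n \<and> i < k}) * W"
  have rest: "wp rest (W * 3 + 6) ?Q m1 out1" if I: "I m1 out1" and z: "m1 12 0 = 0" for m1 out1
  proof -
    define B where "B = max 1 (Max (S 0))"
    have "S 0 \<noteq> {}" using n k by (auto simp: S_def)
    then have "m1 13 0 = Max (S 0)" using I z fin by (simp add: I_def)
    then have B: "m1 13 0 + (1 - m1 13 0) = B" by (simp add: B_def)
    have ag: "m1 19 0 = 1" "agree {7, 12, 13, 14, 15, 16} m m1" using I m(2) by (auto simp: I_def agree_def)
    have "wp (While 12 (Seq (Add 7 7 13) (Sub 12 12 19))) (W * (2 + 1) + 1) ?Q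
       (put (put (put (put m1 16 0 (1 - m1 13 0)) 13 0 B) 7 0 0) 12 0 W) out1"
    proof (rule wp_While[where \<mu> = "\<lambda>m. m 12 0" and k = 2 and I = "\<lambda>m2 out2. out2 = out \<and> agree {7, 12, 13, 14, 15, 16} m m2
        \<and> m2 13 0 = B \<and> m2 12 0 \<le> W \<and> m2 7 0 = B * (W - m2 12 0)"], goal_cases)
      case (2 m2 out2)
      moreover from 2 have "m2 19 0 = 1" using m(2) by (auto simp: agree_def)
      moreover from 2 have "W - (m2 12 0 - 1) = Suc (W - m2 12 0)" by linarith
      ultimately show ?case by (auto simp: wps put_apply)
    next
      case (3 m2 out2)
      then show ?case by (simp add: B_def S_def)
    qed (use ag I in \<open>auto simp: put_apply I_def\<close>)
    moreover have "put (put (put (put (put m1 16 0 1) 16 0 (1 - m1 13 0)) 13 0 B) 7 0 0) 12 0 W =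
      put (put (put (put m1 16 0 (1 - m1 13 0)) 13 0 B) 7 0 0) 12 0 W"
      by (intro ext) (simp add: put_apply)
    ultimately show ?thesis unfolding rest_def using B by (simp add: wps put_apply mult.commute)
  qed
  have "wp (While 12 ?body) (n * (5 * k + 3 + 1) + 1) (wp rest (W * 3 + 6) ?Q)
    (put (put (put m 13 0 0) 12 0 0) 12 0 n) out"
  proof (rule wp_While[where \<mu> = "\<lambda>m. m 12 0" and k = "5 * k + 3" and I = I])
    have "S n = {}" by (auto simp: S_def)
    then show "I (put (put (put m 13 0 0) 12 0 0) 12 0 n) out"
      by (simp add: I_def put_apply)
  qed (use rest step in \<open>auto simp: put_apply\<close>)
  then have "wp (Seq (While 12 ?body) rest) (n * (5 * k + 4) + W * 3 + 7) ?Q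
    (put (put (put m 13 0 0) 12 0 0) 12 0 n) out"
    by (rule wp_Seq) (simp add: algebra_simps)
  then show ?thesis unfolding radix_prog_def rest_def[symmetric]
    using m by (simp add: wps put_apply add.commute add.left_commute)
qed

section \<open>All dimensions of one window objective\<close>

primrec window_dims :: "nat \<Rightarrow> window \<Rightarrow> nat \<Rightarrow> prog" where
  "window_dims j w 0 = Skip"
| "window_dims j w (Suc i) = Seq (window_dims j w i)
     (slots j i (win_len w) (win_step w) (sum_lower (lower w ! i) (win_len w)) (sum_upper (upper w ! i) (win_len w))
        (win_len w div win_step w))"

definition reads_reward :: "memory \<Rightarrow> nat \<Rightarrow> nat \<Rightarrow> nat reward \<Rightarrow> bool" where
  "reads_reward m n j \<rho> \<longleftrightarrow> (\<forall>v<n. \<forall>i<rdim \<rho>. m (67 + 2 * j) (m (66 + 2 * j) v + i) = rew \<rho> v ! i)"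

lemma reads_reward_agree: "agree {1..18} m m' \<Longrightarrow> reads_reward m' n j \<rho> = reads_reward m n j \<rho>"
  by (simp add: reads_reward_def agree_def)

lemma wp_window_dims:
  assumes w: "window w" and B: "B = max 1 mx * win_len w"
    and mx: "\<And>v i. v < n \<Longrightarrow> i < rdim \<rho> \<Longrightarrow> rew \<rho> v ! i \<le> mx"
  defines "s \<equiv> win_len w div win_step w"
  shows "k \<le> rdim \<rho> \<Longrightarrow> Mon n N Q m \<Longrightarrow> tracks n m 4 (\<lambda>r. phase (win_len w) (win_step w)) \<Longrightarrow> m 7 0 = B \<Longrightarrow>
    reads_reward m n j \<rho> \<Longrightarrow>
    wp (window_dims j w k) ((k * (s * 95 + 1) + 1) * (N * B ^ (k * s))) (\<lambda>m' out'. out' = out \<and> agree {1..18} m m' \<and>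
      m' 7 0 = B \<and> Mon n (N * B ^ (k * s)) (\<lambda>r. Q r \<and> (\<forall>i<k. sums_ok w \<rho> i r)) m' \<and>
      tracks n m' 4 (\<lambda>r. phase (win_len w) (win_step w))) m out"
proof (induction k)
  case 0
  then have "0 < N" by (auto simp: Mon_def monitor_tables_def)
  with 0 show ?case by (simp add: wps)
next
  case (Suc k)
  have ww: "0 < win_len w" "0 < win_step w" "win_step w dvd win_len w" using w by (auto simp: window_def)
  have s: "0 < s" using ww by (auto simp: s_def div_greater_zero_iff dvd_imp_le)
  have B0: "0 < B" using B ww by simp
  let ?lo = "sum_lower (lower w ! k) (win_len w)" and ?hi = "sum_upper (upper w ! k) (win_len w)"
  define N1 where "N1 = N * B ^ (k * s)"
  have N1: "N * B ^ (Suc k * s) = N1 * B ^ s" by (simp add: N1_def power_add algebra_simps)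
  let ?Q = "\<lambda>m' out'. out' = out \<and> agree {1..18} m m' \<and>
      m' 7 0 = B \<and> Mon n (N1 * B ^ s) (\<lambda>r. Q r \<and> (\<forall>i<Suc k. sums_ok w \<rho> i r)) m' \<and>
      tracks n m' 4 (\<lambda>r. phase (win_len w) (win_step w))"
  have "wp (window_dims j w k) ((k * (s * 95 + 1) + 1) * N1) (wp (slots j k (win_len w) (win_step w) ?lo ?hi s)
    ((s * 95 + 1) * (N1 * B ^ s)) ?Q) m out"
  proof (rule wp_mono[OF Suc.IH])
    fix m1 out1
    assume "out1 = out \<and> agree {1..18} m m1 \<and>
      m1 7 0 = B \<and> Mon n (N * B ^ (k * s)) (\<lambda>r. Q r \<and> (\<forall>i<k. sums_ok w \<rho> i r)) m1 \<and>
      tracks n m1 4 (\<lambda>r. phase (win_len w) (win_step w))"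
    then have 1: "out1 = out" "agree {1..18} m m1" "m1 7 0 = B"
      "Mon n N1 (\<lambda>r. Q r \<and> (\<forall>i<k. sums_ok w \<rho> i r)) m1"
      "tracks n m1 4 (\<lambda>r. phase (win_len w) (win_step w))" by (auto simp: N1_def)
    have "reads_reward m1 n j \<rho>" using Suc.prems(5) reads_reward_agree[OF 1(2)] by blast
    then have rr: "\<And>v. v < n \<Longrightarrow> m1 (67 + 2 * j) (m1 (66 + 2 * j) v + k) = rew \<rho> v ! k"
      using Suc.prems(1) by (auto simp: reads_reward_def)
    have mxk: "\<And>v. v < n \<Longrightarrow> rew \<rho> v ! k \<le> mx" using mx Suc.prems(1) by simp
    show "wp (slots j k (win_len w) (win_step w) ?lo ?hi s) ((s * 95 + 1) * (N1 * B ^ s)) ?Q m1 out1"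
      unfolding 1(1)
    proof (rule wp_mono[OF wp_slots[where xr = "\<lambda>v. rew \<rho> v ! k" and B = B and n = n, OF ww B mxk _ 1(4,5,3) rr]])
      fix m2 out2
      assume *: "out2 = out \<and> agree {1..18} m1 m2 \<and> m2 7 0 = B \<and>
        Mon n (N1 * B ^ s) (\<lambda>r. (Q r \<and> (\<forall>i<k. sums_ok w \<rho> i r)) \<and> (0 < s \<longrightarrow>
          (\<forall>t. phase (win_len w) (win_step w) t = win_len w - 1 \<longrightarrow>
             ?lo \<le> slot_sum (\<lambda>j. rew \<rho> (r j) ! k) (win_len w) (win_step w) 0 t + rew \<rho> (r t) ! k \<and>
             slot_sum (\<lambda>j. rew \<rho> (r j) ! k) (win_len w) (win_step w) 0 t + rew \<rho> (r t) ! k < ?hi))) m2 \<and>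
        tracks n m2 4 (\<lambda>r. phase (win_len w) (win_step w))"
      have "(\<lambda>r. (Q r \<and> (\<forall>i<k. sums_ok w \<rho> i r)) \<and> (0 < s \<longrightarrow>
          (\<forall>t. phase (win_len w) (win_step w) t = win_len w - 1 \<longrightarrow>
             ?lo \<le> slot_sum (\<lambda>j. rew \<rho> (r j) ! k) (win_len w) (win_step w) 0 t + rew \<rho> (r t) ! k \<and>
             slot_sum (\<lambda>j. rew \<rho> (r j) ! k) (win_len w) (win_step w) 0 t + rew \<rho> (r t) ! k < ?hi)))
        = (\<lambda>r. Q r \<and> (\<forall>i<Suc k. sums_ok w \<rho> i r))"
        using s by (auto simp: less_Suc_eq sums_ok_def Let_def fun_eq_iff)
      moreover have "agree {1..18} m m2" using agree_trans[OF 1(2), of "{1..18}" m2] * by blast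
      ultimately show "?Q m2 out2" using * by simp
    qed (auto simp: s_def)
  qed (use Suc.prems in \<open>auto simp: N1_def\<close>)
  then show ?case unfolding window_dims.simps N1 s_def[symmetric]
  proof (rule wp_Seq)
    have "1 * N1 \<le> B ^ s * N1" using B0 by (intro mult_le_mono1) simp
    then have "(k * (s * 95 + 1) + 1) * N1 \<le> (k * (s * 95 + 1) + 1) * (N1 * B ^ s)"
      by (intro mult_le_mono2) (simp add: mult.commute)
    then show "(k * (s * 95 + 1) + 1) * N1 + (s * 95 + 1) * (N1 * B ^ s) \<le> (Suc k * (s * 95 + 1) + 1) * (N1 * B ^ s)"
      by (simp add: algebra_simps)
  qed
qed

definition window_factor :: "nat game \<Rightarrow> window \<Rightarrow> nat reward \<Rightarrow> nat" where
  "window_factor G w \<rho> =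
     win_len w * (max 1 (max_reward G \<rho>) * win_len w) ^ (rdim \<rho> * (win_len w div win_step w))"

definition window_prog :: "nat \<Rightarrow> window \<Rightarrow> prog" where
  "window_prog j w = Seq (phase_stage (win_len w) (win_step w))
     (Seq (radix_prog j (win_dim w) (win_len w)) (window_dims j w (win_dim w)))"

lemma max_reward_ge:
  assumes "finite (states G)" "v \<in> states G" "i < rdim \<rho>"
  shows "rew \<rho> v ! i \<le> max_reward G \<rho>"
proof -
  have "finite {rew \<rho> s ! i | s i. s \<in> states G \<and> i < rdim \<rho>}"
    by (rule finite_subset[of _ "(\<lambda>(s, i). rew \<rho> s ! i) ` (states G \<times> {..<rdim \<rho>})"]) (use assms in auto)
  then show ?thesis unfolding max_reward_def using assms by (intro Max_ge) auto
qed

lemma tracks_agree: "agree A m m' \<Longrightarrow> 2 \<notin> A \<Longrightarrow> a \<notin> A \<Longrightarrow> tracks n m' a y = tracks n m a y"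
  by (simp add: tracks_def agreeD_fun)

lemma Mon_agree: "agree A m m' \<Longrightarrow> {1, 2, 3, 6, 19} \<inter> A = {} \<Longrightarrow> Mon n N Q m' = Mon n N Q m"
  by (simp add: Mon_def agreeD_fun)

text \<open>A window adds one phase digit and \<open>W div D\<close> sum digits per dimension. Each
  stage costs a constant times the size of the tables it produces, and none of these exceeds the
  final size, so the total is the number of digits times the final size.\<close>

lemma wp_window_prog:
  assumes w: "window w" and G: "states G = {..<n}" "0 < n" and \<rho>: "rdim \<rho> = win_dim w" "0 < rdim \<rho>"
    and M: "Mon n N Q m" and n: "m 60 0 = n" and rr: "reads_reward m n j \<rho>"
  shows "wp (window_prog j w) ((112 + 102 * (win_dim w * win_len w)) * (N * window_factor G w \<rho>))
    (\<lambda>m' out'. out' = out \<and> agree {1..18} m m' \<and>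
      Mon n (N * window_factor G w \<rho>) (\<lambda>r. Q r \<and> (\<forall>i<win_dim w. sums_ok w \<rho> i r)) m') m out"
proof -
  let ?W = "win_len w" and ?D = "win_step w" and ?k = "win_dim w"
  define s where "s = ?W div ?D"
  define B where "B = max 1 (max_reward G \<rho>) * ?W"
  define M' where "M' = N * ?W * B ^ (?k * s)"
  have M': "N * window_factor G w \<rho> = M'"
    by (simp add: window_factor_def M'_def B_def s_def \<rho> mult.assoc)
  have ww: "0 < ?W" "0 < ?D" "?D dvd ?W" using w by (auto simp: window_def)
  have s: "0 < s" "s \<le> ?W" using ww by (auto simp: s_def div_greater_zero_iff dvd_imp_le)
  have nN: "n \<le> N" using M by (simp add: Mon_def monitor_tables_def)
  have B0: "0 < B" using ww by (simp add: B_def)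
  define t2 where "t2 = n * (5 * ?k + 4) + ?W * 3 + 10"
  define t3 where "t3 = (?k * (s * 95 + 1) + 1) * M'"
  let ?Q = "\<lambda>m' out'. out' = out \<and> agree {1..18} m m' \<and>
      Mon n (N * window_factor G w \<rho>) (\<lambda>r. Q r \<and> (\<forall>i<win_dim w. sums_ok w \<rho> i r)) m'"
  have 3: "wp (window_dims j w ?k) t3 ?Q m2 out"
    if m2: "agree {1..18} m m2" "Mon n (N * ?W) Q m2" "tracks n m2 4 (\<lambda>r. phase ?W ?D)" "m2 7 0 = B" for m2
  proof (rule wp_mono[OF wp_window_dims[where B = B and mx = "max_reward G \<rho>" and \<rho> = \<rho> and n = n, OF w B_def _ _ m2(2,3,4)]])
    show "rew \<rho> v ! i \<le> max_reward G \<rho>" if "v < n" "i < rdim \<rho>" for v i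
      using that G by (intro max_reward_ge) auto
    show "reads_reward m2 n j \<rho>" using rr reads_reward_agree[OF m2(1)] by blast
    show "?Q m3 out3" if *: "out3 = out \<and> agree {1..18} m2 m3 \<and> m3 7 0 = B \<and>
      Mon n (N * ?W * B ^ (?k * (?W div ?D))) (\<lambda>r. Q r \<and> (\<forall>i<win_dim w. sums_ok w \<rho> i r)) m3 \<and>
      tracks n m3 4 (\<lambda>r. phase ?W ?D)" for m3 out3
      using * agree_trans[OF m2(1), of "{1..18}" m3] by (simp add: M' M'_def s_def)
  qed (auto simp: \<rho> t3_def M'_def s_def)
  have 2: "wp (Seq (radix_prog j ?k ?W) (window_dims j w ?k)) (t2 + t3) ?Q m1 out"
    if m1: "agree {1..18} m m1" "Mon n (N * ?W) Q m1" "tracks n m1 4 (\<lambda>r. phase ?W ?D)" for m1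
  proof (rule wp_Seq[OF wp_mono[OF wp_radix_prog[where n = n and x = "\<lambda>v i. rew \<rho> v ! i"]]])
    show "m1 60 0 = n" "m1 19 0 = 1" using m1 n by (auto simp: agree_def Mon_def)
    show "m1 (67 + 2 * j) (m1 (66 + 2 * j) v + i) = rew \<rho> v ! i" if "v < n" "i < ?k" for v i
      using rr reads_reward_agree[OF m1(1), of n j \<rho>] that \<rho> by (simp add: reads_reward_def)
    show "n * (5 * ?k + 4) + ?W * 3 + 10 \<le> t2" by (simp add: t2_def)
    fix m2 out2
    assume *: "out2 = out \<and> agree {7, 12, 13, 14, 15, 16} m1 m2 \<and>
      m2 7 0 = max 1 (Max {rew \<rho> v ! i |v i. v < n \<and> i < ?k}) * ?W"
    then have "m2 7 0 = B" by (simp add: B_def max_reward_def G \<rho>)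
    moreover have "agree {1..18} m m2"
      by (rule agree_trans[OF m1(1), of "{7, 12, 13, 14, 15, 16}"]) (use * in auto)
    moreover have "Mon n (N * ?W) Q m2" using m1(2) * Mon_agree[of _ m1 m2] by auto
    moreover have "tracks n m2 4 (\<lambda>r. phase ?W ?D)" using m1(3) * tracks_agree[of _ m1 m2] by auto
    ultimately show "wp (window_dims j w ?k) t3 ?Q m2 out2" using 3 * by blast
  qed (use G \<rho> in auto)
  have "wp (phase_stage ?W ?D) (N * ?W * 80) (wp (Seq (radix_prog j ?k ?W) (window_dims j w ?k)) (t2 + t3) ?Q) m out"
    by (rule wp_mono[OF wp_phase_stage[OF ww M]]) (use 2 in auto)
  then show ?thesis unfolding window_prog_def
  proof (rule wp_Seq)
    have M1: "N * ?W \<le> M'" using B0 by (simp add: M'_def)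
    have "N \<le> N * ?W" "?W \<le> N * ?W" using nN ww G(2) by simp_all
    then have "n \<le> M'" "?W \<le> M'" "1 \<le> M'" using nN M1 G(2) by linarith+
    have a: "n * (5 * ?k + 4) \<le> M' * (5 * ?k + 4)" using \<open>n \<le> M'\<close> by simp
    \<comment> \<open>The number of slots is bounded by the window length, which
      \<open>win_len_le_M_of\<close> will later absorb.\<close>
    have b: "?k * (s * 95 + 1) \<le> ?k * (96 * ?W)" using s ww by (intro mult_le_mono2) linarith
    have c: "?k * (s * 95 + 1) * M' \<le> ?k * (96 * ?W) * M'" using b by simp
    have d: "?k * M' * 1 \<le> ?k * M' * ?W" by (rule mult_le_mono2) (use ww in simp)
    have e: "M' * (5 * ?k + 4) = 5 * (?k * M') + 4 * M'" "?k * (96 * ?W) * M' = 96 * (?k * M' * ?W)"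
      "(112 + 102 * (?k * ?W)) * M' = 112 * M' + 102 * (?k * M' * ?W)" by (simp_all add: algebra_simps)
    have "N * ?W * 80 + (t2 + t3) \<le> 80 * M' + (M' * (5 * ?k + 4) + M' * 3 + 10 * M' + (?k * (96 * ?W) * M' + M'))"
      using M1 a c \<open>?W \<le> M'\<close> \<open>1 \<le> M'\<close> unfolding t2_def t3_def add_mult_distrib by linarith
    also have "\<dots> \<le> (112 + 102 * (?k * ?W)) * M'"
      using d unfolding e by linarith
    finally show "N * ?W * 80 + (t2 + t3) \<le> (112 + 102 * (?k * ?W)) * (N * window_factor G w \<rho>)"
      unfolding M' .
  qed
qed

section \<open>All windows of the multi-objective\<close>

primrec windows_prog :: "nat \<Rightarrow> window list \<Rightarrow> prog" where
  "windows_prog j [] = Skip"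
| "windows_prog j (w # ws) = Seq (window_prog j w) (windows_prog (Suc j) ws)"

lemma prod_shift: "(\<Prod>i<Suc k. f i) = f 0 * (\<Prod>i<k. f (Suc i))" for f :: "nat \<Rightarrow> nat"
  by (rule prod.lessThan_Suc_shift)

lemma all_less_Suc_shift: "(\<forall>i<Suc k. P i) \<longleftrightarrow> P 0 \<and> (\<forall>i<k. P (Suc i))"
  using less_Suc_eq_0_disj by auto

text \<open>Each window pays its own constant times the size of the tables after it. As the tables
  only grow, all these sizes are at most the final one, and the constants add up.\<close>

lemma wp_windows_prog:
  assumes G: "states G = {..<n}" "0 < n"
  shows "\<forall>w\<in>set ws. window w \<Longrightarrow> length \<rho>s = length ws \<Longrightarrow>
    \<forall>i<length ws. rdim (\<rho>s ! i) = win_dim (ws ! i) \<and> 0 < rdim (\<rho>s ! i) \<and> reads_reward m n (j + i) (\<rho>s ! i) \<Longrightarrow>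
    Mon n N Q m \<Longrightarrow> m 60 0 = n \<Longrightarrow>
    wp (windows_prog j ws) ((1 + (\<Sum>w\<leftarrow>ws. 112 + 102 * (win_dim w * win_len w))) * (N * (\<Prod>i<length ws. window_factor G (ws ! i) (\<rho>s ! i))))
    (\<lambda>m' out'. out' = out \<and> agree {1..18} m m' \<and>
      Mon n (N * (\<Prod>i<length ws. window_factor G (ws ! i) (\<rho>s ! i)))
        (\<lambda>r. Q r \<and> (\<forall>i<length ws. \<forall>d<win_dim (ws ! i). sums_ok (ws ! i) (\<rho>s ! i) d r)) m') m out"
proof (induction ws arbitrary: \<rho>s j N Q m out)
  case Nil
  then have "0 < N" by (auto simp: Mon_def monitor_tables_def)
  with Nil show ?case by (simp add: wps)
next
  case (Cons w ws)
  obtain \<rho> \<rho>s' where \<rho>s: "\<rho>s = \<rho> # \<rho>s'" using Cons.prems(2) by (cases \<rho>s) auto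
  from Cons.prems(3) have a: "rdim \<rho> = win_dim w" "0 < rdim \<rho>" "reads_reward m n j \<rho>"
    and b: "\<forall>i<length ws. rdim (\<rho>s' ! i) = win_dim (ws ! i) \<and> 0 < rdim (\<rho>s' ! i) \<and> reads_reward m n (Suc j + i) (\<rho>s' ! i)"
    by (auto simp: \<rho>s all_less_Suc_shift)
  let ?N = "N * window_factor G w \<rho>"
  let ?P = "\<Prod>i<length ws. window_factor G (ws ! i) (\<rho>s' ! i)"
  define c where "c w = 112 + 102 * (win_dim w * win_len w)" for w
  have eqs: "N * (\<Prod>i<length (w # ws). window_factor G ((w # ws) ! i) (\<rho>s ! i)) = ?N * ?P"
    unfolding \<rho>s length_Cons prod_shift by (simp add: mult.assoc)
  let ?Q = "\<lambda>m' out'. out' = out \<and> agree {1..18} m m' \<and> Mon n (?N * ?P)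
        (\<lambda>r. Q r \<and> (\<forall>i<length (w # ws). \<forall>d<win_dim ((w # ws) ! i). sums_ok ((w # ws) ! i) (\<rho>s ! i) d r)) m'"
  have "wp (window_prog j w) (c w * ?N) (wp (windows_prog (Suc j) ws) ((1 + (\<Sum>w\<leftarrow>ws. c w)) * (?N * ?P)) ?Q) m out"
  proof (rule wp_mono[OF wp_window_prog[OF _ G a(1,2) Cons.prems(4,5) a(3)]])
    show "window w" using Cons.prems(1) by simp
    show "(112 + 102 * (win_dim w * win_len w)) * (N * window_factor G w \<rho>) \<le> c w * ?N" by (simp add: c_def)
    fix m1 out1
    assume *: "out1 = out \<and> agree {1..18} m m1 \<and> Mon n ?N (\<lambda>r. Q r \<and> (\<forall>i<win_dim w. sums_ok w \<rho> i r)) m1"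
    then have ag: "agree {1..18} m m1" by blast
    have b': "\<forall>i<length ws. rdim (\<rho>s' ! i) = win_dim (ws ! i) \<and> 0 < rdim (\<rho>s' ! i) \<and> reads_reward m1 n (Suc j + i) (\<rho>s' ! i)"
      using b reads_reward_agree[OF ag] by blast
    have "m1 60 0 = n" using Cons.prems(5) ag by (simp add: agree_def)
    then have "wp (windows_prog (Suc j) ws) ((1 + (\<Sum>w\<leftarrow>ws. c w)) * (?N * ?P)) (\<lambda>m' out'. out' = out \<and> agree {1..18} m1 m' \<and>
      Mon n (?N * ?P) (\<lambda>r. (Q r \<and> (\<forall>i<win_dim w. sums_ok w \<rho> i r)) \<and> (\<forall>i<length ws. \<forall>d<win_dim (ws ! i). sums_ok (ws ! i) (\<rho>s' ! i) d r)) m') m1 out"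
      unfolding c_def using Cons.prems(1,2) b' * \<rho>s by (intro Cons.IH) auto
    moreover have "(\<lambda>r. (Q r \<and> (\<forall>i<win_dim w. sums_ok w \<rho> i r)) \<and> (\<forall>i<length ws. \<forall>d<win_dim (ws ! i). sums_ok (ws ! i) (\<rho>s' ! i) d r))
       = (\<lambda>r. Q r \<and> (\<forall>i<length (w # ws). \<forall>d<win_dim ((w # ws) ! i). sums_ok ((w # ws) ! i) (\<rho>s ! i) d r))"
      unfolding \<rho>s length_Cons all_less_Suc_shift by (auto simp: fun_eq_iff)
    ultimately show "wp (windows_prog (Suc j) ws) ((1 + (\<Sum>w\<leftarrow>ws. c w)) * (?N * ?P)) ?Q m1 out1"
      using * agree_trans[OF ag, of "{1..18}"] by (auto elim!: wp_mono)
  qed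
  then show ?case unfolding eqs windows_prog.simps c_def[symmetric]
  proof (rule wp_Seq)
    have "0 < ?P"
      using Cons.prems(1) by (intro prod_pos) (auto simp: window_factor_def window_def)
    then have "1 \<le> ?P" by linarith
    then have "?N * 1 \<le> ?N * ?P" by (rule mult_le_mono2)
    then have "c w * ?N \<le> c w * (?N * ?P)" unfolding mult_1_right by (rule mult_le_mono2)
    then show "c w * ?N + (1 + (\<Sum>w\<leftarrow>ws. c w)) * (?N * ?P) \<le> (1 + (\<Sum>w\<leftarrow>w # ws. c w)) * (?N * ?P)"
      unfolding list.map sum_list.Cons add_mult_distrib by linarith
  qed
qed

definition init_tables :: prog where
  "init_tables = Seq (Const 19 1) (Seq (Add 6 6 60) (Seq (Add 12 12 60)
     (While 12 (Seq (Sub 12 12 19) (Store 1 12 12)))))"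

text \<open>The trivial monitor with a single state: \<open>st\<close> is the identity, while the
  zeros of the fresh memory already provide \<open>nb\<close> and the absence of violations.\<close>

lemma wp_init_tables:
  assumes "m 60 0 = n" "0 < n" "\<And>a i. a < 60 \<Longrightarrow> m a i = 0"
  shows "wp init_tables (n * 3 + 4) (\<lambda>m' out'. out' = out \<and> agree {1..19} m m' \<and> Mon n n (\<lambda>r. True) m') m out"
proof -
  have "wp (While 12 (Seq (Sub 12 12 19) (Store 1 12 12))) (n * (2 + 1) + 1)
     (\<lambda>m' out'. out' = out \<and> agree {1..19} m m' \<and> Mon n n (\<lambda>r. True) m')
     (put (put (put m 19 0 1) 6 0 n) 12 0 n) out"
  proof (rule wp_While[where k = 2 and \<mu> = "\<lambda>m. m 12 0" and I = "\<lambda>m' out'. out' = out \<and> agree {1, 6, 12, 19} m m' \<and>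
      m' 19 0 = 1 \<and> m' 6 0 = n \<and> m' 12 0 \<le> n \<and> (\<forall>v<n. m' 12 0 \<le> v \<longrightarrow> m' 1 v = v)"], goal_cases)
    case (2 m1 out1)
    then show ?case by (auto simp: wps put_apply)
  next
    case (3 m1 out1)
    then have z: "m1 2 v = 0" "m1 3 v = 0" for v using assms(3) by (auto simp: agree_def)
    have "agree {1..19} m m1" using 3 by (auto elim: agree_mono)
    moreover have "Mon n n (\<lambda>r. True) m1"
      using 3 assms(2) z by (auto simp: Mon_def monitor_tables_def)
    ultimately show ?case using 3 by blast
  qed (auto simp: put_apply)
  then show ?thesis unfolding init_tables_def using assms by (simp add: wps put_apply)
qed

definition tables_prog :: "window list \<Rightarrow> prog" where
  "tables_prog ws = Seq init_tables (windows_prog 0 ws)"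

lemma M_of_eq: "M_of (G :: nat game) ws \<rho>s = (\<Prod>i<length ws. window_factor G (ws ! i) (\<rho>s ! i))"
  by (simp add: M_of_def window_factor_def Let_def)

text \<open>Turns the window length in the running time of \<open>window_prog\<close> into a second
  factor \<open>M_of\<close>. This is what makes the constant independent of the windows, apart from
  their dimensions.\<close>

lemma win_len_le_M_of:
  fixes G :: "nat game"
  assumes "\<forall>w\<in>set ws. window w" "i < length ws"
  shows "win_len (ws ! i) \<le> M_of G ws \<rho>s"
proof -
  have pos: "0 < window_factor G (ws ! k) (\<rho>s ! k)" if "k < length ws" for k
    using assms that by (auto simp: window_factor_def window_def)
  have "0 < win_len (ws ! i)" using assms by (auto simp: window_def)
  then have "win_len (ws ! i) \<le> window_factor G (ws ! i) (\<rho>s ! i)"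
    unfolding window_factor_def by simp
  also have "\<dots> \<le> (\<Prod>k<length ws. window_factor G (ws ! k) (\<rho>s ! k))"
    by (rule dvd_imp_le) (use assms pos in \<open>auto intro: prod_pos dvd_prodI\<close>)
  finally show ?thesis by (simp add: M_of_eq)
qed

lemma M_of_pos: "\<forall>w\<in>set ws. window w \<Longrightarrow> 0 < M_of (G :: nat game) ws \<rho>s"
  unfolding M_of_eq by (intro prod_pos) (auto simp: window_factor_def window_def)

text \<open>The summands are the constants of \<open>wp_window_prog\<close> with the window length
  moved into a factor \<open>M_of\<close>; the 10 covers the initial tables and the end of the list
  of windows.\<close>

definition setup_constant :: "nat list \<Rightarrow> nat" where
  "setup_constant ks = 10 + (\<Sum>k\<leftarrow>ks. 112 + 102 * k)"

lemma wp_tables_prog: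
  assumes G: "states G = {..<n}" "0 < n" and ws: "\<forall>w\<in>set ws. window w" and len: "length \<rho>s = length ws"
    and \<rho>s: "\<forall>i<length ws. rdim (\<rho>s ! i) = win_dim (ws ! i) \<and> 0 < rdim (\<rho>s ! i) \<and> reads_reward m n i (\<rho>s ! i)"
    and m: "m 60 0 = n" "\<And>a i. a < 60 \<Longrightarrow> m a i = 0"
  shows "wp (tables_prog ws) (setup_constant (map win_dim ws) * (n * (M_of G ws \<rho>s)\<^sup>2))
    (\<lambda>m' out'. out' = out \<and> agree {1..19} m m' \<and> Mon n (n * M_of G ws \<rho>s)
       (\<lambda>r. \<forall>i<length ws. \<forall>d<win_dim (ws ! i). sums_ok (ws ! i) (\<rho>s ! i) d r) m') m out"
proof -
  let ?M = "M_of G ws \<rho>s"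
  let ?c = "\<Sum>w\<leftarrow>ws. 112 + 102 * (win_dim w * win_len w)"
  have M0: "0 < ?M" using M_of_pos[OF ws] .
  let ?Q = "\<lambda>m' out'. out' = out \<and> agree {1..19} m m' \<and> Mon n (n * M_of G ws \<rho>s)
       (\<lambda>r. \<forall>i<length ws. \<forall>d<win_dim (ws ! i). sums_ok (ws ! i) (\<rho>s ! i) d r) m'"
  have "wp init_tables (n * 3 + 4) (wp (windows_prog 0 ws) ((1 + ?c) * (n * ?M)) ?Q) m out"
  proof (rule wp_mono[OF wp_init_tables[where m = m and n = n, OF m(1) G(2) m(2)]])
    fix m1 out1 assume *: "out1 = out \<and> agree {1..19} m m1 \<and> Mon n n (\<lambda>r. True) m1"
    have rr: "\<forall>i<length ws. rdim (\<rho>s ! i) = win_dim (ws ! i) \<and> 0 < rdim (\<rho>s ! i) \<and> reads_reward m1 n (0 + i) (\<rho>s ! i)"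
    proof -
      have "reads_reward m1 n i \<rho> = reads_reward m n i \<rho>" for i \<rho>
        using * by (simp add: reads_reward_def agree_def)
      then show ?thesis using \<rho>s by (simp only: add_0)
    qed
    have m60: "m1 60 0 = n" using * m by (simp add: agree_def)
    have "wp (windows_prog 0 ws) ((1 + ?c) * (n * ?M)) (\<lambda>m' out'. out' = out1 \<and> agree {1..18} m1 m' \<and> Mon n (n * ?M)
       (\<lambda>r. True \<and> (\<forall>i<length ws. \<forall>d<win_dim (ws ! i). sums_ok (ws ! i) (\<rho>s ! i) d r)) m') m1 out1"
      unfolding M_of_eq by (rule wp_windows_prog[OF G ws len rr _ m60]) (use * in blast)
    then show "wp (windows_prog 0 ws) ((1 + ?c) * (n * ?M)) ?Q m1 out1"
    proof (rule wp_mono)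
      fix m' out'
      assume **: "out' = out1 \<and> agree {1..18} m1 m' \<and> Mon n (n * ?M)
        (\<lambda>r. True \<and> (\<forall>i<length ws. \<forall>d<win_dim (ws ! i). sums_ok (ws ! i) (\<rho>s ! i) d r)) m'"
      have "agree {1..19} m m'" by (rule agree_trans[of "{1..19}" m m1 "{1..18}"]) (use * ** in auto)
      then show "?Q m' out'" using * ** by simp
    qed simp
  qed auto
  then show ?thesis unfolding tables_prog_def
  proof (rule wp_Seq)
    have "112 + 102 * (win_dim w * win_len w) \<le> (112 + 102 * win_dim w) * ?M" if w: "w \<in> set ws" for w
    proof -
      obtain i where "i < length ws" "w = ws ! i" using w by (auto simp: in_set_conv_nth)
      then have "win_len w \<le> ?M" using win_len_le_M_of[OF ws] by blast
      then have "win_dim w * win_len w \<le> win_dim w * ?M" by simp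
      moreover have "112 \<le> 112 * ?M" using M0 by simp
      ultimately show ?thesis unfolding add_mult_distrib by linarith
    qed
    then have "?c \<le> (\<Sum>w\<leftarrow>ws. (112 + 102 * win_dim w) * ?M)" by (rule sum_list_mono)
    also have "\<dots> = (\<Sum>k\<leftarrow>map win_dim ws. 112 + 102 * k) * ?M"
      unfolding map_map o_def sum_list_mult_const ..
    finally have "?c * (n * ?M) \<le> (\<Sum>k\<leftarrow>map win_dim ws. 112 + 102 * k) * ?M * (n * ?M)"
      by (rule mult_le_mono1)
    also have "\<dots> = (\<Sum>k\<leftarrow>map win_dim ws. 112 + 102 * k) * (n * ?M\<^sup>2)"
      by (simp add: power2_eq_square mult.commute mult.left_commute)
    finally have c: "?c * (n * ?M) \<le> (\<Sum>k\<leftarrow>map win_dim ws. 112 + 102 * k) * (n * ?M\<^sup>2)" .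
    have "1 * 1 \<le> ?M * ?M" using M0 by (intro mult_le_mono) auto
    then have "n * 1 \<le> n * ?M\<^sup>2" "n * (?M * 1) \<le> n * ?M\<^sup>2" using M0 unfolding power2_eq_square
      by (intro mult_le_mono2; simp)+
    then have "n * 3 + 4 + 1 * (n * ?M) \<le> 10 * (n * ?M\<^sup>2)" using G(2) by linarith
    with c show "n * 3 + 4 + (1 + ?c) * (n * ?M) \<le> setup_constant (map win_dim ws) * (n * ?M\<^sup>2)"
      unfolding setup_constant_def add_mult_distrib by linarith
  qed
qed

section \<open>Computing the attractor\<close>

text \<open>Iterates over the adjacency list of the game state of product state \<open>v\<close>
  (scalar 9). Before each execution of \<open>body\<close>, scalar 17 holds the successor in the
  product, which is the listed state plus \<open>nb v\<close> from scalar 16, and scalar 18 holds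
  its mark in array 3.\<close>

definition for_edges :: "prog \<Rightarrow> prog" where
  "for_edges body = Seq (Load 15 1 9) (Seq (Load 21 62 15) (Seq (Add 15 15 19) (Seq (Load 22 62 15) (Seq (Sub 22 22 21)
     (Seq (Load 16 2 9)
       (While 22 (Seq (Load 17 63 21) (Seq (Add 17 17 16) (Seq (Load 18 3 17) (Seq body
         (Seq (Add 21 21 19) (Sub 22 22 19))))))))))))"

text \<open>Scalars 23 and 24 tell whether there is a successor inside and outside the set stored in array 3.\<close>

definition scan :: prog where
  "scan = Seq (Const 23 0) (Seq (Const 24 0) (for_edges (If 18 (Const 23 1) (Const 24 1))))"

text \<open>Array 3 holds the states that are known to be losing; scalar 20 tells whether a pass over all
  states has found a new one.\<close>

definition attractor_pass :: prog where
  "attractor_pass = Seq (Const 20 0) (Seq (Const 9 0) (Seq (Add 9 9 6)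
     (While 9 (Seq (Sub 9 9 19) (Seq scan (Seq (Load 15 1 9) (Seq (Load 15 61 15) (Seq (Load 16 3 9)
       (If 16 Skip (If 15 (If 24 Skip (Seq (Store 3 9 19) (Const 20 1)))
                          (If 23 (Seq (Store 3 9 19) (Const 20 1)) Skip)))))))))))"

definition pass_arrays :: "nat set" where
  "pass_arrays = {3, 9, 15, 16, 17, 18, 20, 21, 22, 23, 24}"

definition attractor_prog :: prog where
  "attractor_prog = Seq (Const 20 1) (While 20 attractor_pass)"

context monitored
begin

definition reads_game :: "memory \<Rightarrow> bool" where
  "reads_game m \<longleftrightarrow> (\<forall>v<N. m 1 v = st v \<and> m 2 v = nb v) \<and> m 6 0 = N \<and> m 19 0 = 1 \<and> m 60 0 = n \<and>
     (\<forall>v<n. m 61 v = (if v \<in> boxes G then 1 else 0)) \<and>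
     (\<forall>v<n. m 62 v \<le> m 62 (Suc v) \<and>
        distinct (map (m 63) [m 62 v..<m 62 (Suc v)]) \<and>
        set (map (m 63) [m 62 v..<m 62 (Suc v)]) = {w. (v, w) \<in> edges G})"

lemma reads_game_agree:
  "agree A m m' \<Longrightarrow> {1, 2, 6, 19, 60, 61, 62, 63} \<inter> A = {} \<Longrightarrow> reads_game m' = reads_game m"
  unfolding reads_game_def by (simp add: agreeD_fun)

definition succs :: "memory \<Rightarrow> nat \<Rightarrow> nat list" where
  "succs m v = map (\<lambda>e. nb v + m 63 e) [m 62 (st v)..<m 62 (Suc (st v))]"

lemma succs:
  assumes "reads_game m" "v < N"
  shows "set (succs m v) = {u. (v, u) \<in> prod_edges}" "distinct (succs m v)" "length (succs m v) \<le> n"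
proof -
  have eq: "succs m v = map ((+) (nb v)) (map (m 63) [m 62 (st v)..<m 62 (Suc (st v))])"
    by (simp add: succs_def)
  have E: "distinct (map (m 63) [m 62 (st v)..<m 62 (Suc (st v))])"
    "set (map (m 63) [m 62 (st v)..<m 62 (Suc (st v))]) = {w. (st v, w) \<in> edges G}"
    using assms st_less[OF assms(2)] by (auto simp: reads_game_def)
  show "set (succs m v) = {u. (v, u) \<in> prod_edges}"
    unfolding eq set_map[of "(+) (nb v)"] E using assms(2) by (auto simp: prod_edges_def)
  show d: "distinct (succs m v)"
    unfolding eq distinct_map[of "(+) (nb v)"] using E by auto
  have "length (succs m v) = card {w. (st v, w) \<in> edges G}"
    using distinct_card[OF E(1)] E(2) by (simp add: eq del: set_map)
  also have "\<dots> \<le> card {..<n}" using edge_states by (intro card_mono) auto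
  finally show "length (succs m v) \<le> n" by simp
qed

text \<open>\<open>J ys\<close> is the invariant after the successors \<open>ys\<close> have been
  treated. The loop owns scalars 16, 21 and 22, so \<open>body\<close> has to preserve them.\<close>

lemma wp_for_edges:
  assumes rg: "reads_game m" and v: "m 9 0 = v" "v < N"
    and J0: "\<And>m'. agree {15, 16, 17, 18, 21, 22} m m' \<Longrightarrow> J [] m'"
    and J: "\<And>ys m1 m2. J ys m1 \<Longrightarrow> agree {17, 18, 21, 22} m1 m2 \<Longrightarrow> J ys m2"
    and body: "\<And>ys u m' out. J ys m' \<Longrightarrow> u \<in> set (succs m v) \<Longrightarrow> m' 17 0 = u \<Longrightarrow> m' 18 0 = m' 3 u \<Longrightarrow>
       agree A m m' \<Longrightarrow>
       wp body K (\<lambda>m'' out''. out'' = out \<and> J (ys @ [u]) m'' \<and> agree A m m'' \<and> agree (- {16, 21, 22}) m' m'') m' out"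
    and A: "{15, 16, 17, 18, 21, 22} \<subseteq> A" "{1, 2, 6, 9, 19, 60, 61, 62, 63} \<inter> A = {}"
  shows "wp (for_edges body) (n * (K + 6) + 7) (\<lambda>m' out'. out' = out \<and> J (succs m v) m' \<and> agree A m m') m out"
proof -
  define lo where "lo = m 62 (st v)"
  define hi where "hi = m 62 (Suc (st v))"
  have m: "m 1 v = st v" "m 2 v = nb v" "m 19 0 = 1" "lo \<le> hi"
    using rg v st_less[OF v(2)] by (auto simp: reads_game_def lo_def hi_def)
  have len: "length (succs m v) = hi - lo" by (simp add: succs_def lo_def hi_def)
  let ?while = "While 22 (Seq (Load 17 63 21) (Seq (Add 17 17 16) (Seq (Load 18 3 17) (Seq body
         (Seq (Add 21 21 19) (Sub 22 22 19))))))"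
  define m0 where "m0 = put (put (put (put m 15 0 (Suc (st v))) 21 0 lo) 22 0 (hi - lo)) 16 0 (nb v)"
  define I where "I m' out' \<longleftrightarrow> out' = out \<and> agree A m m' \<and> m' 16 0 = nb v \<and> m' 22 0 \<le> hi - lo \<and>
      m' 21 0 = hi - m' 22 0 \<and> J (take (hi - lo - m' 22 0) (succs m v)) m'" for m' :: memory and out'
  have "wp ?while ((hi - lo) * (K + 5 + 1) + 1) (\<lambda>m' out'. out' = out \<and> J (succs m v) m' \<and> agree A m m') m0 out"
  proof (rule wp_While[where I = I and \<mu> = "\<lambda>m. m 22 0" and k = "K + 5"], goal_cases)
    case 1
    have "agree {15, 16, 17, 18, 21, 22} m m0" by (simp add: m0_def)
    then show ?case using J0[of m0] m(4) A(1) unfolding I_def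
      by (auto simp: m0_def put_apply elim: agree_mono)
  next
    case (2 m1 out1)
    then have I: "I m1 out1" and pos: "m1 22 0 \<noteq> 0" by auto
    define k where "k = hi - lo - m1 22 0"
    define u where "u = succs m v ! k"
    have k: "k < hi - lo" "m1 21 0 = lo + k" using I pos m(4) by (auto simp: I_def k_def)
    have u: "u = nb v + m 63 (lo + k)" using k by (simp add: u_def succs_def lo_def hi_def)
    have tk: "take (Suc k) (succs m v) = take k (succs m v) @ [u]"
      using k len by (simp add: u_def take_Suc_conv_app_nth)
    have ag: "m1 63 = m 63" "m1 19 0 = 1" "m1 16 0 = nb v"
      using I A(2) m(3) by (auto simp: I_def agreeD_fun)
    define m2 where "m2 = put (put (put m1 17 0 (m 63 (lo + k))) 17 0 u) 18 0 (m1 3 u)"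
    have Jm2: "J (take k (succs m v)) m2"
      by (rule J[of _ m1]) (use I in \<open>auto simp: I_def k_def m2_def\<close>)
    have Am2: "agree A m m2" using I A(1) by (auto simp: I_def m2_def)
    have "wp body K (\<lambda>m'' out''. out'' = out1 \<and> J (take k (succs m v) @ [u]) m'' \<and> agree A m m'' \<and> agree (- {16, 21, 22}) m2 m'') m2 out1"
      by (rule body[OF Jm2]) (use k len Am2 in \<open>auto simp: u_def m2_def put_apply\<close>)
    then have "wp body K (wp (Seq (Add 21 21 19) (Sub 22 22 19)) 2 (\<lambda>m' out'. I m' out' \<and> m' 22 0 < m1 22 0)) m2 out1"
    proof (rule wp_mono)
      fix m3 out3
      assume *: "out3 = out1 \<and> J (take k (succs m v) @ [u]) m3 \<and> agree A m m3 \<and> agree (- {16, 21, 22}) m2 m3"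
      then have 3: "m3 19 0 = 1" "m3 16 0 = nb v" "m3 21 0 = lo + k" "m3 22 0 = m1 22 0"
        using A(2) m(3) ag k by (auto simp: agreeD_fun m2_def put_apply)
      define m4 where "m4 = put (put m3 21 0 (Suc (lo + k))) 22 0 (m1 22 0 - 1)"
      have "J (take (Suc k) (succs m v)) m4"
        unfolding tk by (rule J[of _ m3]) (use * in \<open>auto simp: m4_def\<close>)
      moreover have "hi - lo - (m1 22 0 - 1) = Suc k" using I pos m(4) by (auto simp: I_def k_def)
      moreover have "Suc (lo + k) = hi - (m1 22 0 - 1)" using I pos k m(4) by (auto simp: I_def k_def)
      moreover have "agree A m m4" using * A(1) by (simp add: m4_def)
      ultimately have "I m4 out1" using I 3 unfolding I_def by (simp add: m4_def put_apply)
      then show "wp (Seq (Add 21 21 19) (Sub 22 22 19)) 2 (\<lambda>m' out'. I m' out' \<and> m' 22 0 < m1 22 0) m3 out3"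
        using 3 pos * by (simp add: wps put_apply m4_def)
    qed simp
    then have "wp (Seq body (Seq (Add 21 21 19) (Sub 22 22 19))) (K + 2) (\<lambda>m' out'. I m' out' \<and> m' 22 0 < m1 22 0) m2 out1"
      by (rule wp_Seq) simp
    then show ?case using ag k u by (simp add: wps put_apply m2_def add.commute)
  next
    case (3 m1 out1)
    then show ?case using len by (simp add: I_def)
  qed (simp add: m0_def put_apply)
  moreover have "(hi - lo) * (K + 6) \<le> n * (K + 6)"
    using succs(3)[OF rg v(2)] len by (intro mult_le_mono1) simp
  then have "(hi - lo) * (K + 5 + 1) + 1 \<le> n * (K + 6) + 1" by (simp add: add.commute)
  ultimately have "wp ?while (n * (K + 6) + 1) (\<lambda>m' out'. out' = out \<and> J (succs m v) m' \<and> agree A m m') m0 out"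
    by (rule wp_le)
  moreover have "put (put (put (put (put (put m 15 0 (st v)) 21 0 lo) 15 0 (Suc (st v))) 22 0 hi) 22 0 (hi - lo)) 16 0 (nb v) = m0"
    by (intro ext) (simp add: m0_def put_apply)
  ultimately show ?thesis unfolding for_edges_def
    using m v by (simp add: wps put_apply lo_def hi_def)
qed

lemma wp_scan:
  assumes rg: "reads_game m" and v: "m 9 0 = v" "v < N"
  shows "wp scan (n * 8 + 9) (\<lambda>m' out'. out' = out \<and> agree {15, 16, 17, 18, 21, 22, 23, 24} m m' \<and>
    (m' 23 0 \<noteq> 0 \<longleftrightarrow> (\<exists>u. (v, u) \<in> prod_edges \<and> m 3 u \<noteq> 0)) \<and>
    (m' 24 0 \<noteq> 0 \<longleftrightarrow> (\<exists>u. (v, u) \<in> prod_edges \<and> m 3 u = 0))) m out"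
proof -
  define m1 where "m1 = put (put m 23 0 0) 24 0 0"
  have rg1: "reads_game m1"
    using rg reads_game_agree[of "{23, 24}" m m1] by (auto simp: m1_def)
  have sc: "set (succs m1 v) = {u. (v, u) \<in> prod_edges}" using succs(1)[OF rg1 v(2)] .
  define J where "J ys m' \<longleftrightarrow> agree {15, 16, 17, 18, 21, 22, 23, 24} m m' \<and>
      (m' 23 0 \<noteq> 0 \<longleftrightarrow> (\<exists>u\<in>set ys. m 3 u \<noteq> 0)) \<and> (m' 24 0 \<noteq> 0 \<longleftrightarrow> (\<exists>u\<in>set ys. m 3 u = 0))" for ys and m' :: memory
  have "wp (for_edges (If 18 (Const 23 1) (Const 24 1))) (n * (2 + 6) + 7)
    (\<lambda>m' out'. out' = out \<and> J (succs m1 v) m' \<and> agree {15, 16, 17, 18, 21, 22, 23, 24} m1 m') m1 out"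
  proof (rule wp_for_edges[OF rg1])
    show "m1 9 0 = v" using v by (simp add: m1_def put_apply)
    fix ys u m' out'
    assume *: "J ys m'" "m' 17 0 = u" "m' 18 0 = m' 3 u" "agree {15, 16, 17, 18, 21, 22, 23, 24} m1 m'"
    then have "m' 3 u = m 3 u" by (simp add: J_def agree_def)
    with * show "wp (If 18 (Const 23 1) (Const 24 1)) 2 (\<lambda>m'' out''. out'' = out' \<and> J (ys @ [u]) m'' \<and>
       agree {15, 16, 17, 18, 21, 22, 23, 24} m1 m'' \<and> agree (- {16, 21, 22}) m' m'') m' out'"
      by (auto simp: wps J_def put_apply)
  qed (use v in \<open>auto simp: J_def agree_def m1_def put_apply\<close>)
  then have "wp (for_edges (If 18 (Const 23 1) (Const 24 1))) (n * 8 + 7)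
    (\<lambda>m' out'. out' = out \<and> agree {15, 16, 17, 18, 21, 22, 23, 24} m m' \<and>
    (m' 23 0 \<noteq> 0 \<longleftrightarrow> (\<exists>u. (v, u) \<in> prod_edges \<and> m 3 u \<noteq> 0)) \<and>
    (m' 24 0 \<noteq> 0 \<longleftrightarrow> (\<exists>u. (v, u) \<in> prod_edges \<and> m 3 u = 0))) m1 out"
    by (rule wp_mono) (auto simp: J_def sc)
  then show ?thesis unfolding scan_def by (simp add: wps m1_def add.commute)
qed

text \<open>The negation of the two closure rules of \<open>attr\<close> with respect to the marks
  \<open>U\<close>. If all unmarked states satisfy it, the marked set is closed under these
  rules.\<close>

definition safe_at :: "(nat \<Rightarrow> nat) \<Rightarrow> nat \<Rightarrow> bool" where
  "safe_at U v \<longleftrightarrow> (if st v \<in> boxes G then \<exists>u. (v, u) \<in> prod_edges \<and> U u = 0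
     else \<forall>u. (v, u) \<in> prod_edges \<longrightarrow> U u = 0)"

lemma wp_attractor_pass:
  assumes rg: "reads_game m" and sound: "\<And>v. v < N \<Longrightarrow> m 3 v \<noteq> 0 \<Longrightarrow> attr v"
  shows "wp attractor_pass (N * (n * 8 + 20) + 4) (\<lambda>m' out'. out' = out \<and> agree pass_arrays m m' \<and>
     (\<forall>v<N. m' 3 v \<noteq> 0 \<longrightarrow> attr v) \<and> (\<forall>v<N. m 3 v \<noteq> 0 \<longrightarrow> m' 3 v \<noteq> 0) \<and>
     (if m' 20 0 = 0 then (\<forall>v<N. m' 3 v = 0 \<longrightarrow> safe_at (m' 3) v) else (\<exists>v<N. m 3 v = 0 \<and> m' 3 v \<noteq> 0))) m out"
    (is "wp _ _ ?Q m out")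
proof -
  \<comment> \<open>As long as scalar 20 is 0, array 3 has not changed during the pass, so all tests
    so far refer to the same marks. A pass that changes nothing therefore certifies
    \<open>safe_at\<close> for every unmarked state at once.\<close>
  define I where "I m' out' \<longleftrightarrow> out' = out \<and> agree pass_arrays m m' \<and> m' 9 0 \<le> N \<and>
     (\<forall>v<N. m' 3 v \<noteq> 0 \<longrightarrow> attr v) \<and> (\<forall>v<N. m 3 v \<noteq> 0 \<longrightarrow> m' 3 v \<noteq> 0) \<and>
     (m' 20 0 = 0 \<longrightarrow> m' 3 = m 3 \<and> (\<forall>v<N. m' 9 0 \<le> v \<longrightarrow> m 3 v = 0 \<longrightarrow> safe_at (m 3) v)) \<and>
     (m' 20 0 \<noteq> 0 \<longrightarrow> (\<exists>v<N. m 3 v = 0 \<and> m' 3 v \<noteq> 0))" for m' :: memory and out'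
  let ?mark = "Seq (Store 3 9 19) (Const 20 1)"
  define tl where "tl = Seq (Load 15 1 9) (Seq (Load 15 61 15) (Seq (Load 16 3 9)
       (If 16 Skip (If 15 (If 24 Skip ?mark) (If 23 ?mark Skip)))))"
  have "wp (While 9 (Seq (Sub 9 9 19) (Seq scan tl))) (N * (n * 8 + 18 + 1) + 1) ?Q
     (put (put m 20 0 0) 9 0 N) out"
  proof (rule wp_While[where I = I and \<mu> = "\<lambda>m. m 9 0" and k = "n * 8 + 18"], goal_cases)
    case 1
    then show ?case using sound by (auto simp: I_def put_apply pass_arrays_def)
  next
    case (2 m1 out1)
    then have I: "I m1 out1" and pos: "m1 9 0 \<noteq> 0" by auto
    define v where "v = m1 9 0 - 1"
    have v: "v < N" "m1 9 0 = Suc v" using I pos by (auto simp: I_def v_def)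
    have rg1: "reads_game m1" using I rg reads_game_agree[of pass_arrays m m1] by (auto simp: I_def pass_arrays_def)
    then have m1: "m1 1 v = st v" "m1 61 (st v) = (if st v \<in> boxes G then 1 else 0)" "m1 19 0 = 1"
      using v st_less[OF v(1)] by (auto simp: reads_game_def)
    define m2 where "m2 = put m1 9 0 v"
    have rg2: "reads_game m2" using rg1 reads_game_agree[of "{9}" m1 m2] by (auto simp: m2_def)
    have p2: "\<And>u. (v, u) \<in> prod_edges \<Longrightarrow> u < N" by (simp add: prod_edges_iff)
    have "wp scan (n * 8 + 9) (wp tl 8 (\<lambda>m' out'. I m' out' \<and> m' 9 0 < m1 9 0)) m2 out1"
    proof (rule wp_mono[OF wp_scan[OF rg2, of v]])
      show "m2 9 0 = v" "v < N" using v by (simp_all add: m2_def put_apply)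
      fix m3 out3
      assume *: "out3 = out1 \<and> agree {15, 16, 17, 18, 21, 22, 23, 24} m2 m3 \<and>
        (m3 23 0 \<noteq> 0 \<longleftrightarrow> (\<exists>u. (v, u) \<in> prod_edges \<and> m2 3 u \<noteq> 0)) \<and>
        (m3 24 0 \<noteq> 0 \<longleftrightarrow> (\<exists>u. (v, u) \<in> prod_edges \<and> m2 3 u = 0))"
      have 3: "m3 9 0 = v" "m3 1 v = st v" "m3 61 (st v) = (if st v \<in> boxes G then 1 else 0)" "m3 19 0 = 1"
        "m3 3 = m1 3" "m3 20 0 = m1 20 0"
        using * m1 by (auto simp: agreeD_fun m2_def put_apply fun_eq_iff)
      have ag3: "agree pass_arrays m m3"
      proof (rule agree_trans)
        show "agree pass_arrays m m2" using I by (simp add: I_def m2_def pass_arrays_def)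
        show "agree {15, 16, 17, 18, 21, 22, 23, 24} m2 m3" using * by blast
      qed (auto simp: pass_arrays_def)
      have m2_3: "m2 3 = m1 3" by (intro ext) (simp add: m2_def put_apply)
      have flags: "m3 23 0 \<noteq> 0 \<longleftrightarrow> (\<exists>u. (v, u) \<in> prod_edges \<and> m1 3 u \<noteq> 0)"
        "m3 24 0 \<noteq> 0 \<longleftrightarrow> (\<exists>u. (v, u) \<in> prod_edges \<and> m1 3 u = 0)"
        using * unfolding m2_3 by auto
      define hit where "hit \<longleftrightarrow> m1 3 v = 0 \<and> \<not> safe_at (m1 3) v"
      define m4 where "m4 = put (put m3 15 0 (if st v \<in> boxes G then 1 else 0)) 16 0 (m1 3 v)"
      define m5 where "m5 = (if hit then put (put m4 3 v 1) 20 0 1 else m4)"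
      have hit: "hit \<longleftrightarrow> m1 3 v = 0 \<and> (if st v \<in> boxes G then m3 24 0 = 0 else m3 23 0 \<noteq> 0)"
        using flags by (auto simp: hit_def safe_at_def)
      have "I m5 out1 \<and> m5 9 0 < m1 9 0"
      proof (cases hit)
        case False
        have e: "m5 3 = m1 3" "m5 20 0 = m1 20 0" "m5 9 0 = v" "agree pass_arrays m m5"
          using False 3 ag3 by (auto simp: m5_def m4_def put_apply fun_eq_iff pass_arrays_def)
        have "m1 3 v = 0 \<longrightarrow> safe_at (m1 3) v" using False by (auto simp: hit_def)
        then show ?thesis using I v e(4) unfolding I_def e(1-3)
          by (auto simp: le_Suc_eq Suc_le_eq)
      next
        case True
        have e: "\<And>u. m5 3 u = (if u = v then 1 else m1 3 u)" "m5 20 0 = 1" "m5 9 0 = v" "agree pass_arrays m m5"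
          using True 3 ag3 by (auto simp: m5_def m4_def put_apply fun_eq_iff pass_arrays_def)
        have z: "m1 3 v = 0" using True by (simp add: hit_def)
        then have "m 3 v = 0" using I v by (auto simp: I_def)
        have s1: "\<And>u. u < N \<Longrightarrow> m1 3 u \<noteq> 0 \<Longrightarrow> attr u" using I by (auto simp: I_def)
        have "attr v"
        proof (cases "st v \<in> boxes G")
          case True
          have "m1 3 u \<noteq> 0" if "(v, u) \<in> prod_edges" for u
            using \<open>hit\<close> True that by (auto simp: hit_def safe_at_def)
          then show ?thesis by (intro attr.box[OF v(1) True] s1[OF p2])
        next
          case False
          then obtain u where "(v, u) \<in> prod_edges" "m1 3 u \<noteq> 0"
            using \<open>hit\<close> by (auto simp: hit_def safe_at_def)
          then show ?thesis using attr.diamond[OF _ False s1[OF p2]] by blast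
        qed
        moreover have "\<exists>u<N. m 3 u = 0 \<and> m5 3 u \<noteq> 0" using v \<open>m 3 v = 0\<close> e(1) by auto
        moreover have "\<forall>u<N. m 3 u \<noteq> 0 \<longrightarrow> m5 3 u \<noteq> 0" using I e(1) by (simp add: I_def)
        moreover have "out1 = out" using I by (simp add: I_def)
        ultimately show ?thesis using v s1 e unfolding I_def by simp
      qed
      moreover have "put (put (put m3 15 0 (st v)) 15 0 (if st v \<in> boxes G then 1 else 0)) 16 0 (m1 3 v) = m4"
        by (intro ext) (simp add: m4_def put_apply)
      moreover have 4: "m4 9 0 = v" "m4 15 0 = (if st v \<in> boxes G then 1 else 0)" "m4 16 0 = m1 3 v"
        "m4 19 0 = 1" "m4 23 0 = m3 23 0" "m4 24 0 = m3 24 0" by (simp_all add: m4_def put_apply 3)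
      ultimately show "wp tl 8 (\<lambda>m' out'. I m' out' \<and> m' 9 0 < m1 9 0) m3 out3"
        using conjunct1[OF *] unfolding tl_def m5_def hit
        by (cases "st v \<in> boxes G"; cases "m3 24 0 = 0"; cases "m3 23 0 = 0"; cases "m1 3 v = 0")
          (simp_all add: wps 3 4 put_apply del: One_nat_def)
    qed simp
    then have "wp (Seq scan tl) (n * 8 + 17) (\<lambda>m' out'. I m' out' \<and> m' 9 0 < m1 9 0) m2 out1"
      by (rule wp_Seq) simp
    then show ?case using v m1 by (simp add: wps m2_def add.commute)
  next
    case (3 m1 out1)
    then show ?case by (auto simp: I_def)
  qed (simp add: put_apply algebra_simps)
  moreover have "put (put (put m 20 0 0) 9 0 0) 9 0 N = put (put m 20 0 0) 9 0 N"
    by (intro ext) (simp add: put_apply)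
  moreover have "m 6 0 = N" using rg by (simp add: reads_game_def)
  ultimately show ?thesis unfolding attractor_pass_def tl_def
    by (auto simp: wps put_apply elim: wp_le)
qed

text \<open>Marks are only set where a rule of \<open>attr\<close> applies, which gives one
  inclusion; the last pass finds the marked set closed under the rules, which gives the
  other.\<close>

lemma wp_attractor_prog:
  assumes rg: "reads_game m" and bd: "\<And>v. v < N \<Longrightarrow> m 3 v \<noteq> 0 \<longleftrightarrow> bad v" and N: "0 < N"
  shows "wp attractor_prog (80 * (N * N * n)) (\<lambda>m' out'. out' = out \<and> agree pass_arrays m m' \<and>
     (\<forall>v<N. m' 3 v \<noteq> 0 \<longleftrightarrow> attr v)) m out"
proof -
  let ?Q = "\<lambda>m' out'. out' = out \<and> agree pass_arrays m m' \<and> (\<forall>v<N. m' 3 v \<noteq> 0 \<longleftrightarrow> attr v)"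
  define I where "I m' out' \<longleftrightarrow> out' = out \<and> agree pass_arrays m m' \<and>
     (\<forall>v<N. m' 3 v \<noteq> 0 \<longrightarrow> attr v) \<and> (\<forall>v<N. m 3 v \<noteq> 0 \<longrightarrow> m' 3 v \<noteq> 0) \<and>
     (m' 20 0 = 0 \<longrightarrow> (\<forall>v<N. m' 3 v = 0 \<longrightarrow> safe_at (m' 3) v))" for m' :: memory and out'
  \<comment> \<open>The successor accounts for the final pass, which marks nothing and only resets
    scalar 20.\<close>
  define \<mu> where "\<mu> m' = (if m' 20 0 = 0 then 0 else Suc (card {v. v < N \<and> m' 3 v = 0}))" for m' :: memory
  let ?k = "N * (n * 8 + 20) + 4"
  have "wp (While 20 attractor_pass) (Suc N * (?k + 1) + 1) ?Q (put m 20 0 1) out"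
  proof (rule wp_While[where I = I and \<mu> = \<mu> and k = ?k])
    show "I (put m 20 0 1) out" using bd attr.bad by (auto simp: I_def put_apply pass_arrays_def)
    show "wp attractor_pass ?k (\<lambda>m' out'. I m' out' \<and> \<mu> m' < \<mu> m1) m1 out1" if I: "I m1 out1" "m1 20 0 \<noteq> 0" for m1 out1
    proof (rule wp_mono[OF wp_attractor_pass])
      show "reads_game m1" using I rg reads_game_agree[of pass_arrays m m1] by (auto simp: I_def pass_arrays_def)
      show "attr v" if "v < N" "m1 3 v \<noteq> 0" for v using I that by (auto simp: I_def)
      fix m2 out2
      assume *: "out2 = out1 \<and> agree pass_arrays m1 m2 \<and>
         (\<forall>v<N. m2 3 v \<noteq> 0 \<longrightarrow> attr v) \<and> (\<forall>v<N. m1 3 v \<noteq> 0 \<longrightarrow> m2 3 v \<noteq> 0) \<and>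
         (if m2 20 0 = 0 then (\<forall>v<N. m2 3 v = 0 \<longrightarrow> safe_at (m2 3) v) else (\<exists>v<N. m1 3 v = 0 \<and> m2 3 v \<noteq> 0))"
      have "agree pass_arrays m m2" by (rule agree_trans[of pass_arrays m m1 pass_arrays]) (use I * in \<open>auto simp: I_def\<close>)
      moreover have "\<forall>v<N. m 3 v \<noteq> 0 \<longrightarrow> m2 3 v \<noteq> 0" using I(1) * unfolding I_def by blast
      moreover have "out1 = out" using I(1) by (simp add: I_def)
      moreover have "m2 20 0 = 0 \<longrightarrow> (\<forall>v<N. m2 3 v = 0 \<longrightarrow> safe_at (m2 3) v)" using * by presburger
      ultimately have "I m2 out2" using * unfolding I_def by blast
      moreover have "\<mu> m2 < \<mu> m1"
      proof (cases "m2 20 0 = 0")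
        case False
        then obtain v where "v < N" "m1 3 v = 0" "m2 3 v \<noteq> 0" using * by metis
        have mono: "m1 3 u = 0" if "u < N" "m2 3 u = 0" for u using * that by metis
        have "{v. v < N \<and> m2 3 v = 0} \<subseteq> {v. v < N \<and> m1 3 v = 0}" using mono by blast
        moreover have "v \<in> {v. v < N \<and> m1 3 v = 0} - {v. v < N \<and> m2 3 v = 0}"
          using \<open>v < N\<close> \<open>m1 3 v = 0\<close> \<open>m2 3 v \<noteq> 0\<close> by simp
        ultimately have "{v. v < N \<and> m2 3 v = 0} \<subset> {v. v < N \<and> m1 3 v = 0}" by (metis DiffE psubsetI)
        then have "card {v. v < N \<and> m2 3 v = 0} < card {v. v < N \<and> m1 3 v = 0}"
          by (intro psubset_card_mono) auto
        then show ?thesis using I(2) False by (simp add: \<mu>_def)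
      qed (use I in \<open>simp add: \<mu>_def\<close>)
      ultimately show "I m2 out2 \<and> \<mu> m2 < \<mu> m1" ..
    qed simp
    show "?Q m1 out1" if I: "I m1 out1" and z: "m1 20 0 = 0" for m1 out1
    proof -
      have c: "safe_at (m1 3) v" if "v < N" "m1 3 v = 0" for v using I z that by (simp add: I_def)
      \<comment> \<open>Bad states were marked from the start and marks are never removed; the other
        rules are covered by \<open>c\<close>, since an unmarked state could not be safe if such a
        rule applied to it.\<close>
      have "attr v \<Longrightarrow> m1 3 v \<noteq> 0" for v
      proof (induction rule: attr.induct)
        case (bad v)
        then show ?case using I bd by (simp add: I_def)
      next
        case (diamond v u)
        then have "v < N" by (simp add: prod_edges_iff)
        with diamond show ?case using c[of v] by (metis safe_at_def)
      next
        case (box v)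
        then show ?case using c[of v] by (metis safe_at_def)
      qed
      then show ?thesis using I by (simp add: I_def) blast
    qed
    have "card {v. v < N \<and> put m 20 0 1 3 v = 0} \<le> card {..<N}" by (rule card_mono) auto
    then have "\<mu> (put m 20 0 1) \<le> Suc N" by (simp add: \<mu>_def put_apply)
    then show "\<mu> (put m 20 0 1) * (?k + 1) + 1 \<le> Suc N * (?k + 1) + 1" by (intro add_right_mono mult_le_mono1)
  qed
  then show ?thesis unfolding attractor_prog_def wp_Seq_prim
  proof (intro conjI)
    have 1: "1 \<le> N" "1 \<le> n" using N n_pos by auto
    have a: "N * (n * 8 + 20) + 5 \<le> N * n * 33"
    proof -
      have "N * 1 \<le> N * n" using 1 by (intro mult_le_mono2)
      moreover have "1 \<le> N" by (rule 1)
      moreover have "N * (n * 8 + 20) = 8 * (N * n) + 20 * N" by (simp add: algebra_simps)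
      ultimately show ?thesis by linarith
    qed
    have "Suc N * (?k + 1) \<le> (2 * N) * (N * n * 33)"
      by (rule mult_le_mono) (use 1 a in linarith)+
    also have "\<dots> = 66 * (N * N * n)" by simp
    finally have b: "Suc N * (?k + 1) \<le> 66 * (N * N * n)" .
    have "1 * 1 * 1 \<le> N * N * n" using 1 by (intro mult_le_mono)
    with b show "0 < 80 * (N * N * n)" 
      "wp (While 20 attractor_pass) (80 * (N * N * n) - 1) ?Q (put m 20 0 1) out"
      using \<open>wp (While 20 attractor_pass) (Suc N * (?k + 1) + 1) ?Q (put m 20 0 1) out\<close>
      by (auto elim!: wp_le)
  qed
qed

end

section \<open>Building the safe game\<close>

text \<open>Scalar 26 is the first free position of the new edge list, array 43.\<close>

definition keep_edge :: prog where
  "keep_edge = If 18 (If 25 (Seq (Store 43 26 17) (Add 26 26 19)) Skip) (Seq (Store 43 26 17) (Add 26 26 19))"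

text \<open>For the rewards only the reference of the underlying game state is copied, so the time
  per state does not depend on the dimension and the vectors themselves stay in the input
  array.\<close>

definition copy_state :: prog where
  "copy_state = Seq (Load 15 1 9) (Seq (Load 16 61 15) (Seq (Store 41 9 16)
     (Seq (Load 16 64 15) (Seq (Store 44 9 16) (Seq (Load 25 3 9) (Seq (for_edges keep_edge)
     (Seq (Add 9 9 19) (Seq (Store 42 9 26) (Sub 27 27 19)))))))))"

text \<open>The initial state is copied without change: its number is below \<open>n\<close>, hence
  its monitor code is 0. The dimension of the main reward is copied as well.\<close>

definition build_prog :: prog where
  "build_prog = Seq (Const 26 0) (Seq (Const 9 0) (Seq (Const 27 0) (Seq (Add 27 27 6) (Seq (Store 42 9 26)
     (Seq (While 27 copy_state)
     (Seq (Const 15 0) (Seq (Store 40 15 6)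
     (Seq (Const 15 1) (Seq (Load 16 60 15) (Seq (Store 40 15 16)
     (Seq (Const 15 2) (Seq (Load 16 60 15) (Store 40 15 16)))))))))))))"

definition build_arrays :: "nat set" where
  "build_arrays = {9, 15, 16, 17, 18, 21, 22, 25, 26, 27, 40, 41, 42, 43, 44}"

lemma map_append_upt:
  assumes "map f [a..<b] = xs" "\<And>i. i < b \<Longrightarrow> g i = f i" "g b = x" "a \<le> b"
  shows "map g [a..<Suc b] = xs @ [x]"
proof -
  have "map g [a..<b] = map f [a..<b]" using assms(2) by auto
  then show ?thesis using assms by simp
qed

lemma put_other: "a \<noteq> b \<Longrightarrow> put m a i v b = m b"
  by (simp add: put_def)

context monitored
begin

lemma wp_keep_edges:
  assumes rg: "reads_game m" and v: "m 9 0 = v" "v < N" and m25: "m 25 0 = m 3 v"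
  shows "wp (for_edges keep_edge) (n * 10 + 7) (\<lambda>m' out'. out' = out \<and> agree {15, 16, 17, 18, 21, 22, 26, 43} m m' \<and>
    (let L = filter (\<lambda>u. m 3 v \<noteq> 0 \<or> m 3 u = 0) (succs m v) in
      m' 26 0 = m 26 0 + length L \<and> (\<forall>i<m 26 0. m' 43 i = m 43 i) \<and>
      map (m' 43) [m 26 0..<m 26 0 + length L] = L)) m out"
proof -
  let ?A = "{15, 16, 17, 18, 21, 22, 26, 43} :: nat set"
  let ?k = "\<lambda>u. m 3 v \<noteq> 0 \<or> m 3 u = 0"
  define pos where "pos = m 26 0"
  define J where "J ys m' \<longleftrightarrow> m' 26 0 = pos + length (filter ?k ys) \<and> (\<forall>i<pos. m' 43 i = m 43 i) \<and>
      map (m' 43) [pos..<pos + length (filter ?k ys)] = filter ?k ys" for ys and m' :: memory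
  have "wp (for_edges keep_edge) (n * (4 + 6) + 7) (\<lambda>m' out'. out' = out \<and> J (succs m v) m' \<and> agree ?A m m') m out"
  proof (rule wp_for_edges[OF rg v])
    fix m' assume "agree {15, 16, 17, 18, 21, 22} m m'"
    then show "J [] m'" by (simp add: J_def pos_def agree_def)
  next
    fix ys m1 m2 assume "J ys m1" "agree {17, 18, 21, 22} m1 m2"
    then show "J ys m2" by (simp add: J_def agreeD_fun)
  next
    fix ys u m' out'
    assume J: "J ys m'" and u: "m' 17 0 = u" "m' 18 0 = m' 3 u" and a: "agree ?A m m'"
    have f: "m' 25 0 = m 3 v" "m' 3 u = m 3 u" "m' 19 0 = 1"
      using a m25 rg by (simp_all add: agree_def reads_game_def)
    define m'' where "m'' = (if ?k u then put (put m' 43 (m' 26 0) u) 26 0 (Suc (m' 26 0)) else m')"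
    have "J (ys @ [u]) m''"
    proof (cases "?k u")
      case True
      have "map (m'' 43) [pos..<Suc (m' 26 0)] = filter ?k ys @ [u]"
      proof (rule map_append_upt)
        show "map (m' 43) [pos..<m' 26 0] = filter ?k ys" using J by (simp add: J_def)
      qed (use True J in \<open>auto simp: m''_def put_apply J_def\<close>)
      moreover have "m'' 26 0 = Suc (m' 26 0)" using True by (simp add: m''_def put_apply)
      moreover have "m'' 43 i = m' 43 i" if "i < pos" for i
        using True J that by (auto simp: m''_def put_apply J_def)
      ultimately show ?thesis using True J by (simp add: J_def)
    next
      case False
      then show ?thesis using J by (simp add: J_def m''_def)
    qed
    moreover have "agree ?A m m''" using a by (simp add: m''_def)
    moreover have "agree (- {16, 21, 22}) m' m''" by (simp add: m''_def)
    ultimately show "wp keep_edge 4 (\<lambda>m'' out''. out'' = out' \<and> J (ys @ [u]) m'' \<and> agree ?A m m'' \<and>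
      agree (- {16, 21, 22}) m' m'') m' out'"
      unfolding keep_edge_def m''_def by (cases "m 3 v = 0"; cases "m 3 u = 0") (simp_all add: wps u f put_apply)
  qed auto
  then show ?thesis by (rule wp_mono) (auto simp: J_def pos_def Let_def)
qed

text \<open>The part of \<open>represents\<close> that concerns the first \<open>k\<close> states,
  in the arrays where the given solver will find it.\<close>

definition built :: "memory \<Rightarrow> memory \<Rightarrow> nat \<Rightarrow> bool" where
  "built m m' k \<longleftrightarrow> m' 42 0 = 0 \<and> (\<forall>v<k. m' 41 v = (if st v \<in> boxes G then 1 else 0) \<and> m' 44 v = m 64 (st v) \<and>
      m' 42 v \<le> m' 42 (Suc v) \<and> distinct (map (m' 43) [m' 42 v..<m' 42 (Suc v)]) \<and>
      set (map (m' 43) [m' 42 v..<m' 42 (Suc v)]) = {u. (v, u) \<in> edges safe_game})"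

lemma wp_build_prog:
  assumes rg: "reads_game m" and at: "\<And>v. v < N \<Longrightarrow> m 3 v \<noteq> 0 \<longleftrightarrow> attr v" and N: "0 < N"
  shows "wp build_prog (50 * (N * n)) (\<lambda>m' out'. out' = out \<and> agree build_arrays m m' \<and> built m m' N \<and>
     m' 40 0 = N \<and> m' 40 1 = m 60 1 \<and> m' 40 2 = m 60 2) m out"
proof -
  let ?Q = "\<lambda>m' out'. out' = out \<and> agree build_arrays m m' \<and> built m m' N \<and>
     m' 40 0 = N \<and> m' 40 1 = m 60 1 \<and> m' 40 2 = m 60 2"
  \<comment> \<open>The bound on the earlier segment boundaries guarantees that new edges are
    appended behind all finished segments, which therefore keep their contents.\<close>
  define I where "I m' out' \<longleftrightarrow> out' = out \<and> agree (build_arrays - {40}) m m' \<and> m' 9 0 + m' 27 0 = N \<and>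
     built m m' (m' 9 0) \<and> m' 42 (m' 9 0) = m' 26 0 \<and> (\<forall>v<m' 9 0. m' 42 v \<le> m' 26 0)" for m' :: memory and out'
  define tl where "tl = Seq (Add 9 9 19) (Seq (Store 42 9 26) (Sub 27 27 19))"
  have step: "wp copy_state (n * 10 + 16) (\<lambda>m' out'. I m' out' \<and> m' 27 0 < m1 27 0) m1 out1"
    if I: "I m1 out1" and pos: "m1 27 0 \<noteq> 0" for m1 out1
  proof -
    define v where "v = m1 9 0"
    define p where "p = m1 26 0"
    have v: "v < N" "m1 9 0 = v" using I pos by (auto simp: I_def v_def)
    have rg1: "reads_game m1"
      using I rg reads_game_agree[of "build_arrays - {40}" m m1] by (auto simp: I_def build_arrays_def)
    have m1: "m1 1 v = st v" "m1 61 (st v) = (if st v \<in> boxes G then 1 else 0)" "m1 19 0 = 1" "m1 3 = m 3" "m1 64 = m 64"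
      using rg1 v st_less[OF v(1)] I by (auto simp: reads_game_def I_def build_arrays_def agreeD_fun)
    define m2 where "m2 = put (put (put (put (put m1 15 0 (st v)) 41 v (m1 61 (st v))) 16 0 (m 64 (st v))) 44 v (m 64 (st v))) 25 0 (m 3 v)"
    have rg2: "reads_game m2" using rg1 reads_game_agree[of "{15, 16, 25, 41, 44}" m1 m2] by (auto simp: m2_def)
    have m2: "m2 9 0 = v" "m2 25 0 = m2 3 v" "m2 3 = m 3" "m2 26 0 = p"
      using v m1 by (auto simp: m2_def put_apply fun_eq_iff p_def)
    define L where "L = filter (\<lambda>u. m2 3 v \<noteq> 0 \<or> m2 3 u = 0) (succs m2 v)"
    have L: "set L = {u. (v, u) \<in> edges safe_game}" "distinct L"
    proof -
      have "u \<in> set L \<longleftrightarrow> (v, u) \<in> edges safe_game" for u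
      proof -
        have "(v, u) \<in> prod_edges \<Longrightarrow> m 3 u \<noteq> 0 \<longleftrightarrow> attr u"
          using at[of u] by (simp add: prod_edges_iff)
        moreover have "m 3 v \<noteq> 0 \<longleftrightarrow> attr v" using at[OF v(1)] .
        moreover have "u \<in> set L \<longleftrightarrow> (v, u) \<in> prod_edges \<and> (m 3 v \<noteq> 0 \<or> m 3 u = 0)"
          using succs(1)[OF rg2 v(1)] by (auto simp: L_def m2(3))
        ultimately show ?thesis by (simp only: safe_game_sel mem_Collect_eq case_prod_conv) blast
      qed
      then show "set L = {u. (v, u) \<in> edges safe_game}" by blast
      show "distinct L" using succs(2)[OF rg2 v(1)] by (simp add: L_def)
    qed
    have "wp (for_edges keep_edge) (n * 10 + 7) (wp tl 3 (\<lambda>m' out'. I m' out' \<and> m' 27 0 < m1 27 0)) m2 out1"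
    proof (rule wp_mono[OF wp_keep_edges[OF rg2 m2(1) v(1) m2(2)]])
      fix m3 out3
      assume *: "out3 = out1 \<and> agree {15, 16, 17, 18, 21, 22, 26, 43} m2 m3 \<and>
        (let L = filter (\<lambda>u. m2 3 v \<noteq> 0 \<or> m2 3 u = 0) (succs m2 v) in
          m3 26 0 = m2 26 0 + length L \<and> (\<forall>i<m2 26 0. m3 43 i = m2 43 i) \<and>
          map (m3 43) [m2 26 0..<m2 26 0 + length L] = L)"
      then have 3: "m3 26 0 = p + length L" "\<And>i. i < p \<Longrightarrow> m3 43 i = m1 43 i"
        "map (m3 43) [p..<p + length L] = L"
        unfolding L_def[symmetric] Let_def m2(4) by (auto simp: m2_def put_apply)
      have 4: "m3 9 0 = v" "m3 19 0 = 1" "m3 27 0 = m1 27 0" "m3 42 = m1 42"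
        "\<And>k. m3 41 k = (if k = v then (if st v \<in> boxes G then 1 else 0) else m1 41 k)"
        "\<And>k. m3 44 k = (if k = v then m 64 (st v) else m1 44 k)"
      proof -
        have a3: "agree {15, 16, 17, 18, 21, 22, 26, 43} m2 m3" using * by (elim conjE)
        show "m3 9 0 = v" "m3 19 0 = 1" "m3 27 0 = m1 27 0" "m3 42 = m1 42"
          "\<And>k. m3 41 k = (if k = v then (if st v \<in> boxes G then 1 else 0) else m1 41 k)"
          "\<And>k. m3 44 k = (if k = v then m 64 (st v) else m1 44 k)"
          using m1 v by (simp_all add: agreeD_fun[OF a3] m2_def put_apply fun_eq_iff)
      qed
      define m4 where "m4 = put (put (put m3 9 0 (Suc v)) 42 (Suc v) (p + length L)) 27 0 (m1 27 0 - 1)"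
      have sc: "m4 9 0 = Suc v" "m4 27 0 = m1 27 0 - 1" "m4 26 0 = p + length L" "m4 43 = m3 43" "m4 41 = m3 41" "m4 44 = m3 44"
        "\<And>k. m4 42 k = (if k = Suc v then p + length L else m1 42 k)"
        using 3 4 by (auto simp: m4_def put_apply fun_eq_iff)
      have Ib: "built m m1 v" "m1 42 v = p" "\<forall>k<v. m1 42 k \<le> p" using I by (auto simp: I_def v_def p_def)
      have "built m m4 (Suc v)"
        unfolding built_def
      proof (intro conjI allI impI)
        show "m4 42 0 = 0" using Ib(1) by (simp add: sc built_def)
        fix k assume k: "k < Suc v"
        show "m4 41 k = (if st k \<in> boxes G then 1 else 0)" "m4 44 k = m 64 (st k)"
          using k Ib(1) unfolding sc 4 built_def by auto
        have pre: "map (m3 43) [m1 42 k..<m1 42 (Suc k)] = map (m1 43) [m1 42 k..<m1 42 (Suc k)]" if "k < v"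
        proof -
          have "m1 42 (Suc k) \<le> p" using Ib(2,3) that by (cases "Suc k = v") auto
          then show ?thesis using 3(2) by auto
        qed
        have ends: "m4 42 k = m1 42 k" "m4 42 (Suc k) = (if k = v then p + length L else m1 42 (Suc k))"
          using k by (simp_all add: sc(7))
        have seg: "map (m4 43) [m4 42 k..<m4 42 (Suc k)] = (if k = v then L else map (m1 43) [m1 42 k..<m1 42 (Suc k)])"
        proof (cases "k = v")
          case True
          then show ?thesis unfolding ends sc(4) using 3(3) Ib(2) by simp
        next
          case False
          then show ?thesis unfolding ends sc(4) using pre k by simp
        qed
        have old: "m1 42 k \<le> m1 42 (Suc k)" "distinct (map (m1 43) [m1 42 k..<m1 42 (Suc k)])"
          "set (map (m1 43) [m1 42 k..<m1 42 (Suc k)]) = {u. (k, u) \<in> edges safe_game}" if "k < v"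
          using Ib(1) that unfolding built_def by blast+
        show "m4 42 k \<le> m4 42 (Suc k)" unfolding ends using old(1) k Ib(2) by (cases "k = v") simp_all
        show "distinct (map (m4 43) [m4 42 k..<m4 42 (Suc k)])"
          unfolding seg using old(2) k L(2) by (cases "k = v") simp_all
        show "set (map (m4 43) [m4 42 k..<m4 42 (Suc k)]) = {u. (k, u) \<in> edges safe_game}"
          unfolding seg using old(3) k L(1) by (cases "k = v") simp_all
      qed
      moreover have "agree (build_arrays - {40}) m m4"
      proof (rule agree_trans)
        show "agree (build_arrays - {40}) m m1" using I by (simp add: I_def)
        have "agree (build_arrays - {40}) m1 m2" by (simp add: m2_def build_arrays_def)
        moreover have "agree (build_arrays - {40}) m2 m3" using * by (auto elim!: agree_mono simp: build_arrays_def)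
        ultimately have "agree (build_arrays - {40}) m1 m3" by (rule agree_trans) auto
        then show "agree (build_arrays - {40}) m1 m4" by (simp add: m4_def build_arrays_def)
      qed auto
      moreover have "\<forall>k<Suc v. m4 42 k \<le> m4 26 0" using Ib(2,3) by (auto simp: sc less_Suc_eq)
      ultimately have "I m4 out1" using I pos v unfolding I_def by (simp add: sc)
      then show "wp tl 3 (\<lambda>m' out'. I m' out' \<and> m' 27 0 < m1 27 0) m3 out3"
        using * pos unfolding tl_def by (simp add: wps put_apply 4 3(1) m4_def)
    qed simp
    then have "wp (Seq (for_edges keep_edge) tl) (n * 10 + 10) (\<lambda>m' out'. I m' out' \<and> m' 27 0 < m1 27 0) m2 out1"
      by (rule wp_Seq) simp
    moreover have "put (put (put (put (put (put m1 15 0 (st v)) 16 0 (m1 61 (st v))) 41 v (m1 61 (st v))) 16 0 (m 64 (st v))) 44 v (m 64 (st v))) 25 0 (m 3 v) = m2"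
      by (intro ext) (simp add: m2_def put_apply)
    ultimately show ?thesis
      unfolding copy_state_def tl_def[symmetric] using v m1(1,4,5)
      by (simp add: wps put_apply add.commute)
  qed
  define fin where "fin = Seq (Const 15 0) (Seq (Store 40 15 6)
     (Seq (Const 15 1) (Seq (Load 16 60 15) (Seq (Store 40 15 16)
     (Seq (Const 15 2) (Seq (Load 16 60 15) (Store 40 15 16)))))))"
  define m0 where "m0 = put (put (put (put m 26 0 0) 9 0 0) 27 0 N) 42 0 0"
  have "wp (While 27 copy_state) (N * (n * 10 + 16 + 1) + 1) (wp fin 8 ?Q) m0 out"
  proof (rule wp_While[where I = I and \<mu> = "\<lambda>m. m 27 0" and k = "n * 10 + 16"])
    show "I m0 out" by (auto simp: I_def m0_def put_apply built_def build_arrays_def)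
    show "wp fin 8 ?Q m1 out1" if I: "I m1 out1" and z: "m1 27 0 = 0" for m1 out1
    proof -
      have m1: "m1 6 0 = N" "m1 60 = m 60" "m1 9 0 = N" "built m m1 N" "out1 = out" "agree build_arrays m m1"
        using I z rg by (auto simp: I_def build_arrays_def reads_game_def agreeD_fun elim: agree_mono)
      then show ?thesis unfolding fin_def
        by (simp add: wps put_other built_def) (simp add: put_apply build_arrays_def)
    qed
  qed (use step in \<open>auto simp: m0_def put_apply\<close>)
  then have "wp (Seq (While 27 copy_state) fin) (N * (n * 10 + 17) + 9) ?Q m0 out"
    by (rule wp_Seq) simp
  moreover have "put (put (put (put (put m 26 0 0) 9 0 0) 27 0 0) 27 0 N) 42 0 0 = m0"
    by (intro ext) (simp add: m0_def put_apply)
  moreover have "m 6 0 = N" using rg by (simp add: reads_game_def)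
  moreover have "5 + (N * (n * 10 + 17) + 9) \<le> 50 * (N * n)"
  proof -
    have 1: "1 \<le> N" "1 \<le> n" using N n_pos by auto
    have "N * 1 \<le> N * n" using 1 by (intro mult_le_mono2)
    moreover have "N * (n * 10 + 17) = 10 * (N * n) + 17 * N" by (simp add: algebra_simps)
    ultimately show ?thesis using 1 by linarith
  qed
  ultimately have "wp build_prog (5 + (N * (n * 10 + 17) + 9)) ?Q m out"
    unfolding build_prog_def fin_def[symmetric] by (simp add: wps put_apply add.commute)
  then show ?thesis by (rule wp_le) fact
qed

end

section \<open>The strategy program\<close>

text \<open>The description of a strategy consists of the description \<open>d\<close> of a strategy in the safe
  game, the table of the monitor, and the size of that table. The description for the
  inner program \<open>q\<close> is put into array 21, the lifted history into array 22.\<close>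

definition lift_prog :: prog where
  "lift_prog = Seq (Const 4 1) (Seq (Sub 7 0 4) (Seq (Load 5 1 7) (Seq (Sub 6 7 5)
     (Seq (Const 8 0) (Seq (Const 9 0) (Seq (Add 9 9 6)
     (Seq (While 9 (Seq (Load 10 1 8) (Seq (Store 21 8 10) (Seq (Add 8 8 4) (Sub 9 9 4)))))
     (Seq (Const 8 0) (Seq (Load 9 0 4) (Seq (Const 11 0)
     (Seq (While 9 (Seq (Load 10 2 8) (Seq (Add 10 10 11) (Seq (Store 22 8 10) (Seq (Add 10 10 6)
        (Seq (Load 11 1 10) (Seq (Add 8 8 4) (Sub 9 9 4))))))))
     (Seq (Const 8 0) (Seq (Store 20 8 6) (Seq (Load 9 0 4) (Store 20 4 9)))))))))))))))"

text \<open>Relocation without printing leaves the move of the inner strategy in scalar 3, which is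
  0 beforehand. Subtracting the entry of \<open>nb\<close> for the current product state, kept in
  scalar 11, yields the move in the original game.\<close>

definition strategy_prog :: "prog \<Rightarrow> prog" where
  "strategy_prog q = Seq lift_prog (Seq (relocate False 3 ((+) 20) q) (Seq (Sub 3 3 11) (Print 3)))"

context monitored
begin

text \<open>With \<open>N\<close> at the end, the program can locate the table without knowing the
  length of \<open>d\<close>: it reads \<open>N\<close> from the last cell and finds where
  \<open>d\<close> stops.\<close>

abbreviation "description d \<equiv> d @ map nb [0..<N] @ [N]"

text \<open>The inner program must see its input with all cells right, including the zeros; so apart
  from arrays 20, 21 and 22 the program works below 20. Some bound \<open>T\<close> is enough
  because \<open>describes\<close> asks only for termination.\<close>

lemma wp_lift_prog:
  assumes h: "h \<noteq> []" "set h \<subseteq> {..<n}" and nN: "n \<le> N"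
  shows "\<exists>T. wp lift_prog T (\<lambda>m' out'. out' = out \<and> (\<forall>a. m' (20 + a) = move_input d (lift h) a) \<and>
    m' 11 0 = nb (last (lift h)) \<and> m' 3 0 = 0) (move_input (description d) h) out"
proof -
  let ?m = "move_input (description d) h"
  define Ld where "Ld = length d"
  define m1 where "m1 = put (put (put (put (put (put ?m 4 0 1) 7 0 (Ld + N)) 5 0 N) 6 0 Ld) 8 0 0) 9 0 Ld"
  define copy where "copy = Seq (Load 10 1 8) (Seq (Store 21 8 10) (Seq (Add 8 8 4) (Sub 9 9 4)))"
  define lft where "lft = Seq (Load 10 2 8) (Seq (Add 10 10 11) (Seq (Store 22 8 10) (Seq (Add 10 10 6)
        (Seq (Load 11 1 10) (Seq (Add 8 8 4) (Sub 9 9 4))))))"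
  define fin where "fin = Seq (Const 8 0) (Seq (Store 20 8 6) (Seq (Load 9 0 4) (Store 20 4 9)))"
  let ?Q = "\<lambda>m' out'. out' = out \<and> (\<forall>a. m' (20 + a) = move_input d (lift h) a) \<and>
    m' 11 0 = nb (last (lift h)) \<and> m' 3 0 = 0"
  define w where "w i = track nb ((!) h) i" for i
  have w: "w i < N" if "i < length h" for i
  proof -
    have "h ! j < n" if "j \<le> i" for j using h(2) \<open>i < length h\<close> that nth_mem[of j h] by (auto simp: subset_iff)
    then show ?thesis using track_states[of i "(!) h"] nN by (simp add: w_def)
  qed
  have lift: "lift h ! i = w i" if "i < length h" for i using that by (simp add: lift_def w_def)
  have z: "?m a i = 0" if "3 \<le> a" for a i using that by (simp add: move_input_def)
  define I2 where "I2 m' out' \<longleftrightarrow> out' = out \<and> agree {4, 5, 6, 7, 8, 9, 10, 11, 21, 22} ?m m' \<and> m' 4 0 = 1 \<and> m' 6 0 = Ld \<and>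
      m' 8 0 + m' 9 0 = length h \<and> m' 11 0 = (if m' 8 0 = 0 then 0 else nb (w (m' 8 0 - 1))) \<and>
      (\<forall>i. m' 21 i = (if i < Ld then d ! i else 0)) \<and> (\<forall>i. m' 22 i = (if i < m' 8 0 then w i else 0))" for m' :: memory and out'
  have fin: "wp fin 4 ?Q m' out'" if I: "I2 m' out'" and e: "m' 9 0 = 0" for m' out'
  proof -
    have 0: "m' 0 1 = length h" "\<And>i. m' 20 i = 0" "m' 3 0 = 0" "\<And>a i. 23 \<le> a \<Longrightarrow> m' a i = 0"
      using I z by (auto simp: I2_def agree_def move_input_def)
    have m': "m' 8 0 = length h" "m' 4 0 = 1" "m' 6 0 = Ld" "m' 11 0 = nb (last (lift h))" "out' = out"
    proof -
      have "lift h \<noteq> []" using h(1) length_lift[of h] by (metis length_0_conv)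
      then have "last (lift h) = w (length h - 1)" using h(1) lift[of "length h - 1"] by (simp add: last_conv_nth)
      then show "m' 8 0 = length h" "m' 4 0 = 1" "m' 6 0 = Ld" "m' 11 0 = nb (last (lift h))" "out' = out"
        using I e h(1) by (auto simp: I2_def)
    qed
    have "put (put (put (put m' 8 0 0) 20 0 Ld) 9 0 (length h)) 20 1 (length h) (20 + a) = move_input d (lift h) a" for a
    proof
      fix i
      consider "a = 0" | "a = 1" | "a = 2" | "3 \<le> a" by linarith
      then show "put (put (put (put m' 8 0 0) 20 0 Ld) 9 0 (length h)) 20 1 (length h) (20 + a) i = move_input d (lift h) a i"
      proof cases
        case 1
        then show ?thesis using 0(2) by (simp add: put_apply move_input_def Ld_def)
      next
        case 2
        then show ?thesis using I by (simp add: put_apply move_input_def I2_def Ld_def)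
      next
        case 3
        then show ?thesis using I m'(1) lift by (simp add: put_apply move_input_def I2_def)
      next
        case 4
        then show ?thesis using 0(4) by (simp add: put_apply move_input_def)
      qed
    qed
    then show ?thesis using m' 0(1,3) unfolding fin_def by (simp add: wps put_apply)
  qed
  have lp: "wp (While 9 lft) (length h * 8 + 1) (wp fin 4 ?Q) m' out'" if I: "I2 m' out'" and e: "m' 8 0 = 0" for m' out'
  proof (rule wp_While[where I = I2 and \<mu> = "\<lambda>m. m 9 0" and k = 7])
    show "I2 m' out'" by fact
    show "wp lft 7 (\<lambda>m2 out2. I2 m2 out2 \<and> m2 9 0 < m1 9 0) m1 out1" if I: "I2 m1 out1" and pos: "m1 9 0 \<noteq> 0" for m1 out1
    proof -
      define i where "i = m1 8 0"
      have i: "i < length h" "m1 8 0 = i" using I pos by (auto simp: I2_def i_def)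
      have m2: "m1 2 i = h ! i" "m1 (Suc 0) (w i + Ld) = nb (w i)" "m1 4 0 = 1" "m1 6 0 = Ld"
        using I i w[OF i(1)] by (auto simp: I2_def agree_def move_input_def nth_append Ld_def)
      have wi: "h ! i + m1 11 0 = w i" using I i by (cases i) (auto simp: I2_def w_def)
      define m4 where "m4 = put (put (put (put (put m1 22 i (w i)) 10 0 (w i + Ld)) 11 0 (nb (w i))) 8 0 (Suc i)) 9 0 (m1 9 0 - 1)"
      have "I2 m4 out1" using I pos i unfolding I2_def by (auto simp: m4_def put_apply less_Suc_eq)
      moreover have "put (put (put (put (put (put (put m1 10 0 (h ! i)) 10 0 (w i)) 22 i (w i)) 10 0 (w i + Ld)) 11 0 (nb (w i))) 8 0 (Suc i)) 9 0 (m1 9 0 - 1) = m4"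
        by (intro ext) (simp add: m4_def put_apply)
      moreover have "m4 9 0 < m1 9 0" using pos by (simp add: m4_def put_apply)
      ultimately show ?thesis unfolding lft_def by (simp add: wps put_apply i m2 wi)
    qed
    show "m' 9 0 * (7 + 1) + 1 \<le> length h * 8 + 1" using I e by (simp add: I2_def)
  qed (rule fin)
  define rest where "rest = Seq (Const 8 0) (Seq (Load 9 0 4) (Seq (Const 11 0) (Seq (While 9 lft) fin)))"
  define I1 where "I1 m' out' \<longleftrightarrow> out' = out \<and> agree {4, 5, 6, 7, 8, 9, 10, 21} ?m m' \<and> m' 4 0 = 1 \<and> m' 6 0 = Ld \<and>
      m' 8 0 + m' 9 0 = Ld \<and>
      (\<forall>i. m' 21 i = (if i < m' 8 0 then d ! i else 0))" for m' :: memory and out'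
  have rest: "wp rest (length h * 8 + 9) ?Q m' out'" if I: "I1 m' out'" and e: "m' 9 0 = 0" for m' out'
  proof -
    define m2 where "m2 = put (put (put m' 8 0 0) 9 0 (length h)) 11 0 0"
    have 0: "m' 0 1 = length h" "\<And>i. m' 22 i = 0" "m' 4 0 = 1"
      using I z by (auto simp: I1_def agree_def move_input_def)
    have "agree {4, 5, 6, 7, 8, 9, 10, 11, 21, 22} ?m m'" using I by (auto simp: I1_def elim: agree_mono)
    then have "I2 m2 out'" using I e 0 unfolding I1_def I2_def by (auto simp: m2_def put_apply)
    moreover have "m2 8 0 = 0" by (simp add: m2_def put_apply)
    ultimately have "wp (Seq (While 9 lft) fin) (length h * 8 + 5) ?Q m2 out'"
      by (intro wp_Seq[OF lp]) auto
    then show ?thesis unfolding rest_def using 0 by (simp add: wps put_apply m2_def wp_le)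
  qed
  have "wp (While 9 copy) (Ld * (4 + 1) + 1) (wp rest (length h * 8 + 9) ?Q) m1 out"
  proof (rule wp_While[where I = I1 and \<mu> = "\<lambda>m. m 9 0" and k = 4])
    show "I1 m1 out" using z by (simp add: I1_def m1_def put_apply)
    show "wp copy 4 (\<lambda>m2 out2. I1 m2 out2 \<and> m2 9 0 < m' 9 0) m' out'" if I: "I1 m' out'" and pos: "m' 9 0 \<noteq> 0" for m' out'
    proof -
      define i where "i = m' 8 0"
      have i: "i < Ld" "m' 8 0 = i" using I pos by (auto simp: I1_def i_def)
      have "m' 1 i = d ! i" "m' 4 0 = 1"
        using I i by (auto simp: I1_def agree_def move_input_def nth_append Ld_def)
      then show ?thesis using I pos i unfolding copy_def I1_def by (auto simp: wps put_apply less_Suc_eq)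
    qed
    show "m1 9 0 * (4 + 1) + 1 \<le> Ld * (4 + 1) + 1" by (simp add: m1_def put_apply)
  qed (rule rest)
  then have "wp (Seq (While 9 copy) rest) (Ld * 5 + length h * 8 + 10) ?Q m1 out"
    by (rule wp_Seq) simp
  moreover have "put (put (put (put (put (put (put ?m 4 0 1) 7 0 (Ld + N)) 5 0 N) 6 0 Ld) 8 0 0) 9 0 0) 9 0 Ld = m1"
    by (intro ext) (simp add: m1_def put_apply)
  moreover have "?m 0 0 = Suc (Ld + N)" "?m 1 (Ld + N) = N"
    by (simp_all add: move_input_def Ld_def nth_append)
  ultimately have "wp lift_prog (Ld * 5 + length h * 8 + 17) ?Q ?m out"
    unfolding lift_prog_def copy_def[symmetric] lft_def[symmetric] fin_def[symmetric] rest_def[symmetric]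
    by (simp add: wps put_apply add.commute add.left_commute)
  then show ?thesis ..
qed

lemma describes_project:
  assumes nN: "n \<le> N" and \<sigma>': "strategy safe_game (boxes safe_game) \<sigma>'" and q: "describes q d safe_game \<sigma>'"
  shows "describes (strategy_prog q) (description d) G (project \<sigma>')"
  unfolding describes_def
proof (intro allI impI)
  fix h w assume hw: "set h \<subseteq> states G \<and> w \<in> boxes G"
  let ?h = "h @ [w]"
  have hn: "set ?h \<subseteq> {..<n}" using hw game states_G by (auto simp: game_def)
  obtain v where v: "lift ?h = lift h @ [v]" using lift_snoc by blast
  have "set (lift ?h) \<subseteq> {..<N}" "map st (lift ?h) = ?h" using set_lift[OF hn nN] .
  then have "set (lift h) \<subseteq> states safe_game" "v \<in> boxes safe_game"
    using v hw set_lift[of h] hn nN by auto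
  with q v obtain t m1 where ex: "exec q (move_input d (lift ?h), []) t (m1, [\<sigma>' (lift ?h)])"
    unfolding describes_def by metis
  obtain T where "wp lift_prog T (\<lambda>m' out'. out' = [] \<and> (\<forall>a. m' (20 + a) = move_input d (lift ?h) a) \<and>
    m' 11 0 = nb (last (lift ?h)) \<and> m' 3 0 = 0) (move_input (description d) ?h) []"
    using wp_lift_prog[of ?h "[]" d] hn nN by auto
  then obtain t0 M0 where M0: "exec lift_prog (move_input (description d) ?h, []) t0 (M0, [])"
    "\<And>a. M0 (20 + a) = move_input d (lift ?h) a" "M0 11 0 = nb (last (lift ?h))" "M0 3 0 = 0"
    unfolding wp_def by auto
  have "inj ((+) (20::nat))" "3 \<notin> range ((+) (20::nat))" by auto
  from exec_relocate[OF this ex refl refl, where M = M0 and Out = "[]" and e = False] M0(2) obtain t1 M1 Out1 where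
    M1: "exec (relocate False 3 ((+) 20) q) (M0, []) t1 (M1, Out1)"
    "relocated False 3 ((+) 20) (move_input d (lift ?h)) [] M0 [] m1 [\<sigma>' (lift ?h)] M1 Out1" by blast
  have "11 \<notin> range ((+) (20::nat))" by auto
  then have 1: "M1 11 0 = nb (last (lift ?h))" "M1 3 0 = \<sigma>' (lift ?h)" "Out1 = []"
    using M1(2) M0(3,4) unfolding relocated_def by auto
  have "exec (Seq (Sub 3 3 11) (Print 3)) (M1, []) (1 + 1) (put M1 3 0 (project \<sigma>' ?h), [project \<sigma>' ?h])"
    by (auto simp: exec_Seq exec_prim 1 project_def put_apply)
  from exec.Seq[OF M0(1) exec.Seq[OF M1(1)[unfolded 1(3)] this]] have "exec (strategy_prog q) (move_input (description d) ?h, []) (t0 + (t1 + (1 + 1)))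
    (put M1 3 0 (project \<sigma>' ?h), [project \<sigma>' ?h])"
    unfolding strategy_prog_def .
  then show "\<exists>t m. exec (strategy_prog q) (move_input (description d) (h @ [w]), []) t (m, [project \<sigma>' (h @ [w])])"
    by blast
qed

end

section \<open>The solver\<close>

definition print_tables :: prog where
  "print_tables = Seq (Const 9 0) (Seq (Const 27 0) (Seq (Add 27 27 6)
     (Seq (While 27 (Seq (Load 15 2 9) (Seq (Print 15) (Seq (Add 9 9 19) (Sub 27 27 19))))) (Print 6))))"

lemma wp_print_tables:
  assumes m: "m 6 0 = N" "m 19 0 = 1"
  shows "wp print_tables (N * 5 + 6) (\<lambda>m' out'. out' = out @ map (m 2) [0..<N] @ [N]) m out"
proof -
  define I where "I m' out' \<longleftrightarrow> agree {9, 15, 27} m m' \<and> m' 9 0 + m' 27 0 = N \<and> out' = out @ map (m 2) [0..<m' 9 0]" for m' :: memory and out'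
  have "wp (While 27 (Seq (Load 15 2 9) (Seq (Print 15) (Seq (Add 9 9 19) (Sub 27 27 19))))) (N * (4 + 1) + 1)
    (wp (Print 6) 1 (\<lambda>m' out'. out' = out @ map (m 2) [0..<N] @ [N])) (put (put m 9 0 0) 27 0 N) out"
  proof (rule wp_While[where I = I and \<mu> = "\<lambda>m. m 27 0" and k = 4], goal_cases)
    case (2 m1 out1)
    then have "m1 19 0 = 1" "m1 2 = m 2" using m by (auto simp: I_def agreeD_fun)
    with 2 show ?case by (auto simp: wps put_apply I_def)
  next
    case (3 m1 out1)
    then show ?case using m by (auto simp: wps I_def agree_def)
  qed (auto simp: I_def put_apply)
  then have "wp (Seq (While 27 (Seq (Load 15 2 9) (Seq (Print 15) (Seq (Add 9 9 19) (Sub 27 27 19))))) (Print 6)) (N * 5 + 2)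
    (\<lambda>m' out'. out' = out @ map (m 2) [0..<N] @ [N]) (put (put m 9 0 0) 27 0 N) out"
    by (rule wp_Seq) simp
  moreover have "put (put (put m 9 0 0) 27 0 0) 27 0 N = put (put m 9 0 0) 27 0 N"
    by (intro ext) (simp add: put_apply)
  ultimately show ?thesis unfolding print_tables_def using m by (simp add: wps put_apply wp_le)
qed

text \<open>The given solver finds its game in the arrays 40 to 44 and the reward vectors in their original
  place, input array 5.\<close>

definition inner_place :: "nat \<Rightarrow> nat \<Rightarrow> nat" where
  "inner_place L a = (if a < 5 then 40 + a else if a = 5 then 65 else 60 + L + a)"

text \<open>The relocated solver prints its own answer, and the sum in scalar 45 reveals it: 0 for
  \<open>[0]\<close>, positive for \<open>1 # d\<close>. In the latter case the monitor table is
  appended, which completes the description.\<close>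

definition solver :: "prog \<Rightarrow> nat \<Rightarrow> window list \<Rightarrow> prog" where
  "solver p L ws = Seq (tables_prog ws) (Seq attractor_prog
     (Seq (Const 15 1) (Seq (Load 15 60 15) (Seq (Load 16 3 15)
     (If 16 (Seq (Const 15 0) (Print 15))
        (Seq build_prog (Seq (relocate True 45 (inner_place L) p) (If 45 print_tables Skip))))))))"

text \<open>Position \<open>66 + L\<close> is left out: there \<open>relocate\<close> accumulates the output.\<close>

definition outer_place :: "nat \<Rightarrow> nat \<Rightarrow> nat" where
  "outer_place L a = (if a < 60 then 6 + L + a else if a < 66 + L then a - 60 else Suc a)"

lemma inj_inner_place: "inj (inner_place L)" "45 \<notin> range (inner_place L)"
  by (auto simp: inj_def inner_place_def split: if_splits)

lemma inj_outer_place: "inj (outer_place L)" "66 + L \<notin> range (outer_place L)"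
  by (auto simp: inj_def outer_place_def split: if_splits)

text \<open>The body of \<open>solvable_within\<close> with both programs as parameters, so that
  they can be named when the new programs are built from them.\<close>

definition solves :: "nat set \<Rightarrow> nat list \<Rightarrow> (nat game \<Rightarrow> nat reward \<Rightarrow> nat reward list \<Rightarrow> (nat \<Rightarrow> nat) set) \<Rightarrow>
    (nat game \<Rightarrow> nat reward \<Rightarrow> nat reward list \<Rightarrow> real) \<Rightarrow> prog \<Rightarrow> prog \<Rightarrow> bool" where
  "solves K ks \<Phi> T p q \<longleftrightarrow> (\<forall>G s \<rho> \<rho>s m.
        game G \<and> finite (states G) \<and> s \<in> states G \<and>
        reward_function G \<rho> \<and> rdim \<rho> \<in> K \<and>
        (\<forall>\<rho>' \<in> set \<rho>s. reward_function G \<rho>') \<and> map rdim \<rho>s = ks \<and>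
        represents m G s (\<rho> # \<rho>s)
        \<longrightarrow> (\<exists>t m' out.
              exec p (m, []) t (m', out) \<and> real t \<le> T G \<rho> \<rho>s \<and>
              (if winning G (\<Phi> G \<rho> \<rho>s) s = {} then out = [0]
               else \<exists>d. out = 1 # d \<and> (\<exists>\<sigma> \<in> winning G (\<Phi> G \<rho> \<rho>s) s. describes q d G \<sigma>))))"

lemma wp_exec:
  assumes "wp p T (\<lambda>m' out'. out' = out \<and> R m') m out"
  obtains t m' where "exec p (m, out) t (m', out)" "t \<le> T" "R m'"
  using assms unfolding wp_def by blast

text \<open>\<open>tp\<close> is the time spent in the given solver, and 0 if it is not called.\<close>

lemma solver_run:
  assumes p: "solves K [] (\<lambda>G \<rho> \<rho>s. reward_objective \<Psi> G \<rho>) (\<lambda>G \<rho> \<rho>s. T G \<rho>) p q"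
    and G: "game G" "states G = {..<n}" "s < n" and \<rho>: "reward_function G \<rho>" "rdim \<rho> \<in> K"
    and ws: "\<forall>w\<in>set ws. window w" and \<rho>s: "\<forall>\<rho>'\<in>set \<rho>s. reward_function G \<rho>'" "map rdim \<rho>s = map win_dim ws"
    and M60: "M 60 0 = n" "M 60 1 = s" "M 60 2 = rdim \<rho>"
    and M61: "\<forall>v<n. M 61 v = (if v \<in> boxes G then 1 else 0)"
    and M62: "\<forall>v<n. M 62 v \<le> M 62 (Suc v) \<and> distinct (map (M 63) [M 62 v..<M 62 (Suc v)]) \<and>
        set (map (M 63) [M 62 v..<M 62 (Suc v)]) = {w. (v, w) \<in> edges G}"
    and M64: "\<forall>v<n. map (\<lambda>i. M 65 (M 64 v + i)) [0..<rdim \<rho>] = rew \<rho> v"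
    and M66: "\<forall>i<length ws. reads_reward M n i (\<rho>s ! i)"
    and M0: "\<And>a i. a < 60 \<or> 66 + 2 * length ws \<le> a \<Longrightarrow> M a i = 0"
  defines "Mo \<equiv> M_of G ws \<rho>s"
    and "\<Phi> \<equiv> multi_objective G ws \<rho>s \<inter> reward_objective \<Psi> G \<rho>"
  shows "\<exists>G' \<rho>' t tp M' out. exec (solver p (2 * length ws) ws) (M, []) t (M', out) \<and>
    t \<le> (setup_constant (map win_dim ws) + 200) * (n * n * card (edges G) * Mo\<^sup>2) + 2 * tp \<and>
    (tp = 0 \<or> real tp \<le> T G' \<rho>') \<and> card (states G') \<le> n * Mo \<and> card (edges G') \<le> card (edges G) * Mo \<and>
    max_reward G' \<rho>' = max_reward G \<rho> \<and> rdim \<rho>' = rdim \<rho> \<and>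
    (if winning G \<Phi> s = {} then out = [0]
     else \<exists>d. out = 1 # d \<and> (\<exists>\<sigma> \<in> winning G \<Phi> s. describes (strategy_prog q) d G \<sigma>))"
proof -
  let ?L = "2 * length ws"
  define N where "N = n * Mo"
  define c where "c = setup_constant (map win_dim ws)"
  define X where "X = n * n * card (edges G) * Mo\<^sup>2"
  have n: "0 < n" using G(3) by simp
  have Mo: "0 < Mo" using M_of_pos[OF ws] by (simp add: Mo_def)
  have N: "0 < N" "n \<le> N" using n Mo by (simp_all add: N_def)
  have finE: "finite (edges G)"
    using G(1,2) by (auto simp: game_def intro: finite_subset[of _ "{..<n} \<times> {..<n}"])
  have nE: "n \<le> card (edges G)"
  proof -
    have "{..<n} \<subseteq> fst ` edges G"
    proof
      fix v assume "v \<in> {..<n}"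
      then obtain w where "(v, w) \<in> edges G" using G(1,2) unfolding game_def by blast
      then show "v \<in> fst ` edges G" by (rule image_eqI[rotated]) simp
    qed
    then have "card {..<n} \<le> card (fst ` edges G)" using finE by (intro card_mono) auto
    also have "\<dots> \<le> card (edges G)" using finE by (rule card_image_le)
    finally show ?thesis by simp
  qed
  have len: "length \<rho>s = length ws" using \<rho>s(2) by (metis length_map)
  have dims: "rdim (\<rho>s ! i) = win_dim (ws ! i)" if "i < length ws" for i
    using \<rho>s(2) that len by (metis nth_map)
  have \<rho>s': "\<forall>i<length ws. rdim (\<rho>s ! i) = win_dim (ws ! i) \<and> 0 < rdim (\<rho>s ! i) \<and> reads_reward M n i (\<rho>s ! i)"
  proof (intro allI impI conjI)
    fix i assume i: "i < length ws"
    then have "\<rho>s ! i \<in> set \<rho>s" using len by simp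
    then show "0 < rdim (\<rho>s ! i)" using \<rho>s(1) unfolding reward_function_def by blast
  qed (use dims M66 in blast)+
  have "wp (tables_prog ws) (c * (n * Mo\<^sup>2)) (\<lambda>m' out'. out' = [] \<and> (agree {1..19} M m' \<and> Mon n N
       (\<lambda>r. \<forall>i<length ws. \<forall>d<win_dim (ws ! i). sums_ok (ws ! i) (\<rho>s ! i) d r) m')) M []"
    unfolding c_def Mo_def N_def using M0 by (intro wp_tables_prog[OF G(2) n ws len \<rho>s' M60(1)]) auto
  then obtain t1 m1 where m1: "exec (tables_prog ws) (M, []) t1 (m1, [])" "t1 \<le> c * (n * Mo\<^sup>2)"
    "agree {1..19} M m1" "Mon n N (\<lambda>r. \<forall>i<length ws. \<forall>d<win_dim (ws ! i). sums_ok (ws ! i) (\<rho>s ! i) d r) m1"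
    by (auto elim!: wp_exec)
  have mt: "monitor_tables n N (m1 1) (m1 2)" using m1(4) by (simp add: Mon_def)
  \<comment> \<open>The tables and flags are frozen at this point, because the attractor computation
    is about to overwrite array 3.\<close>
  define ST where "ST = m1 1"
  define NB where "NB = m1 2"
  define bd where "bd v \<longleftrightarrow> m1 3 v \<noteq> 0" for v
  interpret monitored G n N ST NB bd
    using G mt by unfold_locales (auto simp: monitor_tables_def ST_def NB_def)
  have rg1: "reads_game m1"
    unfolding reads_game_def using m1(3,4) M60 M61 M62 by (simp add: agreeD_fun Mon_def ST_def NB_def)
  have \<Delta>: "r \<in> multi_objective G ws \<rho>s \<longleftrightarrow> (\<forall>t. \<not> bd (track NB r t))" if r: "r \<in> runs G" for r
  proof -
    have "\<forall>t. r t < n" using r G(2) by (auto simp: runs_def)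
    then have "(\<forall>t. m1 3 (track (m1 2) r t) = 0) \<longleftrightarrow> (\<forall>i<length ws. \<forall>d<win_dim (ws ! i). sums_ok (ws ! i) (\<rho>s ! i) d r)"
      using m1(4) by (simp add: Mon_def)
    moreover have "window (ws ! i)" if "i < length ws" for i using ws that by simp
    ultimately show ?thesis
      using r by (simp add: multi_objective_def window_objective_iff bd_def NB_def)
  qed
  let ?\<rho> = "lifted_reward \<rho>"
  have prems: "n \<le> N" "s < n" "\<And>r. r \<in> runs G \<Longrightarrow> r \<in> multi_objective G ws \<rho>s \<longleftrightarrow> (\<forall>t. \<not> bd (track NB r t))"
    using N G(3) \<Delta> by blast+
  note wei = winning_empty_iff[where \<Delta> = "multi_objective G ws \<rho>s" and s = s and \<rho> = \<rho> and \<Psi> = \<Psi>, OF prems, folded \<Phi>_def]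
  have "wp attractor_prog (80 * (N * N * n)) (\<lambda>m' out'. out' = [] \<and> (agree pass_arrays m1 m' \<and>
     (\<forall>v<N. m' 3 v \<noteq> 0 \<longleftrightarrow> attr v))) m1 []"
    by (rule wp_attractor_prog[OF rg1 _ N(1)]) (simp add: bd_def)
  then obtain t2 m2 where m2: "exec attractor_prog (m1, []) t2 (m2, [])" "t2 \<le> 80 * (N * N * n)"
    "agree pass_arrays m1 m2" "\<forall>v<N. m2 3 v \<noteq> 0 \<longleftrightarrow> attr v" by (auto elim!: wp_exec)
  have rg2: "reads_game m2"
    using rg1 reads_game_agree[OF m2(3)] by (simp add: pass_arrays_def)
  have keep2: "m2 a = M a" if "60 \<le> a" for a
    using m1(3) m2(3) that by (simp add: agreeD_fun pass_arrays_def)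
  have keep2z: "m2 a i = 0" if "25 \<le> a" "a < 60" for a i
    using m1(3) m2(3) that M0[of a i] by (simp add: agree_def pass_arrays_def)
  define k1 where "k1 = If 16 (Seq (Const 15 0) (Print 15))
        (Seq build_prog (Seq (relocate True 45 (inner_place ?L) p) (If 45 print_tables Skip)))"
  define m2' where "m2' = put (put m2 15 0 s) 16 0 (m2 3 s)"
  have ld: "exec (Seq (Const 15 1) (Seq (Load 15 60 15) (Seq (Load 16 3 15) k1))) (m2, []) (1 + (1 + (1 + t))) (M', out)"
    if "exec k1 (m2', []) t (M', out)" for t M' out
  proof -
    have eq: "put (put (put m2 15 0 1) 15 0 s) 16 0 (m2 3 s) = m2'" by (intro ext) (simp add: m2'_def put_apply)
    have 60: "m2 60 1 = s" using keep2 M60 by simp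
    have "exec (Load 16 3 15) (put (put m2 15 0 1) 15 0 s, []) 1 (m2', [])"
      by (simp add: exec_prim put_apply eq[symmetric])
    moreover have "exec (Load 15 60 15) (put m2 15 0 1, []) 1 (put (put m2 15 0 1) 15 0 s, [])"
      using 60 by (simp add: exec_prim put_apply)
    moreover have "exec (Const 15 1) (m2, []) 1 (put m2 15 0 1, [])" by (simp add: exec_prim)
    ultimately show ?thesis using that by (blast intro: exec.Seq)
  qed
  have run: "exec (solver p ?L ws) (M, []) (t1 + (t2 + (1 + (1 + (1 + t))))) (M', out)"
    if "exec k1 (m2', []) t (M', out)" for t M' out
    unfolding solver_def k1_def[symmetric] using m1(1) m2(1) ld[OF that] by (blast intro: exec.Seq)
  \<comment> \<open>The attractor costs \<open>N * N * n\<close>, which is the cube of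
    \<open>n\<close> times the square of \<open>Mo\<close>; bounding one factor \<open>n\<close> by
    the number of edges gives \<open>X\<close>. The tables, the construction of the safe game and
    the printing cost no more.\<close>
  have X: "n * Mo\<^sup>2 \<le> X" "N * N * n \<le> X" "N * n \<le> X" "1 \<le> X" "N \<le> X"
  proof -
    have E: "1 \<le> card (edges G)" using nE n by simp
    have "1 * (n * Mo\<^sup>2) * 1 \<le> n * (n * Mo\<^sup>2) * card (edges G)" using n E by (intro mult_le_mono) auto
    then show "n * Mo\<^sup>2 \<le> X" by (simp add: X_def mult.commute mult.left_commute)
    have "n * n * n * Mo\<^sup>2 \<le> n * n * card (edges G) * Mo\<^sup>2" using nE by simp
    then show NNn: "N * N * n \<le> X" by (simp add: X_def N_def power2_eq_square mult.commute mult.left_commute)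
    have "1 * (N * n) \<le> N * (N * n)" using N by (intro mult_le_mono1) simp
    moreover have "N * (N * n) = N * N * n" by simp
    ultimately show Nn: "N * n \<le> X" using NNn by linarith
    have "N * 1 \<le> N * n" using n by (intro mult_le_mono2) simp
    then show "N \<le> X" using Nn by linarith
    then show "1 \<le> X" using N by simp
  qed
  have t12: "t1 + t2 \<le> c * X + 80 * X"
    using m1(2) m2(2) X(2) mult_le_mono2[OF X(1), of c] by linarith
  have cX: "(c + 200) * X = c * X + 200 * X" by (simp add: add_mult_distrib)
  have card: "card (states safe_game) \<le> n * Mo" "card (edges safe_game) \<le> card (edges G) * Mo"
    using card_edges_safe_game[OF N_def] safe_game_sel(1) card_lessThan[of N] N_def by (metis order_refl)+
  have rw: "max_reward safe_game ?\<rho> = max_reward G \<rho>" "rdim ?\<rho> = rdim \<rho>"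
    by (rule max_lifted_reward[OF N(2)]) (simp only: lifted_reward_def fst_conv)
  have sN: "s < N" using N G by simp
  show ?thesis
  proof (cases "attr s")
    case True
    then have "m2 3 s \<noteq> 0" using m2(4) sN by blast
    then have "exec k1 (m2', []) (Suc (1 + 1)) (put m2' 15 0 0, [0])"
      unfolding k1_def by (intro exec.If_True) (auto simp: m2'_def put_apply exec_Seq exec_prim)
    from run[OF this] have e: "exec (solver p ?L ws) (M, []) (t1 + (t2 + (1 + (1 + (1 + Suc (1 + 1)))))) (put m2' 15 0 0, [0])" .
    have "t1 + (t2 + (1 + (1 + (1 + Suc (1 + 1))))) \<le> (c + 200) * X + 2 * 0"
      using t12 cX X by linarith
    moreover have "winning G \<Phi> s = {}" using wei True by blast
    ultimately show ?thesis using e card rw unfolding c_def X_def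
      by (intro exI[of _ safe_game] exI[of _ ?\<rho>] exI[of _ "t1 + (t2 + (1 + (1 + (1 + Suc (1 + 1)))))"] exI[of _ 0]
        exI[of _ "put m2' 15 0 0"] exI[of _ "[0]"]) simp
  next
    case False
    then have z: "m2 3 s = 0" using m2(4) sN by blast
    have ag2: "agree {15, 16} m2 m2'" by (simp add: m2'_def)
    have rg2': "reads_game m2'" using rg2 reads_game_agree[OF ag2] by simp
    have "\<And>v. v < N \<Longrightarrow> m2' 3 v \<noteq> 0 \<longleftrightarrow> attr v" using m2(4) by (simp add: m2'_def put_apply)
    then have "wp build_prog (50 * (N * n)) (\<lambda>m' out'. out' = [] \<and> (agree build_arrays m2' m' \<and> built m2' m' N \<and>
       m' 40 0 = N \<and> m' 40 1 = m2' 60 1 \<and> m' 40 2 = m2' 60 2)) m2' []"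
      by (intro wp_build_prog[OF rg2' _ N(1)]) auto
    then obtain t3 m3 where m3: "exec build_prog (m2', []) t3 (m3, [])" "t3 \<le> 50 * (N * n)" "agree build_arrays m2' m3"
      "built m2' m3 N" "m3 40 0 = N" "m3 40 1 = m2' 60 1" "m3 40 2 = m2' 60 2" by (auto elim!: wp_exec)
    have m2'60: "m2' a = M a" if "60 \<le> a" for a using keep2[OF that] that ag2 by (simp add: agreeD_fun)
    have m3_60: "m3 a = M a" if "60 \<le> a" for a using m2'60[OF that] that m3(3) by (simp add: agreeD_fun build_arrays_def)
    have m3_45: "m3 45 0 = 0" using keep2z[of 45 0] ag2 m3(3) by (simp add: agree_def build_arrays_def)
    have m3_t: "m3 6 0 = N" "m3 19 0 = 1" "\<And>v. v < N \<Longrightarrow> m3 2 v = NB v"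
      using rg2' m3(3) by (auto simp: agreeD_fun build_arrays_def reads_game_def)
    \<comment> \<open>The memory as the given solver sees it. Apart from the five arrays built above
      and the reward vectors, it consists of arrays behind the input, which are still zero.\<close>
    define P where "P a = m3 (inner_place ?L a)" for a
    have P: "P 0 = m3 40" "P 1 = m3 41" "P 2 = m3 42" "P 3 = m3 43" "P 4 = m3 44" "P 5 = m3 65"
      by (simp_all add: P_def inner_place_def)
    have rep: "represents P safe_game s [?\<rho>]"
      unfolding represents_def
    proof (intro conjI allI impI ballI)
      show "states safe_game = {..<P 0 0}" by (simp add: P m3)
      show "P 0 1 = s" using m3(6) m2'60 M60 by (simp add: P)
      show "P 0 (2 + j) = rdim ([?\<rho>] ! j)" if "j < length [?\<rho>]" for j
        using that m3(7) m2'60 M60 by (simp add: P lifted_reward_def)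
      show "P 2 0 = 0" using m3(4) by (simp add: P built_def)
      show "P a i = 0" if "4 + 2 * length [?\<rho>] \<le> a" for a i
        using that m3_60 M0 by (simp add: P_def inner_place_def)
      fix v assume "v \<in> states safe_game"
      then have v: "v < N" by simp
      then show "P 1 v = (if v \<in> boxes safe_game then 1 else 0)" "P 2 v \<le> P 2 (Suc v)"
        "distinct (map (P 3) [P 2 v..<P 2 (Suc v)])"
        "set (map (P 3) [P 2 v..<P 2 (Suc v)]) = {w. (v, w) \<in> edges safe_game}"
        using m3(4) unfolding P built_def by (simp_all del: set_map)
      show "map (\<lambda>i. P (5 + 2 * j) (P (4 + 2 * j) v + i)) [0..<rdim ([?\<rho>] ! j)] = rew ([?\<rho>] ! j) v"
        if "j < length [?\<rho>]" for j
      proof -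
        have "m3 44 v = M 64 (ST v)" using m3(4) v m2'60 by (simp add: built_def)
        then show ?thesis using that M64 st_less[OF v] m3_60 by (simp add: P lifted_reward_def)
      qed
    qed
    have "game safe_game" using game_safe_game[OF N(1)] .
    moreover have "reward_function safe_game ?\<rho>"
      using \<rho>(1) st_less G(2) by (auto simp: reward_function_def lifted_reward_def)
    moreover have "finite (states safe_game)" "s \<in> states safe_game" "rdim ?\<rho> \<in> K"
      using sN \<rho>(2) by (simp_all add: lifted_reward_def)
    ultimately obtain tp mp outp where tp: "exec p (P, []) tp (mp, outp)" "real tp \<le> T safe_game ?\<rho>"
      "if winning safe_game (reward_objective \<Psi> safe_game ?\<rho>) s = {} then outp = [0]
       else \<exists>d. outp = 1 # d \<and> (\<exists>\<sigma> \<in> winning safe_game (reward_objective \<Psi> safe_game ?\<rho>) s. describes q d safe_game \<sigma>)"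
      using p rep unfolding solves_def by (metis empty_iff list.set(1) list.map(1))
    from exec_relocate[OF inj_inner_place tp(1) refl refl, of m3 ?L True "[]"] obtain t4 m4 out4 where
      m4: "t4 \<le> 2 * tp" "exec (relocate True 45 (inner_place ?L) p) (m3, []) t4 (m4, out4)"
      "relocated True 45 (inner_place ?L) P [] m3 [] mp outp m4 out4" by (auto simp: P_def)
    have out4: "out4 = outp" "m4 45 0 = sum_list outp" using m4(3) m3_45 by (auto simp: relocated_def)
    have "a \<notin> range (inner_place ?L)" if "a < 40" for a
      using that by (auto simp: inner_place_def split: if_splits)
    then have m4_t: "m4 a = m3 a" if "a < 40" for a
      using m4(3) that by (auto simp: relocated_def)
    have k1: "exec k1 (m2', []) (Suc (t3 + (t4 + t))) (M', out)"
      if "exec (If 45 print_tables Skip) (m4, outp) t (M', out)" for t M' out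
    proof -
      have "m2' 16 0 = 0" using z by (simp add: m2'_def put_apply)
      moreover have "exec (Seq build_prog (Seq (relocate True 45 (inner_place ?L) p) (If 45 print_tables Skip)))
          (m2', []) (t3 + (t4 + t)) (M', out)"
        using m3(1) m4(2)[unfolded out4(1)] that by (blast intro: exec.Seq)
      ultimately show ?thesis unfolding k1_def by (rule exec.If_False)
    qed
    show ?thesis
    proof (cases "winning safe_game (reward_objective \<Psi> safe_game ?\<rho>) s = {}")
      case True
      then have "outp = [0]" using tp(3) by simp
      then have "exec (If 45 print_tables Skip) (m4, outp) (Suc 1) (m4, [0])"
        using out4(2) by (simp add: exec_If exec_prim)
      from run[OF k1[OF this]]
      have e: "exec (solver p ?L ws) (M, []) (t1 + (t2 + (1 + (1 + (1 + Suc (t3 + (t4 + Suc 1))))))) (m4, [0])" .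
      have "t1 + (t2 + (1 + (1 + (1 + Suc (t3 + (t4 + Suc 1)))))) \<le> (c + 200) * X + 2 * tp"
        using t12 cX X m3(2) m4(1) by linarith
      moreover have "winning G \<Phi> s = {}" using wei True by blast
      ultimately show ?thesis using e card rw tp(2) unfolding c_def X_def
        by (intro exI[of _ safe_game] exI[of _ ?\<rho>] exI[of _ "t1 + (t2 + (1 + (1 + (1 + Suc (t3 + (t4 + Suc 1))))))"] exI[of _ tp]
          exI[of _ m4] exI[of _ "[0]"]) simp
    next
      case False': False
      then obtain d \<sigma> where d: "outp = 1 # d" "\<sigma> \<in> winning safe_game (reward_objective \<Psi> safe_game ?\<rho>) s"
        "describes q d safe_game \<sigma>" using tp(3) by auto
      have "project \<sigma> \<in> winning G \<Phi> s"
        unfolding \<Phi>_def by (rule project_winning[OF prems d(2) False])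
      moreover have "strategy safe_game (boxes safe_game) \<sigma>" using d(2) by (simp add: winning_def)
      note describes_project[OF N(2) this d(3)]
      moreover have "m4 6 0 = N" "m4 19 0 = 1" using m4_t m3_t by simp_all
      note pt = wp_print_tables[where m = m4 and N = N and out = outp, OF this]
      have "map (m4 2) [0..<N] = map NB [0..<N]" using m4_t m3_t(3) by auto
      with pt obtain t5 m5 where t5: "t5 \<le> N * 5 + 6" "exec print_tables (m4, outp) t5 (m5, outp @ map NB [0..<N] @ [N])"
        unfolding wp_def by auto
      have "m4 45 0 \<noteq> 0" using out4(2) d(1) by simp
      then have "exec (If 45 print_tables Skip) (m4, outp) (Suc t5) (m5, 1 # (d @ map NB [0..<N] @ [N]))"
        using t5(2) d(1) by (intro exec.If_True) auto
      from run[OF k1[OF this]]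
      have e: "exec (solver p ?L ws) (M, []) (t1 + (t2 + (1 + (1 + (1 + Suc (t3 + (t4 + Suc t5)))))))
         (m5, 1 # (d @ map NB [0..<N] @ [N]))" .
      moreover have "t1 + (t2 + (1 + (1 + (1 + Suc (t3 + (t4 + Suc t5)))))) \<le> (c + 200) * X + 2 * tp"
        using t12 cX X m3(2) m4(1) t5(1) by linarith
      ultimately show ?thesis using card rw tp(2) unfolding c_def X_def
        by (intro exI[of _ safe_game] exI[of _ ?\<rho>] exI[of _ "t1 + (t2 + (1 + (1 + (1 + Suc (t3 + (t4 + Suc t5))))))"] exI[of _ tp]
          exI[of _ m5] exI[of _ "1 # (d @ map NB [0..<N] @ [N])"]) auto
    qed
  qed
qed

theorem theorem2:
  fixes f :: "nat \<Rightarrow> nat \<Rightarrow> nat \<Rightarrow> nat \<Rightarrow> real"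
    and \<Psi> :: "(nat \<Rightarrow> nat list) set"
    and K :: "nat set"
    and ks :: "nat list"
  assumes "reward_based K \<Psi>"
    and "\<And>a b c d a' b' c' d'.
           a \<le> a' \<Longrightarrow> b \<le> b' \<Longrightarrow> c \<le> c' \<Longrightarrow> d \<le> d' \<Longrightarrow> f a b c d \<le> f a' b' c' d'"
    and "\<exists>C>0. solvable_within K []
           (\<lambda>G \<rho> \<rho>s. reward_objective \<Psi> G \<rho>)
           (\<lambda>G \<rho> \<rho>s. C * f (card (states G)) (card (edges G)) (max_reward G \<rho>) (rdim \<rho>))"
  shows "\<exists>C>0. \<forall>\<Delta>. (\<forall>w \<in> set \<Delta>. window w) \<and> map win_dim \<Delta> = ks \<longrightarrow>
           solvable_within K ks
             (\<lambda>G \<rho> \<rho>s. multi_objective G \<Delta> \<rho>s \<inter> reward_objective \<Psi> G \<rho>)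
             (\<lambda>G \<rho> \<rho>s. C * max
                (f (card (states G) * M_of G \<Delta> \<rho>s) (card (edges G) * M_of G \<Delta> \<rho>s)
                   (max_reward G \<rho>) (rdim \<rho>))
                (real ((card (states G))\<^sup>2 * card (edges G) * (M_of G \<Delta> \<rho>s)\<^sup>2)))"
proof -
  obtain C p q where C: "0 < C" and p: "solves K [] (\<lambda>G \<rho> \<rho>s. reward_objective \<Psi> G \<rho>)
      (\<lambda>G \<rho> \<rho>s. C * f (card (states G)) (card (edges G)) (max_reward G \<rho>) (rdim \<rho>)) p q"
    using assms(3) unfolding solvable_within_def solves_def by blast
  define c where "c = setup_constant ks + 200"
  \<comment> \<open>The outer relocation doubles everything, the inner one doubles the time of the
    given solver once more. Through \<open>setup_constant\<close> the value depends on the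
    dimensions \<open>ks\<close> and on \<open>C\<close>, but not on
    \<open>\<Delta>\<close>.\<close>
  define D where "D = real (2 * c) + 4 * C"
  have "0 < D" using C by (simp add: D_def)
  moreover have "solvable_within K ks
             (\<lambda>G \<rho> \<rho>s. multi_objective G \<Delta> \<rho>s \<inter> reward_objective \<Psi> G \<rho>)
             (\<lambda>G \<rho> \<rho>s. D * max
                (f (card (states G) * M_of G \<Delta> \<rho>s) (card (edges G) * M_of G \<Delta> \<rho>s)
                   (max_reward G \<rho>) (rdim \<rho>))
                (real ((card (states G))\<^sup>2 * card (edges G) * (M_of G \<Delta> \<rho>s)\<^sup>2)))"
    if \<Delta>: "(\<forall>w \<in> set \<Delta>. window w) \<and> map win_dim \<Delta> = ks" for \<Delta>
  proof -
    let ?L = "2 * length \<Delta>"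
    let ?p = "relocate True (66 + ?L) (outer_place ?L) (solver p ?L \<Delta>)"
    show ?thesis
      unfolding solvable_within_def
    proof (rule exI[of _ ?p], rule exI[of _ "strategy_prog q"], intro allI impI, elim conjE)
      fix G s \<rho> \<rho>s m
      assume G: "game G" "finite (states G)" "s \<in> states G" and \<rho>: "reward_function G \<rho>" "rdim \<rho> \<in> K"
        and \<rho>s: "\<forall>\<rho>'\<in>set \<rho>s. reward_function G \<rho>'" "map rdim \<rho>s = ks" and rep: "represents m G s (\<rho> # \<rho>s)"
      define n where "n = m 0 0"
      have st: "states G = {..<n}" "s < n" using rep G(3) by (auto simp: represents_def n_def)
      have len: "length \<rho>s = length \<Delta>" using \<rho>s \<Delta> by (metis length_map)
      \<comment> \<open>The memory as the relocated program sees it: the input starts at array 60,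
        and the scratch arrays below are mapped behind the input, where the memory is zero.\<close>
      define M where "M a = m (outer_place ?L a)" for a
      have M_in: "M (60 + a) = m a" if "a < 6 + ?L" for a using that by (simp add: M_def outer_place_def)
      have M_out: "M a i = 0" if "a < 60 \<or> 66 + 2 * length \<Delta> \<le> a" for a i
        using that rep len by (auto simp: M_def outer_place_def represents_def)
      have M6: "M 60 = m 0" "M 61 = m 1" "M 62 = m 2" "M 63 = m 3" "M 64 = m 4" "M 65 = m 5"
        using M_in[of 0] M_in[of 1] M_in[of 2] M_in[of 3] M_in[of 4] M_in[of 5] by simp_all
      have rd: "reads_reward M n i (\<rho>s ! i)" if i: "i < length \<Delta>" for i
        unfolding reads_reward_def
      proof (intro allI impI)
        fix v k assume vk: "v < n" "k < rdim (\<rho>s ! i)"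
        have a: "M (66 + 2 * i) = m (6 + 2 * i)" "M (67 + 2 * i) = m (7 + 2 * i)"
          using M_in[of "6 + 2 * i"] M_in[of "7 + 2 * i"] i by simp_all
        have "\<forall>j < length (\<rho> # \<rho>s). \<forall>v \<in> states G.
            map (\<lambda>k. m (5 + 2 * j) (m (4 + 2 * j) v + k)) [0..<rdim ((\<rho> # \<rho>s) ! j)] = rew ((\<rho> # \<rho>s) ! j) v"
          using rep unfolding represents_def by blast
        from this[rule_format, of "Suc i" v]
        have "map (\<lambda>k. m (7 + 2 * i) (m (6 + 2 * i) v + k)) [0..<rdim (\<rho>s ! i)] = rew (\<rho>s ! i) v"
          using i len vk st by simp
        from this[symmetric] show "M (67 + 2 * i) (M (66 + 2 * i) v + k) = rew (\<rho>s ! i) v ! k"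
          unfolding a using vk by simp
      qed
      have "\<exists>(G' :: nat game) \<rho>' t tp M' out. exec (solver p ?L \<Delta>) (M, []) t (M', out) \<and>
        t \<le> (setup_constant (map win_dim \<Delta>) + 200) * (n * n * card (edges G) * (M_of G \<Delta> \<rho>s)\<^sup>2) + 2 * tp \<and>
        (tp = 0 \<or> real tp \<le> C * f (card (states G')) (card (edges G')) (max_reward G' \<rho>') (rdim \<rho>')) \<and>
        card (states G') \<le> n * M_of G \<Delta> \<rho>s \<and> card (edges G') \<le> card (edges G) * M_of G \<Delta> \<rho>s \<and>
        max_reward G' \<rho>' = max_reward G \<rho> \<and> rdim \<rho>' = rdim \<rho> \<and>
        (if winning G (multi_objective G \<Delta> \<rho>s \<inter> reward_objective \<Psi> G \<rho>) s = {} then out = [0]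
         else \<exists>d. out = 1 # d \<and> (\<exists>\<sigma> \<in> winning G (multi_objective G \<Delta> \<rho>s \<inter> reward_objective \<Psi> G \<rho>) s. describes (strategy_prog q) d G \<sigma>))"
      proof (rule solver_run[where T = "\<lambda>G \<rho>. C * f (card (states G)) (card (edges G)) (max_reward G \<rho>) (rdim \<rho>)"
          and ws = \<Delta> and \<rho>s = \<rho>s and M = M and n = n and s = s and G = G and \<rho> = \<rho> and K = K and p = p and q = q
          and \<Psi> = \<Psi>, OF p G(1) st \<rho>])
        show "M 60 2 = rdim \<rho>" using rep unfolding represents_def M6 by (metis add.right_neutral length_greater_0_conv list.distinct(1) nth_Cons_0)
        show "\<forall>v<n. map (\<lambda>i. M 65 (M 64 v + i)) [0..<rdim \<rho>] = rew \<rho> v"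
        proof (intro allI impI)
          fix v assume "v < n"
          have "\<forall>j < length (\<rho> # \<rho>s). \<forall>v \<in> states G.
            map (\<lambda>k. m (5 + 2 * j) (m (4 + 2 * j) v + k)) [0..<rdim ((\<rho> # \<rho>s) ! j)] = rew ((\<rho> # \<rho>s) ! j) v"
            using rep unfolding represents_def by blast
          from this[rule_format, of 0 v] show "map (\<lambda>i. M 65 (M 64 v + i)) [0..<rdim \<rho>] = rew \<rho> v"
            using \<open>v < n\<close> st M6 by simp
        qed
      qed (use \<Delta> \<rho>s rep st M6 rd M_out in \<open>auto simp: represents_def n_def\<close>)
      then obtain G' :: "nat game" and \<rho>' t tp M' out where t: "exec (solver p ?L \<Delta>) (M, []) t (M', out)"
        "t \<le> (setup_constant (map win_dim \<Delta>) + 200) * (n * n * card (edges G) * (M_of G \<Delta> \<rho>s)\<^sup>2) + 2 * tp"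
        "tp = 0 \<or> real tp \<le> C * f (card (states G')) (card (edges G')) (max_reward G' \<rho>') (rdim \<rho>')"
        and le: "card (states G') \<le> n * M_of G \<Delta> \<rho>s" "card (edges G') \<le> card (edges G) * M_of G \<Delta> \<rho>s"
        "max_reward G' \<rho>' = max_reward G \<rho>" "rdim \<rho>' = rdim \<rho>"
        and out: "if winning G (multi_objective G \<Delta> \<rho>s \<inter> reward_objective \<Psi> G \<rho>) s = {} then out = [0]
         else \<exists>d. out = 1 # d \<and> (\<exists>\<sigma> \<in> winning G (multi_objective G \<Delta> \<rho>s \<inter> reward_objective \<Psi> G \<rho>) s. describes (strategy_prog q) d G \<sigma>)"
        by blast
      from exec_relocate[OF inj_outer_place t(1) refl refl, of m ?L True "[]"] obtain t' m' out' where
        m': "t' \<le> 2 * t" "exec ?p (m, []) t' (m', out')" "relocated True (66 + ?L) (outer_place ?L) M [] m [] M' out m' out'"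
        by (auto simp: M_def)
      have out': "out' = out" using m'(3) by (auto simp: relocated_def)
      define F where "F = f (card (states G) * M_of G \<Delta> \<rho>s) (card (edges G) * M_of G \<Delta> \<rho>s) (max_reward G \<rho>) (rdim \<rho>)"
      define X where "X = (card (states G))\<^sup>2 * card (edges G) * (M_of G \<Delta> \<rho>s)\<^sup>2"
      have X: "n * n * card (edges G) * (M_of G \<Delta> \<rho>s)\<^sup>2 = X" by (simp add: X_def st power2_eq_square)
      define Y where "Y = max F (real X)"
      \<comment> \<open>If the given solver was not called, the right-hand side is still
        nonnegative, whatever the sign of \<open>f\<close>, because \<open>Y\<close> is at least
        \<open>real X\<close>.\<close>
      have "real tp \<le> C * Y"
      proof (cases "tp = 0")
        case True
        then show ?thesis using C by (simp add: Y_def le_max_iff_disj)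
      next
        case False
        then have "real tp \<le> C * f (card (states G')) (card (edges G')) (max_reward G' \<rho>') (rdim \<rho>')" using t(3) by simp
        \<comment> \<open>Monotonicity of \<open>f\<close> enters here, as the safe game may have
          fewer edges than the product bound allows.\<close>
        also have "\<dots> \<le> C * F"
          unfolding F_def using C le st by (intro mult_left_mono assms(2)) auto
        also have "\<dots> \<le> C * Y" using C by (intro mult_left_mono) (auto simp: Y_def)
        finally show ?thesis .
      qed
      moreover have "real t' \<le> 2 * (real c * real X + 2 * real tp)"
      proof -
        have "t' \<le> 2 * (c * X + 2 * tp)" using m'(1) t(2) \<Delta> X unfolding c_def by auto
        then have "real t' \<le> real (2 * (c * X + 2 * tp))" by (rule of_nat_mono)
        then show ?thesis by simp
      qed
      moreover have "real c * real X \<le> real c * Y" by (intro mult_left_mono) (auto simp: Y_def)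
      moreover have "D * Y = 2 * (real c * Y) + 4 * (C * Y)"
        by (simp add: D_def algebra_simps)
      ultimately have "real t' \<le> D * Y"
      proof -
        assume a: "real tp \<le> C * Y" "real t' \<le> 2 * (real c * real X + 2 * real tp)"
          "real c * real X \<le> real c * Y" "D * Y = 2 * (real c * Y) + 4 * (C * Y)"
        note a(2)
        also have "2 * (real c * real X + 2 * real tp) \<le> 2 * (real c * Y + 2 * (C * Y))"
          by (rule mult_left_mono[OF add_mono[OF a(3) mult_left_mono[OF a(1)]]]) simp_all
        also have "\<dots> = D * Y" unfolding a(4) by simp
        finally show "real t' \<le> D * Y" .
      qed
      then show "\<exists>t m' out. exec ?p (m, []) t (m', out) \<and>
          real t \<le> D * max (f (card (states G) * M_of G \<Delta> \<rho>s) (card (edges G) * M_of G \<Delta> \<rho>s) (max_reward G \<rho>) (rdim \<rho>))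
             (real ((card (states G))\<^sup>2 * card (edges G) * (M_of G \<Delta> \<rho>s)\<^sup>2)) \<and>
          (if winning G (multi_objective G \<Delta> \<rho>s \<inter> reward_objective \<Psi> G \<rho>) s = {} then out = [0]
           else \<exists>d. out = 1 # d \<and> (\<exists>\<sigma> \<in> winning G (multi_objective G \<Delta> \<rho>s \<inter> reward_objective \<Psi> G \<rho>) s. describes (strategy_prog q) d G \<sigma>))"
        using m'(2) out unfolding out' Y_def F_def X_def by blast
    qed
  qed
  ultimately show ?thesis by blast
qed

end
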